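(* Let $K$ be a field of characteristic zero, $S=K[x_0,\ldots,x_n]$, and let $f_0,\ldots,f_n\in S$ be homogeneous polynomials with $\deg f_i=d_i$. Put $J=(f_0,\ldots,f_n)$ and suppose that $\dim S/J=1$ and that $f_1,\ldots,f_n$ is a regular sequence in $S$. Let $I$ be the saturation of $J$, and let $G,F\in\mathbb{Z}[t]$ be the polynomials with $H_{S/J}(t)=G/(1-t)$ and $H_{S/I}(t)=F/(1-t)$. Then $$G=(1-t^{d_0})\prod_{j=1}^n(1+t+\cdots+t^{d_j-1})+t^{\sum_{i=0}^n d_i-n}\,F(1/t).$$ Moreover, if $S/I$ is Gorenstein, then $$G=(1-t^{d_0})\prod_{j=1}^n(1+t+\cdots+t^{d_j-1})+t^{\sum_{i=0}^n d_i-n-\deg F}\,F.$$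
   Context: $S$ has the standard grading. The saturation of $J$ is $I=(J:\mathbf{m}^\infty)$ with $\mathbf{m}=(x_0,\ldots,x_n)$. For a finitely generated graded $S$-module $M$, $H_M(t)=\sum_p \dim_K(M_p)\,t^p$ is its Hilbert series. Since $\dim S/J=\dim S/I=1$, one has $H_{S/J}(t)=G/(1-t)$ and $H_{S/I}(t)=F/(1-t)$ with $G,F\in\mathbb{Z}[t]$, $G(1)\neq0$, $F(1)\neq 0$. *)

theory Defs
  imports
    "HOL-Algebra.Embedded_Algebras"
    "HOL-Algebra.Ideal_Product"
    "HOL-Algebra.Ring_Divisibility"
    "HOL-Algebra.Module"
    "HOL-Library.Extended_Nat"
    "HOL-Library.Poly_Mapping"
    "HOL-Computational_Algebra.Formal_Laurent_Series"
begin

section \<open>Graded polynomial rings\<close>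

text \<open>
  A polynomial in the variables \<open>x\<^sub>0, x\<^sub>1, \<dots>\<close> is a finitely supported map from exponent vectors
  \<open>nat \<Rightarrow>\<^sub>0 nat\<close> to coefficients; multiplication on \<open>\<Rightarrow>\<^sub>0\<close> is convolution.
  The ring \<open>K[x\<^sub>0, \<dots>, x\<^sub>n]\<close> consists of those polynomials that involve only \<open>x\<^sub>0, \<dots>, x\<^sub>n\<close>.
\<close>

type_synonym 'k mpoly = "(nat \<Rightarrow>\<^sub>0 nat) \<Rightarrow>\<^sub>0 'k"

definition mpoly_ring :: "nat \<Rightarrow> ('k::field) mpoly ring" where
  "mpoly_ring n =
    \<lparr> carrier = {p. \<forall>m \<in> Poly_Mapping.keys p. Poly_Mapping.keys m \<subseteq> {..n}},
      monoid.mult = (*), one = 1, zero = 0, add = (+) \<rparr>"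

definition mpoly_const :: "'k::field \<Rightarrow> 'k mpoly" where
  "mpoly_const c = Poly_Mapping.single 0 c"

definition mpoly_var :: "nat \<Rightarrow> ('k::field) mpoly" where
  "mpoly_var i = Poly_Mapping.single (Poly_Mapping.single i 1) 1"

definition total_deg :: "(nat \<Rightarrow>\<^sub>0 nat) \<Rightarrow> nat" where
  "total_deg m = (\<Sum>i \<in> Poly_Mapping.keys m. Poly_Mapping.lookup m i)"

text \<open>The graded component \<open>S\<^sub>p\<close>, that is, the homogeneous polynomials of degree \<open>p\<close> together with
  the zero polynomial.\<close>

definition homogeneous_part :: "nat \<Rightarrow> nat \<Rightarrow> ('k::field) mpoly set" where
  "homogeneous_part n p =
    {g \<in> carrier (mpoly_ring n). \<forall>m \<in> Poly_Mapping.keys g. total_deg m = p}"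

definition irrelevant_ideal :: "nat \<Rightarrow> ('k::field) mpoly set" where
  "irrelevant_ideal n = genideal (mpoly_ring n) (mpoly_var ` {..n})"

text \<open>\<open>dim\<^sub>K (S/J)\<^sub>p\<close> for a homogeneous ideal \<open>J\<close>: the field \<open>K\<close> and the graded component \<open>S\<^sub>p\<close> are
  replaced by their images in \<open>S/J\<close>. (If \<open>J \<noteq> S\<close>, then \<open>K\<close> embeds into \<open>S/J\<close>.)\<close>

definition hilbert_function :: "nat \<Rightarrow> ('k::field) mpoly set \<Rightarrow> nat \<Rightarrow> nat" where
  "hilbert_function n J p =
    ring.dim (mpoly_ring n Quot J)
      ((\<lambda>c. J +>\<^bsub>mpoly_ring n\<^esub> mpoly_const c) ` UNIV)
      ((\<lambda>g. J +>\<^bsub>mpoly_ring n\<^esub> g) ` homogeneous_part n p)"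

definition hilbert_series :: "nat \<Rightarrow> ('k::field) mpoly set \<Rightarrow> int fps" where
  "hilbert_series n J = Abs_fps (\<lambda>p. int (hilbert_function n J p))"

section \<open>Ideals, dimension, regular sequences\<close>

primrec ideal_power :: "('a, 'b) ring_scheme \<Rightarrow> 'a set \<Rightarrow> nat \<Rightarrow> 'a set" where
  "ideal_power R A 0 = carrier R"
| "ideal_power R A (Suc k) = ideal_prod R A (ideal_power R A k)"

definition colon_ideal :: "('a, 'b) ring_scheme \<Rightarrow> 'a set \<Rightarrow> 'a set \<Rightarrow> 'a set" where
  "colon_ideal R J A = {a \<in> carrier R. \<forall>b \<in> A. a \<otimes>\<^bsub>R\<^esub> b \<in> J}"

definition saturation :: "('a, 'b) ring_scheme \<Rightarrow> 'a set \<Rightarrow> 'a set \<Rightarrow> 'a set" where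
  "saturation R J A = (\<Union>k. colon_ideal R J (ideal_power R A k))"

text \<open>The supremum of the lengths \<open>k\<close> of chains \<open>P\<^sub>0 \<subset> \<dots> \<subset> P\<^sub>k\<close> of prime ideals. By this definition
  the zero ring has dimension \<open>0\<close>, instead of the customary \<open>-\<infinity>\<close>.\<close>

definition krull_dim :: "('a, 'b) ring_scheme \<Rightarrow> enat" where
  "krull_dim R =
    Sup {enat k | k. \<exists>P. (\<forall>i \<le> k. primeideal (P i) R) \<and> (\<forall>i < k. P i \<subset> P (Suc i))}"

definition regular_sequence :: "('a, 'b) ring_scheme \<Rightarrow> 'a list \<Rightarrow> bool" where
  "regular_sequence R xs \<longleftrightarrow>
    set xs \<subseteq> carrier R \<and>
    (\<forall>i < length xs. \<forall>a \<in> carrier R.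
       xs ! i \<otimes>\<^bsub>R\<^esub> a \<in> genideal R (set (take i xs)) \<longrightarrow> a \<in> genideal R (set (take i xs))) \<and>
    genideal R (set xs) \<noteq> carrier R"

section \<open>Gorenstein rings\<close>

subsection \<open>Localization\<close>

text \<open>The fraction \<open>r/s\<close> with denominators in the multiplicative set \<open>D\<close>, as an equivalence class of
  pairs.\<close>

definition fraction :: "('a, 'b) ring_scheme \<Rightarrow> 'a set \<Rightarrow> 'a \<Rightarrow> 'a \<Rightarrow> ('a \<times> 'a) set" where
  "fraction R D r s =
    {(r', s'). r' \<in> carrier R \<and> s' \<in> D \<and>
       (\<exists>u \<in> D. u \<otimes>\<^bsub>R\<^esub> (r \<otimes>\<^bsub>R\<^esub> s') = u \<otimes>\<^bsub>R\<^esub> (r' \<otimes>\<^bsub>R\<^esub> s))}"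

text \<open>The operations are computed on representatives; the unions below are unions of equal classes.\<close>

definition localization :: "('a, 'b) ring_scheme \<Rightarrow> 'a set \<Rightarrow> ('a \<times> 'a) set ring" where
  "localization R D =
    \<lparr> carrier = {fraction R D r s | r s. r \<in> carrier R \<and> s \<in> D},
      monoid.mult = (\<lambda>X Y. \<Union>(a, s) \<in> X. \<Union>(b, t) \<in> Y. fraction R D (a \<otimes>\<^bsub>R\<^esub> b) (s \<otimes>\<^bsub>R\<^esub> t)),
      one = fraction R D \<one>\<^bsub>R\<^esub> \<one>\<^bsub>R\<^esub>,
      zero = fraction R D \<zero>\<^bsub>R\<^esub> \<one>\<^bsub>R\<^esub>,
      add = (\<lambda>X Y. \<Union>(a, s) \<in> X. \<Union>(b, t) \<in> Y.
               fraction R D (a \<otimes>\<^bsub>R\<^esub> t \<oplus>\<^bsub>R\<^esub> b \<otimes>\<^bsub>R\<^esub> s) (s \<otimes>\<^bsub>R\<^esub> t)) \<rparr>"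

subsection \<open>Injective dimension\<close>

text \<open>The \<open>mult\<close> and \<open>one\<close> fields of a module record are not used by \<^locale>\<open>module\<close>.\<close>

definition self_module :: "('a, 'b) ring_scheme \<Rightarrow> ('a, 'a) module" where
  "self_module R =
    \<lparr> carrier = carrier R, monoid.mult = monoid.mult R, one = \<one>\<^bsub>R\<^esub>, zero = \<zero>\<^bsub>R\<^esub>, add = add R,
      module.smult = monoid.mult R \<rparr>"

definition mod_hom ::
  "('a, 'b) ring_scheme \<Rightarrow> ('a, 'm, 'c) module_scheme \<Rightarrow> ('a, 'n, 'd) module_scheme \<Rightarrow> ('m \<Rightarrow> 'n) set"
where
  "mod_hom R M N =
    {h \<in> carrier M \<rightarrow> carrier N.
       (\<forall>x \<in> carrier M. \<forall>y \<in> carrier M. h (x \<oplus>\<^bsub>M\<^esub> y) = h x \<oplus>\<^bsub>N\<^esub> h y) \<and>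
       (\<forall>a \<in> carrier R. \<forall>x \<in> carrier M. h (a \<odot>\<^bsub>M\<^esub> x) = a \<odot>\<^bsub>N\<^esub> h x)}"

text \<open>\<open>E\<close> is injective if homomorphisms into \<open>E\<close> extend from submodules \<open>A\<close> to modules \<open>B\<close>.
  HOL cannot quantify over modules \<open>B\<close> of all types; here \<open>B\<close> ranges over the modules
  on the type of \<open>R\<close>. These include \<open>R\<close> itself, so by Baer's criterion
  extension along them implies extension along all inclusions.\<close>

definition injective_module :: "('a, 'b) ring_scheme \<Rightarrow> ('a, 'm) module \<Rightarrow> bool" where
  "injective_module R E \<longleftrightarrow>
    module R E \<and>
    (\<forall>(B :: ('a, 'a) module) A h.
       module R B \<and> submodule A R B \<and> h \<in> mod_hom R (B\<lparr>carrier := A\<rparr>) E \<longrightarrow>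
       (\<exists>g \<in> mod_hom R B E. \<forall>x \<in> A. g x = h x))"

definition injective_resolution ::
  "('a, 'b) ring_scheme \<Rightarrow> ('a, 'm) module \<Rightarrow> (nat \<Rightarrow> ('a, 'e) module) \<Rightarrow>
     ('m \<Rightarrow> 'e) \<Rightarrow> (nat \<Rightarrow> 'e \<Rightarrow> 'e) \<Rightarrow> bool"
where
  "injective_resolution R M E \<epsilon> \<delta> \<longleftrightarrow>
    module R M \<and>
    (\<forall>i. injective_module R (E i)) \<and>
    \<epsilon> \<in> mod_hom R M (E 0) \<and> inj_on \<epsilon> (carrier M) \<and>
    (\<forall>i. \<delta> i \<in> mod_hom R (E i) (E (Suc i))) \<and>
    \<epsilon> ` carrier M = a_kernel (E 0) (E 1) (\<delta> 0) \<and>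
    (\<forall>i. \<delta> i ` carrier (E i) = a_kernel (E (Suc i)) (E (Suc (Suc i))) (\<delta> (Suc i)))"

text \<open>Finite injective dimension of \<open>R\<close> as a module over itself. The members of the resolution live on
  the type \<open>nat \<Rightarrow> 'a\<close>. This is no restriction for Noetherian \<open>R\<close>: the terms of the
  minimal injective resolution of \<open>R\<close> have at most \<open>max |R| \<aleph>\<^sub>0\<close> elements.\<close>

definition finite_self_injective_dimension :: "('a, 'b) ring_scheme \<Rightarrow> bool" where
  "finite_self_injective_dimension R \<longleftrightarrow>
    (\<exists>(E :: nat \<Rightarrow> ('a, nat \<Rightarrow> 'a) module) \<epsilon> \<delta> d.
       injective_resolution R (self_module R) E \<epsilon> \<delta> \<and>
       (\<forall>i > d. carrier (E i) = {\<zero>\<^bsub>E i\<^esub>}))"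

text \<open>A Noetherian local ring is Gorenstein if it has finite injective dimension over itself; a
  Noetherian ring is Gorenstein if its localizations at all maximal ideals are.\<close>

definition gorenstein_ring :: "('a, 'b) ring_scheme \<Rightarrow> bool" where
  "gorenstein_ring R \<longleftrightarrow>
    cring R \<and> noetherian_ring R \<and>
    (\<forall>P. maximalideal P R \<longrightarrow>
       finite_self_injective_dimension (localization R (carrier R - P)))"

text \<open>\<open>F(1/t)\<close> is the case \<open>z = fls_X_inv\<close>.\<close>

definition laurent_eval :: "int poly \<Rightarrow> int fls \<Rightarrow> int fls" where
  "laurent_eval F z = poly (map_poly of_int F) z"

end

theory Submission
  imports Defs
begin

text \<open>
  Let \<open>Q = (f\<^sub>1, \<dots>, f\<^sub>n)\<close>, \<open>W = (Q : f\<^sub>0)\<close> and let \<open>z\<close> be a linear form that is regular modulo \<open>Q\<close>;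
  it is then regular modulo \<open>W\<close> and modulo \<open>I\<close>. The ring \<open>S/(Q + z)\<close> is a graded Artinian complete
  intersection, hence has a one-dimensional socle, in degree \<open>a = \<Sum>(d\<^sub>j - 1)\<close>. Since \<open>W I \<subseteq> Q\<close>, the
  perfect pairing of the degrees \<open>p\<close> and \<open>a - p\<close> bounds the Hilbert function of \<open>S/(Q + z)\<close> at \<open>p\<close> by
  that of \<open>S/(W + z)\<close> at \<open>p\<close> plus that of \<open>S/(I + z)\<close> at \<open>a - p\<close>. The exact sequence
  \<open>0 \<rightarrow> S/W \<rightarrow> S/Q \<rightarrow> S/J \<rightarrow> 0\<close> shows that both sides have the same sum over \<open>p\<close>, so they agree, which
  is the first formula.

  The socle of \<open>S/(Q + z)\<close> is computed by exchange: if \<open>g\<close> and \<open>h\<close> are regular modulo \<open>A\<close>, the socles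
  of \<open>S/(A + g)\<close> and \<open>S/(A + h)\<close> are isomorphic through \<open>g y \<equiv> h x\<close> modulo \<open>A\<close>. Hence every homogeneous
  regular sequence can be compared with \<open>x\<^sub>0, \<dots>, x\<^sub>n\<close>.

  If \<open>S/I\<close> is Gorenstein, then a finite injective resolution of its localization at the irrelevant
  ideal forces the socle of \<open>S/(I + z)\<close> to be one-dimensional, so that the coefficients of \<open>F\<close> are
  symmetric.
\<close>

section \<open>Polynomials, homogeneous components and ideals\<close>

text \<open>The equality of sums is one of multiplicities: modulo \<open>z\<close> each sum
  telescopes to the stable value of a Hilbert function, the stable value for \<open>Q\<close> is the
  sum of those for \<open>J\<close> and \<open>W\<close>, and \<open>J\<close> and \<open>I\<close>
  agree in high degrees. The duality of linked ideals is thus replaced by a dimension count, one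
  inequality per degree and one equality of totals, with no Ext and no canonical module.
  Characteristic zero supplies infinitely many scalars t, hence infinitely many forms x_0 + t x_1 +
  ... + t^n x_n, of which only finitely many are zero divisors when the socle vanishes. The
  injective resolution in the Gorenstein case is not assumed minimal, nor of any prescribed length.
  Its finiteness starts a descending induction: an extension property, trivial for the zero module
  beyond the last term, passes back to the first cosyzygy. There it produces a ring element that
  acts on two independent socle elements of R/z as 1 and as 0, whereas over a local ring every
  element acts on the socle as a scalar from the residue field.\<close>

abbreviation "keys \<equiv> Poly_Mapping.keys"
abbreviation "lookup \<equiv> Poly_Mapping.lookup"
abbreviation "monomial \<equiv> Poly_Mapping.single"

definition polys :: "nat \<Rightarrow> 'k::field mpoly set" where
  "polys n = {p. \<forall>m \<in> keys p. keys m \<subseteq> {..n}}"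

lemma mpoly_ring_simps [simp]:
  "carrier (mpoly_ring n) = polys n"
  "x \<otimes>\<^bsub>mpoly_ring n\<^esub> y = x * y"
  "x \<oplus>\<^bsub>mpoly_ring n\<^esub> y = x + y"
  "\<one>\<^bsub>mpoly_ring n\<^esub> = 1"
  "\<zero>\<^bsub>mpoly_ring n\<^esub> = 0"
  by (auto simp: mpoly_ring_def polys_def)

lemma total_deg_eq_sum:
  assumes "keys m \<subseteq> D" "finite D"
  shows "total_deg m = (\<Sum>i\<in>D. lookup m i)"
  unfolding total_deg_def
  by (rule sum.mono_neutral_left) (use assms in \<open>auto simp: in_keys_iff\<close>)

lemma total_deg_add: "total_deg (m + m') = total_deg m + total_deg m'"
proof -
  let ?D = "keys m \<union> keys m'"
  have "keys (m + m') \<subseteq> ?D" by (rule Poly_Mapping.keys_add)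
  then show ?thesis
    using total_deg_eq_sum[of "m + m'" ?D] total_deg_eq_sum[of m ?D] total_deg_eq_sum[of m' ?D]
    by (simp add: lookup_add sum.distrib)
qed

lemma total_deg_0 [simp]: "total_deg 0 = 0"
  by (simp add: total_deg_def)

lemma total_deg_single [simp]: "total_deg (monomial i k) = k"
  by (simp add: total_deg_def)

lemma total_deg_eq_0_iff: "total_deg m = 0 \<longleftrightarrow> m = 0"
proof
  assume "total_deg m = 0"
  then have "\<And>i. i \<in> keys m \<Longrightarrow> lookup m i = 0"
    by (simp add: total_deg_def)
  then show "m = 0" by (metis in_keys_iff keys_eq_empty equals0I)
qed simp

lemma polys_0 [simp]: "0 \<in> polys n"
  and polys_1 [simp]: "1 \<in> polys n"
  by (auto simp: polys_def)

lemma polys_add [simp]: "x \<in> polys n \<Longrightarrow> y \<in> polys n \<Longrightarrow> x + y \<in> polys n"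
  using Poly_Mapping.keys_add[of x y] by (auto simp: polys_def)

lemma polys_uminus [simp]: "x \<in> polys n \<Longrightarrow> - x \<in> polys n"
  by (auto simp: polys_def in_keys_iff)

lemma polys_diff [simp]: "x \<in> polys n \<Longrightarrow> y \<in> polys n \<Longrightarrow> x - y \<in> polys n"
  using polys_add[of x n "- y"] by simp

lemma polys_mult [simp]:
  assumes "x \<in> polys n" "y \<in> polys n" shows "x * y \<in> polys n"
proof -
  have "i \<in> {..n}" if m: "m \<in> keys (x * y)" and i: "i \<in> keys m" for m i
  proof -
    obtain a b where ab: "a \<in> keys x" "b \<in> keys y" "m = a + b"
      using m keys_mult[of x y] by auto
    with i Poly_Mapping.keys_add[of a b] have "i \<in> keys a \<union> keys b" by auto
    with ab assms show "i \<in> {..n}" by (auto simp: polys_def)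
  qed
  then show ?thesis by (auto simp: polys_def)
qed

lemma polys_single: "keys m \<subseteq> {..n} \<Longrightarrow> monomial m c \<in> polys n"
  by (auto simp: polys_def split: if_splits)

lemma polys_const [simp]: "mpoly_const c \<in> polys n"
  by (simp add: mpoly_const_def polys_single)

lemma cring_mpoly_ring: "cring (mpoly_ring n :: 'k::field mpoly ring)"
proof (rule cringI)
  show "abelian_group (mpoly_ring n :: 'k mpoly ring)"
  proof (rule abelian_groupI)
    fix x :: "'k mpoly" assume "x \<in> carrier (mpoly_ring n)"
    then show "\<exists>y\<in>carrier (mpoly_ring n). y \<oplus>\<^bsub>mpoly_ring n\<^esub> x = \<zero>\<^bsub>mpoly_ring n\<^esub>"
      by (intro bexI[of _ "- x"]) auto
  qed (auto simp: add_ac)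
  show "comm_monoid (mpoly_ring n :: 'k mpoly ring)"
    by (rule comm_monoidI) (auto simp: mult_ac)
qed (auto simp: algebra_simps)

interpretation mpoly: cring "mpoly_ring n" for n
  by (rule cring_mpoly_ring)

lemma mpoly_a_inv [simp]: "x \<in> polys n \<Longrightarrow> \<ominus>\<^bsub>mpoly_ring n\<^esub> x = - x"
  by (rule mpoly.minus_equality) auto

lemma mpoly_a_minus [simp]: "x \<in> polys n \<Longrightarrow> y \<in> polys n \<Longrightarrow> x \<ominus>\<^bsub>mpoly_ring n\<^esub> y = x - y"
  by (simp add: a_minus_def)

text \<open>Ideals in the type-class operations of polynomials, so that ideal arithmetic is left to
  \<open>simp\<close> and \<open>algebra_simps\<close>; \<open>ideal_iff_is_ideal\<close> links them
  to the record-based notion.\<close>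

definition is_ideal :: "nat \<Rightarrow> 'k::field mpoly set \<Rightarrow> bool" where
  "is_ideal n A \<longleftrightarrow> A \<subseteq> polys n \<and> 0 \<in> A \<and> (\<forall>x\<in>A. \<forall>y\<in>A. x + y \<in> A) \<and> (\<forall>x\<in>A. \<forall>r\<in>polys n. r * x \<in> A)"

lemma idlD:
  assumes "is_ideal n A"
  shows "x \<in> A \<Longrightarrow> x \<in> polys n" "0 \<in> A" "x \<in> A \<Longrightarrow> y \<in> A \<Longrightarrow> x + y \<in> A"
    "x \<in> A \<Longrightarrow> r \<in> polys n \<Longrightarrow> r * x \<in> A" "x \<in> A \<Longrightarrow> r \<in> polys n \<Longrightarrow> x * r \<in> A"
  using assms by (auto simp: is_ideal_def mult.commute)

lemma is_ideal_uminus: "is_ideal n A \<Longrightarrow> x \<in> A \<Longrightarrow> - x \<in> A"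
  using idlD(4)[of n A x "- 1"] by simp

lemma is_ideal_diff: "is_ideal n A \<Longrightarrow> x \<in> A \<Longrightarrow> y \<in> A \<Longrightarrow> x - y \<in> A"
  using idlD(3)[of n A x "- y"] is_ideal_uminus[of n A y] by simp

lemma is_ideal_sum: "is_ideal n A \<Longrightarrow> (\<And>i. i \<in> D \<Longrightarrow> f i \<in> A) \<Longrightarrow> sum f D \<in> A"
  by (induction D rule: infinite_finite_induct) (auto simp: idlD)

lemma ideal_iff_is_ideal: "ideal A (mpoly_ring n) \<longleftrightarrow> is_ideal n A"
proof
  assume A: "ideal A (mpoly_ring n)"
  then interpret ideal A "mpoly_ring n" .
  show "is_ideal n A"
    unfolding is_ideal_def using a_subset I_l_closed a_closed zero_closed by auto
next
  assume A: "is_ideal n A"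
  show "ideal A (mpoly_ring n)"
  proof (rule idealI)
    show "ring (mpoly_ring n)" ..
    show "subgroup A (add_monoid (mpoly_ring n))"
    proof (rule mpoly.add.subgroupI)
      fix a assume a: "a \<in> A"
      then have "a \<in> polys n" using A by (auto simp: idlD)
      then show "\<ominus>\<^bsub>mpoly_ring n\<^esub> a \<in> A" using a A by (simp add: is_ideal_uminus)
    qed (use A in \<open>auto simp: is_ideal_def\<close>)
  qed (use A in \<open>auto simp: is_ideal_def mult.commute\<close>)
qed

section \<open>Homogeneous components of polynomials\<close>

definition hcomp :: "nat \<Rightarrow> ('k::field) mpoly \<Rightarrow> 'k mpoly" where
  "hcomp q p = Abs_poly_mapping (\<lambda>m. if total_deg m = q then lookup p m else 0)"

lemma lookup_hcomp: "lookup (hcomp q p) m = (if total_deg m = q then lookup p m else 0)"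
proof -
  have "finite {m. (if total_deg m = q then lookup p m else 0) \<noteq> 0}"
    by (rule finite_subset[OF _ finite_keys[of p]]) (auto simp: in_keys_iff)
  then show ?thesis by (simp add: hcomp_def)
qed

lemma hcomp_0 [simp]: "hcomp q 0 = 0"
  by (rule poly_mapping_eqI) (simp add: lookup_hcomp)

lemma hcomp_add: "hcomp q (x + y) = hcomp q x + hcomp q y"
  by (rule poly_mapping_eqI) (simp add: lookup_hcomp lookup_add)

lemma hcomp_diff: "hcomp q (x - y) = hcomp q x - hcomp q y"
  by (rule poly_mapping_eqI) (simp add: lookup_hcomp lookup_minus)

lemma hcomp_sum: "hcomp q (sum f D) = (\<Sum>i\<in>D. hcomp q (f i))"
  by (induction D rule: infinite_finite_induct) (auto simp: hcomp_add)

lemma homogeneous_iff: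
  "x \<in> homogeneous_part n p \<longleftrightarrow> x \<in> polys n \<and> (\<forall>m\<in>keys x. total_deg m = p)"
  by (simp add: homogeneous_part_def)

lemma homogeneous_polys [simp]: "x \<in> homogeneous_part n p \<Longrightarrow> x \<in> polys n"
  by (simp add: homogeneous_iff)

lemma hcomp_homogeneous [simp]: "x \<in> polys n \<Longrightarrow> hcomp q x \<in> homogeneous_part n q"
  by (auto simp: homogeneous_iff polys_def in_keys_iff lookup_hcomp split: if_splits)

lemma hcomp_polys [simp]: "x \<in> polys n \<Longrightarrow> hcomp q x \<in> polys n"
  using hcomp_homogeneous homogeneous_polys by blast

lemma hcomp_of_homogeneous:
  "x \<in> homogeneous_part n p \<Longrightarrow> hcomp q x = (if p = q then x else 0)"
  by (intro poly_mapping_eqI) (auto simp: homogeneous_iff lookup_hcomp in_keys_iff)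

lemma homogeneous_eq_hcomp: "x \<in> homogeneous_part n p \<longleftrightarrow> x \<in> polys n \<and> hcomp p x = x"
  by (metis hcomp_homogeneous hcomp_of_homogeneous homogeneous_polys)

lemma homogeneous_0 [simp]: "0 \<in> homogeneous_part n p"
  by (simp add: homogeneous_eq_hcomp)

lemma homogeneous_add:
  "x \<in> homogeneous_part n p \<Longrightarrow> y \<in> homogeneous_part n p \<Longrightarrow> x + y \<in> homogeneous_part n p"
  by (simp add: homogeneous_eq_hcomp hcomp_add)

lemma homogeneous_diff:
  "x \<in> homogeneous_part n p \<Longrightarrow> y \<in> homogeneous_part n p \<Longrightarrow> x - y \<in> homogeneous_part n p"
  by (simp add: homogeneous_eq_hcomp hcomp_diff)

lemma homogeneous_sum:
  "(\<And>i. i \<in> D \<Longrightarrow> f i \<in> homogeneous_part n p) \<Longrightarrow> sum f D \<in> homogeneous_part n p"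
  by (induction D rule: infinite_finite_induct) (auto simp: homogeneous_add)

lemma homogeneous_mult:
  assumes "x \<in> homogeneous_part n p" "y \<in> homogeneous_part n q"
  shows "x * y \<in> homogeneous_part n (p + q)"
  unfolding homogeneous_iff
proof (intro conjI ballI)
  fix m assume "m \<in> keys (x * y)"
  then obtain a b where "a \<in> keys x" "b \<in> keys y" "m = a + b"
    using keys_mult[of x y] by auto
  then show "total_deg m = p + q" using assms by (auto simp: homogeneous_iff total_deg_add)
qed (use assms in auto)

lemma homogeneous_const [simp]: "mpoly_const c \<in> homogeneous_part n 0"
  unfolding homogeneous_iff using polys_const[of c n] by (auto simp: mpoly_const_def split: if_splits)

lemma homogeneous_const_mult:
  "x \<in> homogeneous_part n p \<Longrightarrow> mpoly_const c * x \<in> homogeneous_part n p"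
  using homogeneous_mult[of "mpoly_const c" n 0 x p] by simp

lemma homogeneous_1: "1 \<in> homogeneous_part n 0"
  using homogeneous_const[of 1 n] by (simp add: mpoly_const_def)

lemma homogeneous_0_iff: "x \<in> homogeneous_part n 0 \<longleftrightarrow> (\<exists>c. x = mpoly_const c)"
proof
  assume "x \<in> homogeneous_part n 0"
  then have "m \<noteq> 0 \<Longrightarrow> lookup x m = 0" for m
    by (auto simp: homogeneous_iff total_deg_eq_0_iff in_keys_iff)
  then have "x = mpoly_const (lookup x 0)"
    by (intro poly_mapping_eqI) (auto simp: mpoly_const_def lookup_single when_def)
  then show "\<exists>c. x = mpoly_const c" ..
qed auto

lemma homogeneous_var: "i \<le> n \<Longrightarrow> mpoly_var i \<in> homogeneous_part n 1"
  by (auto simp: homogeneous_iff mpoly_var_def polys_single)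

lemma sum_hcomp:
  assumes "finite D" "total_deg ` keys x \<subseteq> D"
  shows "(\<Sum>q\<in>D. hcomp q x) = x"
proof (rule poly_mapping_eqI)
  fix m
  have "lookup x m = 0" if "total_deg m \<notin> D"
    using assms(2) that by (metis image_eqI in_keys_iff subsetD)
  then show "lookup (\<Sum>q\<in>D. hcomp q x) m = lookup x m"
    using assms(1) by (auto simp: lookup_sum lookup_hcomp)
qed

lemma sum_hcomp': "(\<Sum>q\<in>total_deg ` keys x. hcomp q x) = x"
  by (rule sum_hcomp) auto

lemma hcomp_mult:
  assumes "x \<in> polys n" "y \<in> homogeneous_part n e"
  shows "hcomp q (x * y) = (if e \<le> q then hcomp (q - e) x * y else 0)"
proof -
  \<comment> \<open>The index \<open>q - e\<close> is inserted because it need not be the degree of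
    a monomial of \<open>x\<close>; \<open>sum.delta\<close> then applies in every case.\<close>
  let ?D = "insert (q - e) (total_deg ` keys x)"
  have "x * y = (\<Sum>i\<in>?D. hcomp i x * y)"
    by (subst sum_hcomp[of ?D x, symmetric]) (auto simp: sum_distrib_right)
  then have "hcomp q (x * y) = (\<Sum>i\<in>?D. hcomp q (hcomp i x * y))"
    by (simp add: hcomp_sum)
  also have "\<dots> = (\<Sum>i\<in>?D. if i + e = q then hcomp i x * y else 0)"
    by (intro sum.cong refl hcomp_of_homogeneous homogeneous_mult) (use assms in auto)
  also have "\<dots> = (\<Sum>i\<in>?D. if i = q - e then (if e \<le> q then hcomp i x * y else 0) else 0)"
    by (intro sum.cong) auto
  also have "\<dots> = (if e \<le> q then hcomp (q - e) x * y else 0)"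
    by (subst sum.delta) auto
  finally show ?thesis .
qed

lemma sum_monomials: "(\<Sum>m\<in>keys x. monomial m (lookup x m)) = x"
  by (rule poly_mapping_eqI)
    (auto simp: lookup_sum lookup_single when_def in_keys_iff sum.delta)

lemma monomial_decompose:
  fixes c :: "'k::field"
  assumes "lookup m i > 0"
  shows "monomial m c = mpoly_var i * monomial (m - monomial i 1) c"
proof -
  have "m = monomial i 1 + (m - monomial i 1)"
    using assms by (intro poly_mapping_eqI) (auto simp: lookup_add lookup_minus lookup_single when_def)
  then show ?thesis by (simp add: mpoly_var_def mult_single)
qed

text \<open>A monomial of positive degree is divisible by some variable, so S_(p+1) is spanned by
  the products x_i y with y in S_p. As an induction rule this serves spans, ideals and powers of the
  maximal ideal alike.\<close>

lemma homogeneous_Suc_induct [consumes 1, case_names zero add mult]: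
  assumes x: "x \<in> homogeneous_part n (Suc p)"
    and zero: "0 \<in> A"
    and add: "\<And>u v. u \<in> A \<Longrightarrow> v \<in> A \<Longrightarrow> u + v \<in> A"
    and mult: "\<And>i y. i \<le> n \<Longrightarrow> y \<in> homogeneous_part n p \<Longrightarrow> mpoly_var i * y \<in> A"
  shows "x \<in> A"
proof -
  have mono: "monomial m c \<in> A" if m: "m \<in> keys x" for m c
  proof -
    have deg: "total_deg m = Suc p" "keys m \<subseteq> {..n}"
      using x m by (auto simp: homogeneous_iff polys_def)
    then have "m \<noteq> 0" by auto
    then obtain i where i: "i \<in> keys m" by (metis keys_eq_empty all_not_in_conv)
    let ?m = "m - monomial i 1"
    have m_eq: "m = monomial i 1 + ?m"
      using i by (intro poly_mapping_eqI) (auto simp: lookup_add lookup_minus lookup_single when_def in_keys_iff)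
    have "total_deg ?m = p"
      using deg(1) arg_cong[OF m_eq, of total_deg] by (simp add: total_deg_add)
    moreover have "keys ?m \<subseteq> {..n}"
    proof
      fix j assume "j \<in> keys ?m"
      then have "j \<in> keys m" by (auto simp: in_keys_iff lookup_minus)
      then show "j \<in> {..n}" using deg(2) by blast
    qed
    ultimately have "monomial ?m c \<in> homogeneous_part n p"
      by (auto simp: homogeneous_iff polys_single split: if_splits)
    moreover have "i \<le> n" using i deg(2) by auto
    moreover have "monomial m c = mpoly_var i * monomial ?m c"
      using i by (intro monomial_decompose) (simp add: in_keys_iff)
    ultimately show ?thesis using mult by simp
  qed
  have "(\<Sum>m\<in>D. monomial m (lookup x m)) \<in> A" if "D \<subseteq> keys x" for D
    using finite_subset[OF that finite_keys] that
    by (induction D rule: finite_induct) (auto simp: zero add mono)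
  from this[of "keys x"] show ?thesis by (simp add: sum_monomials)
qed

section \<open>Homogeneous ideals, the sum A + gS and the colon ideal (A : g)\<close>

definition homogeneous_ideal :: "nat \<Rightarrow> 'k::field mpoly set \<Rightarrow> bool" where
  "homogeneous_ideal n A \<longleftrightarrow> is_ideal n A \<and> (\<forall>x\<in>A. \<forall>q. hcomp q x \<in> A)"

lemma homogeneous_ideal_is_ideal: "homogeneous_ideal n A \<Longrightarrow> is_ideal n A"
  and homogeneous_ideal_hcomp: "homogeneous_ideal n A \<Longrightarrow> x \<in> A \<Longrightarrow> hcomp q x \<in> A"
  by (auto simp: homogeneous_ideal_def)

lemma homogeneous_ideal_subsetI:
  assumes "homogeneous_ideal n A" "is_ideal n B" "\<And>x p. x \<in> A \<Longrightarrow> x \<in> homogeneous_part n p \<Longrightarrow> x \<in> B"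
  shows "A \<subseteq> B"
proof
  fix x assume x: "x \<in> A"
  then have "hcomp q x \<in> B" for q
    using assms by (meson hcomp_homogeneous homogeneous_ideal_hcomp homogeneous_ideal_is_ideal idlD(1))
  then show "x \<in> B" using is_ideal_sum[OF assms(2), of "total_deg ` keys x" "\<lambda>q. hcomp q x"]
    by (simp add: sum_hcomp')
qed

definition adjoin :: "nat \<Rightarrow> 'k::field mpoly set \<Rightarrow> 'k mpoly \<Rightarrow> 'k mpoly set" where
  "adjoin n A g = {a + g * r | a r. a \<in> A \<and> r \<in> polys n}"

definition colon :: "nat \<Rightarrow> 'k::field mpoly set \<Rightarrow> 'k mpoly \<Rightarrow> 'k mpoly set" where
  "colon n A g = {x \<in> polys n. g * x \<in> A}"

lemma adjI: "a \<in> A \<Longrightarrow> r \<in> polys n \<Longrightarrow> a + g * r \<in> adjoin n A g"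
  by (auto simp: adjoin_def)

lemma adjoin_mult: "is_ideal n A \<Longrightarrow> r \<in> polys n \<Longrightarrow> g * r \<in> adjoin n A g"
  using adjI[of 0 A r n g] by (auto simp: idlD)

lemma adjoin_self: "is_ideal n A \<Longrightarrow> g \<in> adjoin n A g"
  using adjoin_mult[of n A 1 g] by auto

lemma adjoin_superset: "A \<subseteq> adjoin n A g"
  using adjI[of _ A 0 n g] by force

lemma is_ideal_adjoin:
  assumes A: "is_ideal n A" and g: "g \<in> polys n"
  shows "is_ideal n (adjoin n A g)"
proof -
  have "x + y \<in> adjoin n A g" if "x \<in> adjoin n A g" "y \<in> adjoin n A g" for x y
  proof -
    obtain a r b s where "x = a + g * r" "y = b + g * s" "a \<in> A" "b \<in> A" "r \<in> polys n" "s \<in> polys n"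
      using \<open>x \<in> adjoin n A g\<close> \<open>y \<in> adjoin n A g\<close> by (auto simp: adjoin_def)
    then show ?thesis
      using adjI[of "a + b" A "r + s" n g] A by (simp add: idlD algebra_simps)
  qed
  moreover have "s * x \<in> adjoin n A g" if "x \<in> adjoin n A g" "s \<in> polys n" for x s
  proof -
    obtain a r where "x = a + g * r" "a \<in> A" "r \<in> polys n"
      using \<open>x \<in> adjoin n A g\<close> by (auto simp: adjoin_def)
    then show ?thesis
      using adjI[of "s * a" A "s * r" n g] A that by (simp add: idlD algebra_simps)
  qed
  moreover have "adjoin n A g \<subseteq> polys n" using A g by (auto simp: adjoin_def idlD)
  moreover have "0 \<in> adjoin n A g" using A adjoin_superset[of A n g] by (auto simp: idlD)
  ultimately show ?thesis by (auto simp: is_ideal_def)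
qed

lemma adjoin_least: "is_ideal n B \<Longrightarrow> A \<subseteq> B \<Longrightarrow> g \<in> B \<Longrightarrow> adjoin n A g \<subseteq> B"
  by (auto simp: adjoin_def idlD)

text \<open>Components of a + g r are computed termwise. For q < e the cofactor must vanish, so
  \<open>{0}\<close> replaces \<open>homogeneous_part n (q - e)\<close>, which truncated subtraction
  would turn into the constants.\<close>

lemma hcomp_adjoin:
  assumes A: "homogeneous_ideal n A" and g: "g \<in> homogeneous_part n e" and x: "x \<in> adjoin n A g"
  shows "\<exists>a\<in>A \<inter> homogeneous_part n q. \<exists>r\<in>(if e \<le> q then homogeneous_part n (q - e) else {0}).
           hcomp q x = a + g * r"
proof -
  obtain a r where ar: "x = a + g * r" "a \<in> A" "r \<in> polys n" using x by (auto simp: adjoin_def)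
  have "a \<in> polys n" using A ar(2) by (meson homogeneous_ideal_is_ideal idlD(1))
  then have "hcomp q a \<in> A \<inter> homogeneous_part n q" using A ar by (auto simp: homogeneous_ideal_hcomp)
  moreover have "hcomp q x = hcomp q a + g * (if e \<le> q then hcomp (q - e) r else 0)"
    using hcomp_mult[OF ar(3) g, of q] by (auto simp: ar(1) hcomp_add mult.commute)
  moreover have "(if e \<le> q then hcomp (q - e) r else 0) \<in> (if e \<le> q then homogeneous_part n (q - e) else {0})"
    using ar(3) by auto
  ultimately show ?thesis by blast
qed

lemma homogeneous_ideal_adjoin:
  assumes A: "homogeneous_ideal n A" and g: "g \<in> homogeneous_part n e"
  shows "homogeneous_ideal n (adjoin n A g)"
  unfolding homogeneous_ideal_def
proof (intro conjI ballI allI)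
  show "is_ideal n (adjoin n A g)" using assms by (auto intro: is_ideal_adjoin simp: homogeneous_ideal_is_ideal)
  fix x q assume "x \<in> adjoin n A g"
  from hcomp_adjoin[OF assms this, of q] obtain a r where "a \<in> A" "r \<in> polys n" "hcomp q x = a + g * r"
    by (metis IntD1 homogeneous_polys polys_0 singletonD)
  then show "hcomp q x \<in> adjoin n A g" by (simp add: adjI)
qed

lemma adjoin_homogeneous_iff:
  assumes A: "homogeneous_ideal n A" and g: "g \<in> homogeneous_part n e"
  shows "x \<in> adjoin n A g \<inter> homogeneous_part n q \<longleftrightarrow>
    (\<exists>a\<in>A \<inter> homogeneous_part n q. \<exists>r\<in>(if e \<le> q then homogeneous_part n (q - e) else {0}). x = a + g * r)"
    (is "?L \<longleftrightarrow> ?R")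
proof
  assume ?L
  then have "hcomp q x = x" "x \<in> adjoin n A g" by (auto simp: homogeneous_eq_hcomp)
  with hcomp_adjoin[OF assms, of x q] show ?R by simp
next
  assume ?R
  then obtain a r where ar: "a \<in> A" "a \<in> homogeneous_part n q" "x = a + g * r"
      "r \<in> (if e \<le> q then homogeneous_part n (q - e) else {0})" by auto
  have "r \<in> polys n" using ar(4) by (auto split: if_splits)
  then have "x \<in> adjoin n A g" using ar by (auto simp: adjI)
  moreover have "g * r \<in> homogeneous_part n q"
    using ar(4) homogeneous_mult[OF g, of r "q - e"] by (auto split: if_splits)
  ultimately show ?L using ar by (auto simp: homogeneous_add)
qed

lemma is_ideal_colon: "is_ideal n A \<Longrightarrow> g \<in> polys n \<Longrightarrow> is_ideal n (colon n A g)"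
  by (auto simp: is_ideal_def colon_def distrib_left mult.left_commute[of g])

lemma colon_superset: "is_ideal n A \<Longrightarrow> g \<in> polys n \<Longrightarrow> A \<subseteq> colon n A g"
  by (auto simp: colon_def idlD)

lemma homogeneous_ideal_colon:
  assumes A: "homogeneous_ideal n A" and g: "g \<in> homogeneous_part n e"
  shows "homogeneous_ideal n (colon n A g)"
  unfolding homogeneous_ideal_def
proof (intro conjI ballI allI)
  show "is_ideal n (colon n A g)" using assms by (auto intro: is_ideal_colon simp: homogeneous_ideal_is_ideal)
  fix x q assume x: "x \<in> colon n A g"
  then have "hcomp (q + e) (x * g) \<in> A" using A by (auto simp: colon_def homogeneous_ideal_hcomp mult.commute)
  moreover have "hcomp (q + e) (x * g) = hcomp q x * g"
    using hcomp_mult[OF _ g, of x "q + e"] x by (auto simp: colon_def)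
  ultimately show "hcomp q x \<in> colon n A g" using x by (auto simp: colon_def mult.commute)
qed

text \<open>Adds one generator at a time, so that properties of finitely generated ideals follow by
  induction from those of \<open>adjoin\<close>.\<close>

lemma genideal_insert:
  assumes "X \<subseteq> polys n" "g \<in> polys n"
  shows "genideal (mpoly_ring n) (insert g X) = adjoin n (genideal (mpoly_ring n) X) g"
proof
  have X: "ideal (genideal (mpoly_ring n) X) (mpoly_ring n)"
    by (rule mpoly.genideal_ideal) (use assms in auto)
  have gX: "ideal (genideal (mpoly_ring n) (insert g X)) (mpoly_ring n)"
    by (rule mpoly.genideal_ideal) (use assms in auto)
  have sub: "X \<subseteq> genideal (mpoly_ring n) X" "insert g X \<subseteq> genideal (mpoly_ring n) (insert g X)"
    by (rule mpoly.genideal_self; use assms in auto)+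
  show "genideal (mpoly_ring n) (insert g X) \<subseteq> adjoin n (genideal (mpoly_ring n) X) g"
    using X sub adjoin_superset[of "genideal (mpoly_ring n) X" n g] adjoin_self assms
    by (intro mpoly.genideal_minimal) (auto simp: ideal_iff_is_ideal intro!: is_ideal_adjoin)
  have "genideal (mpoly_ring n) X \<subseteq> genideal (mpoly_ring n) (insert g X)"
    using sub gX by (intro mpoly.genideal_minimal) auto
  then show "adjoin n (genideal (mpoly_ring n) X) g \<subseteq> genideal (mpoly_ring n) (insert g X)"
    using sub gX by (intro adjoin_least) (auto simp: ideal_iff_is_ideal)
qed

lemma genideal_empty: "genideal (mpoly_ring n) {} = {0}"
proof
  have "ideal {0} (mpoly_ring n)" using mpoly.zeroideal[of n] by simp
  then show "genideal (mpoly_ring n) {} \<subseteq> {0}"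
    by (intro mpoly.genideal_minimal) auto
  have "ideal (genideal (mpoly_ring n) {}) (mpoly_ring n)"
    by (rule mpoly.genideal_ideal) auto
  then show "{0} \<subseteq> genideal (mpoly_ring n) {}"
    using idlD(2) by (auto simp: ideal_iff_is_ideal)
qed

lemma is_ideal_genideal: "X \<subseteq> polys n \<Longrightarrow> is_ideal n (genideal (mpoly_ring n) X)"
  using mpoly.genideal_ideal[of X n] by (simp add: ideal_iff_is_ideal)

lemma homogeneous_ideal_zero: "homogeneous_ideal n {0}"
  by (auto simp: homogeneous_ideal_def is_ideal_def)

lemma homogeneous_ideal_genideal:
  assumes "finite X" "\<And>x. x \<in> X \<Longrightarrow> \<exists>e. x \<in> homogeneous_part n e"
  shows "homogeneous_ideal n (genideal (mpoly_ring n) X)"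
  using assms
proof (induction X rule: finite_induct)
  case empty
  then show ?case by (simp add: genideal_empty homogeneous_ideal_zero)
next
  case (insert g X)
  then obtain e where g: "g \<in> homogeneous_part n e" by auto
  have "X \<subseteq> polys n" using insert.prems homogeneous_polys by blast
  with g insert show ?case by (auto simp: genideal_insert intro: homogeneous_ideal_adjoin)
qed

section \<open>Dimensions of graded pieces\<close>

definition mpoly_scale :: "'k::field \<Rightarrow> 'k mpoly \<Rightarrow> 'k mpoly" where
  "mpoly_scale c p = mpoly_const c * p"

lemma mpoly_const_add: "mpoly_const (a + b) = mpoly_const a + mpoly_const b"
  and mpoly_const_mult: "mpoly_const (a * b) = mpoly_const a * mpoly_const b"
  and mpoly_const_1 [simp]: "mpoly_const 1 = 1"
  and mpoly_const_0 [simp]: "mpoly_const 0 = 0"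
  by (simp_all add: mpoly_const_def single_add mult_single)

interpretation mp: vector_space "mpoly_scale :: 'k::field \<Rightarrow> 'k mpoly \<Rightarrow> 'k mpoly"
  by standard (auto simp: mpoly_scale_def algebra_simps mpoly_const_add mpoly_const_mult)


text \<open>\<open>mp.dim\<close> is the cardinality of a basis and hence 0 for an infinite one; the
  dimension formulas below are about subspaces inside a finitely generated span.\<close>

definition findim :: "'k::field mpoly set \<Rightarrow> bool" where
  "findim V \<longleftrightarrow> (\<exists>B. finite B \<and> V \<subseteq> mp.span B)"

lemma findim_subset: "findim V \<Longrightarrow> U \<subseteq> V \<Longrightarrow> findim U"
  unfolding findim_def by blast

lemma findim_independent_finite: "findim V \<Longrightarrow> B \<subseteq> V \<Longrightarrow> mp.independent B \<Longrightarrow> finite B"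
  unfolding findim_def using mp.independent_span_bound by blast

text \<open>Rank-nullity for the map V -> (U + f V)/U induced by \<open>f\<close>, whose kernel is
  \<open>{v \<in> V. f v \<in> U}\<close>, stated without quotient spaces.\<close>

lemma dim_sum_image:
  assumes f: "Vector_Spaces.linear mpoly_scale mpoly_scale f"
    and U: "mp.subspace U" "findim U" and V: "mp.subspace V" "findim V"
  shows "mp.dim {u + f v |u v. u \<in> U \<and> v \<in> V} + mp.dim {v \<in> V. f v \<in> U} = mp.dim U + mp.dim V"
proof -
  interpret f: Vector_Spaces.linear mpoly_scale mpoly_scale f by (rule f)
  let ?K = "{v \<in> V. f v \<in> U}"
  obtain B0 where B0: "B0 \<subseteq> ?K" "mp.independent B0" "?K \<subseteq> mp.span B0"
    using mp.maximal_independent_subset by blast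
  then obtain B where B: "B0 \<subseteq> B" "B \<subseteq> V" "mp.independent B" "V \<subseteq> mp.span B"
    using mp.maximal_independent_subset_extend[of B0 V] by blast
  obtain C where C: "C \<subseteq> U" "mp.independent C" "U \<subseteq> mp.span C"
    using mp.maximal_independent_subset by blast
  have fin: "finite B" "finite C"
    using findim_independent_finite U V B C by blast+
  define D where "D = B - B0"
  have finD: "finite D" and finB0: "finite B0"
    using fin(1) B(1) by (auto simp: D_def intro: finite_subset)
  have spanC: "mp.span C = U" using C U by (intro mp.span_subspace)
  \<comment> \<open>\<open>D\<close> completes a basis of the kernel to a basis of \<open>V\<close>;
    its image is adjoined vector by vector to the basis \<open>C\<close> of
    \<open>U\<close>.\<close>
  have step: "mp.independent (C \<union> f ` D') \<and> card (C \<union> f ` D') = card C + card D'" if "D' \<subseteq> D" for D'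
    using finite_subset[OF that finD] that
  proof (induction D' rule: finite_induct)
    case empty
    then show ?case using C by simp
  next
    case (insert d D')
    then have IH: "mp.independent (C \<union> f ` D')" "card (C \<union> f ` D') = card C + card D'" by auto
    \<comment> \<open>A relation would put \<open>d - s\<close>, with \<open>s\<close> in the span
      of \<open>D'\<close>, into the kernel and hence into the span of \<open>B0\<close>, against
      the independence of \<open>B\<close>.\<close>
    have nin: "f d \<notin> mp.span (C \<union> f ` D')"
    proof
      assume "f d \<in> mp.span (C \<union> f ` D')"
      then obtain u s where us: "u \<in> U" "s \<in> mp.span D'" "f d = u + f s"
        by (auto simp: mp.span_Un f.span_image spanC)
      have "d \<in> V" "D' \<subseteq> V" using insert.prems B(2) by (auto simp: D_def)
      then have "s \<in> V" using us(2) mp.span_minimal[of D' V] V(1) by auto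
      then have "d - s \<in> ?K"
        using us \<open>d \<in> V\<close> V(1) by (simp add: f.diff mp.subspace_diff)
      then have "d - s \<in> mp.span B0" using B0 by auto
      then have "(d - s) + s \<in> mp.span (B0 \<union> D')"
        using us(2) by (intro mp.span_add) (meson in_mono mp.span_mono Un_upper1 Un_upper2)+
      then have "d \<in> mp.span (B0 \<union> D')" by simp
      moreover have "B0 \<union> D' \<subseteq> B - {d}"
        using insert B(1) by (auto simp: D_def)
      ultimately have "d \<in> mp.span (B - {d})" using mp.span_mono by blast
      moreover have "d \<in> B" using insert.prems by (auto simp: D_def)
      ultimately show False using B(3) by (auto simp: mp.dependent_def)
    qed
    have "mp.independent (insert (f d) (C \<union> f ` D'))"
      by (rule mp.independent_insertI[OF nin IH(1)])
    moreover have "f d \<notin> C \<union> f ` D'" using nin mp.span_base by metis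
    moreover have "C \<union> f ` insert d D' = insert (f d) (C \<union> f ` D')" by auto
    moreover have "finite (C \<union> f ` D')" using insert.hyps fin(2) by auto
    ultimately show ?case using IH(2) insert.hyps by (metis add_Suc_right card_insert_disjoint)
  qed
  let ?W = "{u + f v |u v. u \<in> U \<and> v \<in> V}"
  have "card (C \<union> f ` D) = mp.dim ?W"
  proof (rule mp.basis_card_eq_dim)
    show "C \<union> f ` D \<subseteq> ?W"
    proof
      fix x assume "x \<in> C \<union> f ` D"
      then consider "x \<in> C" | d where "d \<in> D" "x = f d" by blast
      then show "x \<in> ?W"
      proof cases
        case 1
        then show ?thesis
          using C(1) mp.subspace_0[OF V(1)] by (intro CollectI exI[of _ x] exI[of _ 0]) (auto simp: f.zero)
      next
        case 2
        then show ?thesis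
          using mp.subspace_0[OF U(1)] B(2) by (intro CollectI exI[of _ 0] exI[of _ d]) (auto simp: D_def)
      qed
    qed
    show "?W \<subseteq> mp.span (C \<union> f ` D)"
    proof
      fix x assume "x \<in> ?W"
      then obtain u v where uv: "x = u + f v" "u \<in> U" "v \<in> V" by blast
      have "B = B0 \<union> D" using B(1) by (auto simp: D_def)
      then obtain b s where bs: "v = b + s" "b \<in> mp.span B0" "s \<in> mp.span D"
        using B(4) uv(3) by (auto simp: mp.span_Un)
      have "mp.subspace ?K"
        using U(1) V(1) by (auto simp: mp.subspace_def f.add f.scale f.zero)
      then have "b \<in> ?K" using bs(2) B0(1) mp.span_minimal by blast
      then have "u + f b \<in> mp.span C" using uv U(1) spanC by (auto intro: mp.subspace_add)
      moreover have "f s \<in> mp.span (f ` D)" using bs by (auto simp: f.span_image)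
      moreover have "x = (u + f b) + f s" using uv bs by (simp add: f.add add.assoc)
      ultimately show "x \<in> mp.span (C \<union> f ` D)" by (auto simp: mp.span_Un)
    qed
  qed (use step[of D] in auto)
  moreover have "card B0 = mp.dim ?K" using B0 by (intro mp.basis_card_eq_dim)
  moreover have "card B = mp.dim V" using B by (intro mp.basis_card_eq_dim)
  moreover have "card C = mp.dim U" using C by (intro mp.basis_card_eq_dim)
  moreover have "card B = card B0 + card D"
    unfolding D_def using B(1) fin(1) finB0 card_mono[of B B0] by (subst card_Diff_subset) auto
  ultimately show ?thesis using step[of D] by simp
qed

lemma dim_mono_findim:
  assumes "findim V" "U \<subseteq> V" shows "mp.dim U \<le> mp.dim V"
proof -
  obtain C where C: "C \<subseteq> U" "mp.independent C" "U \<subseteq> mp.span C"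
    using mp.maximal_independent_subset by blast
  obtain B where B: "C \<subseteq> B" "B \<subseteq> V" "mp.independent B" "V \<subseteq> mp.span B"
    using mp.maximal_independent_subset_extend[of C V] C assms by blast
  have "card C \<le> card B"
    using B assms findim_independent_finite by (intro card_mono) auto
  then show ?thesis using mp.basis_card_eq_dim[of C U] mp.basis_card_eq_dim[of B V] B C by simp
qed

lemma subspace_eq_of_dim_le:
  assumes V: "findim V" and U: "mp.subspace U" "U \<subseteq> V" and le: "mp.dim V \<le> mp.dim U"
  shows "U = V"
proof -
  obtain C where C: "C \<subseteq> U" "mp.independent C" "U \<subseteq> mp.span C"
    using mp.maximal_independent_subset by blast
  obtain B where B: "C \<subseteq> B" "B \<subseteq> V" "mp.independent B" "V \<subseteq> mp.span B"
    using mp.maximal_independent_subset_extend[of C V] C assms by blast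
  have "finite B" by (rule findim_independent_finite[OF V B(2,3)])
  moreover have "card B \<le> card C"
    using mp.basis_card_eq_dim[of C U] mp.basis_card_eq_dim[of B V] B C le by simp
  ultimately have "C = B" using B(1) by (simp add: card_seteq)
  then have "V \<subseteq> U" using B(4) C(1) U(1) mp.span_minimal by blast
  with U(2) show ?thesis by auto
qed

lemma linear_mult: "Vector_Spaces.linear mpoly_scale mpoly_scale ((*) (g :: 'k::field mpoly))"
  by (auto simp: Vector_Spaces.linear_iff mpoly_scale_def algebra_simps intro: mp.vector_space_axioms)

lemma is_ideal_subspace: "is_ideal n A \<Longrightarrow> mp.subspace A"
  by (auto simp: mp.subspace_def mpoly_scale_def intro: idlD)

lemma homogeneous_subspace: "mp.subspace (homogeneous_part n p)"
  by (auto simp: mp.subspace_def mpoly_scale_def intro: homogeneous_add homogeneous_const_mult)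

lemma is_ideal_part_subspace: "is_ideal n A \<Longrightarrow> mp.subspace (A \<inter> homogeneous_part n p)"
  by (intro mp.subspace_inter is_ideal_subspace homogeneous_subspace)

lemma homogeneous_findim: "findim (homogeneous_part n p :: 'k::field mpoly set)"
proof (induction p)
  case 0
  have "homogeneous_part n 0 \<subseteq> mp.span {1 :: 'k mpoly}"
    by (auto simp: homogeneous_0_iff mp.span_singleton mpoly_scale_def image_iff)
  then show ?case by (auto simp: findim_def intro: exI[of _ "{1}"])
next
  case (Suc p)
  then obtain B :: "'k mpoly set" where B: "finite B" "homogeneous_part n p \<subseteq> mp.span B"
    by (auto simp: findim_def)
  let ?B = "\<Union>i\<le>n. (*) (mpoly_var i) ` B"
  have "x \<in> mp.span ?B" if "x \<in> homogeneous_part n (Suc p)" for x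
    using that
  proof (induction rule: homogeneous_Suc_induct)
    case (mult i y)
    interpret m: Vector_Spaces.linear mpoly_scale mpoly_scale "(*) (mpoly_var i)" by (rule linear_mult)
    have "mpoly_var i * y \<in> mp.span ((*) (mpoly_var i) ` B)"
      using mult B by (auto simp: m.span_image)
    then show ?case using mp.span_mono[of "(*) (mpoly_var i) ` B" ?B] mult(1) by blast
  qed (auto intro: mp.span_zero mp.span_add)
  then show ?case using B(1) by (auto simp: findim_def intro!: exI[of _ ?B])
qed

text \<open>The dimension of (S/A)_p as a difference of dimensions inside S_p, with no quotient; the
  subtraction never truncates, by \<open>dim_homogeneous_eq\<close>.\<close>

definition hilb :: "nat \<Rightarrow> 'k::field mpoly set \<Rightarrow> nat \<Rightarrow> nat" where
  "hilb n A p = mp.dim (homogeneous_part n p :: 'k mpoly set) - mp.dim (A \<inter> homogeneous_part n p)"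

lemma dim_homogeneous_eq:
  fixes A :: "'k::field mpoly set"
  shows "mp.dim (homogeneous_part n p :: 'k mpoly set) = hilb n A p + mp.dim (A \<inter> homogeneous_part n p)"
  using dim_mono_findim[OF homogeneous_findim, of "A \<inter> homogeneous_part n p" n p]
  by (simp add: hilb_def)

lemma hilb_eq_imp_eq:
  assumes "is_ideal n A" "A \<subseteq> B" "hilb n A p \<le> hilb n B p"
  shows "A \<inter> homogeneous_part n p = B \<inter> homogeneous_part n p"
proof (rule subspace_eq_of_dim_le)
  show "findim (B \<inter> homogeneous_part n p)"
    by (rule findim_subset[OF homogeneous_findim]) auto
  show "mp.dim (B \<inter> homogeneous_part n p) \<le> mp.dim (A \<inter> homogeneous_part n p)"
    using dim_homogeneous_eq[of n p A] dim_homogeneous_eq[of n p B] assms(3) by simp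
qed (use assms in \<open>auto intro: is_ideal_part_subspace\<close>)

lemma hilb_eq_0_iff:
  assumes "is_ideal n A" shows "hilb n A p = 0 \<longleftrightarrow> homogeneous_part n p \<subseteq> A"
proof
  assume "hilb n A p = 0"
  then have "A \<inter> homogeneous_part n p = polys n \<inter> homogeneous_part n p"
    by (intro hilb_eq_imp_eq) (use assms in \<open>auto dest: idlD\<close>)
  then show "homogeneous_part n p \<subseteq> A" using homogeneous_polys by blast
next
  assume "homogeneous_part n p \<subseteq> A"
  then have "A \<inter> homogeneous_part n p = homogeneous_part n p" by auto
  then show "hilb n A p = 0" by (simp add: hilb_def)
qed

text \<open>Degree \<open>p\<close> of the exact sequence 0 -> (S/(A : g))(-e) -> S/A -> S/(A + gS)
  -> 0; below degree \<open>e\<close> the left term is zero.\<close>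

lemma hilb_adjoin:
  fixes A :: "'k::field mpoly set"
  assumes A: "homogeneous_ideal n A" and g: "g \<in> homogeneous_part n e"
  shows "hilb n (adjoin n A g) p + (if e \<le> p then hilb n (colon n A g) (p - e) else 0) = hilb n A p"
proof (cases "e \<le> p")
  case True
  let ?H = "homogeneous_part n :: nat \<Rightarrow> 'k mpoly set"
  have eq1: "{u + g * v |u v. u \<in> A \<inter> ?H p \<and> v \<in> ?H (p - e)} = adjoin n A g \<inter> ?H p"
    using adjoin_homogeneous_iff[OF A g, of _ p] True by auto
  have "g * v \<in> ?H p" if "v \<in> ?H (p - e)" for v
    using homogeneous_mult[OF g that] True by simp
  then have eq2: "{v \<in> ?H (p - e). g * v \<in> A \<inter> ?H p} = colon n A g \<inter> ?H (p - e)"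
    by (auto simp: colon_def)
  have "mp.dim (adjoin n A g \<inter> ?H p) + mp.dim (colon n A g \<inter> ?H (p - e)) =
    mp.dim (A \<inter> ?H p) + mp.dim (?H (p - e))"
    unfolding eq1[symmetric] eq2[symmetric]
    by (rule dim_sum_image[OF linear_mult])
      (use A in \<open>auto intro: is_ideal_part_subspace homogeneous_ideal_is_ideal homogeneous_subspace homogeneous_findim
        findim_subset[OF homogeneous_findim]\<close>)
  then show ?thesis
    using True dim_homogeneous_eq[of n p A] dim_homogeneous_eq[of n p "adjoin n A g"]
      dim_homogeneous_eq[of n "p - e" "colon n A g"] by simp
next
  case False
  then have "adjoin n A g \<inter> homogeneous_part n p = A \<inter> homogeneous_part n p"
    using adjoin_homogeneous_iff[OF A g, of _ p] by auto
  then show ?thesis using False by (simp add: hilb_def)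
qed

text \<open>Every vector of a basis of a complement of \<open>V\<close> cuts the dimension of \<open>U\<close> by at most one.\<close>

lemma dim_annihilating_pair:
  fixes B U V :: "'k::field mpoly set"
  assumes B: "is_ideal n B"
    and U: "mp.subspace U" "U \<subseteq> homogeneous_part n p"
    and V: "mp.subspace V" "V \<subseteq> homogeneous_part n q"
    and UV: "\<And>u v. u \<in> U \<Longrightarrow> v \<in> V \<Longrightarrow> u * v \<in> B"
    and nondeg: "\<And>u. u \<in> homogeneous_part n p \<Longrightarrow> (\<And>w. w \<in> homogeneous_part n q \<Longrightarrow> u * w \<in> B) \<Longrightarrow> u \<in> B"
    and codim: "hilb n B (p + q) \<le> 1"
  shows "mp.dim U + mp.dim V \<le> mp.dim (B \<inter> homogeneous_part n p) + mp.dim (homogeneous_part n q :: 'k mpoly set)"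
proof -
  let ?H = "homogeneous_part n :: nat \<Rightarrow> 'k mpoly set"
  obtain C where C: "C \<subseteq> V" "mp.independent C" "V \<subseteq> mp.span C"
    using mp.maximal_independent_subset by blast
  obtain E where E: "C \<subseteq> E" "E \<subseteq> ?H q" "mp.independent E" "?H q \<subseteq> mp.span E"
    using mp.maximal_independent_subset_extend[of C "?H q"] C V by blast
  have finE: "finite E" using E findim_independent_finite homogeneous_findim by blast
  define D where "D = E - C"
  have finD: "finite D" using finE by (simp add: D_def)
  have finU: "findim W" if "W \<subseteq> ?H r" for W r
    using findim_subset[OF homogeneous_findim that] .
  have sub: "mp.subspace {u \<in> U. \<forall>w\<in>D'. u * w \<in> B}" for D'
  proof (rule mp.subspaceI)
    fix c x assume x: "x \<in> {u \<in> U. \<forall>w\<in>D'. u * w \<in> B}"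
    have "mpoly_scale c x * w = mpoly_scale c (x * w)" for w by (simp add: mpoly_scale_def mult.assoc)
    then show "mpoly_scale c x \<in> {u \<in> U. \<forall>w\<in>D'. u * w \<in> B}"
      using x U(1) is_ideal_subspace[OF B] by (auto intro: mp.subspace_scale)
  next
    fix x y assume "x \<in> {u \<in> U. \<forall>w\<in>D'. u * w \<in> B}" "y \<in> {u \<in> U. \<forall>w\<in>D'. u * w \<in> B}"
    then show "x + y \<in> {u \<in> U. \<forall>w\<in>D'. u * w \<in> B}"
      using U(1) is_ideal_subspace[OF B] by (auto simp: distrib_right intro: mp.subspace_add)
  qed (use U(1) is_ideal_subspace[OF B] in \<open>auto intro: mp.subspace_0\<close>)
  have step: "mp.dim U \<le> mp.dim {u \<in> U. \<forall>w\<in>D'. u * w \<in> B} + card D'" if "D' \<subseteq> D" for D'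
    using finite_subset[OF that finD] that
  proof (induction D' rule: finite_induct)
    case (insert w D')
    let ?U = "{u \<in> U. \<forall>w\<in>D'. u * w \<in> B}"
    have w: "w \<in> ?H q" using insert.prems E by (auto simp: D_def)
    have wH: "w * u \<in> ?H (p + q)" if "u \<in> ?H p" for u
      using homogeneous_mult[OF that w] by (simp add: mult.commute)
    let ?BH = "B \<inter> ?H (p + q)"
    \<comment> \<open>Rank-nullity for multiplication by \<open>w\<close> from \<open>?U\<close>
      into degree p + q modulo \<open>B\<close>, where there is room for at most one
      dimension.\<close>
    have "mp.dim {b + w * u |b u. b \<in> ?BH \<and> u \<in> ?U} + mp.dim {u \<in> ?U. w * u \<in> ?BH} = mp.dim ?BH + mp.dim ?U"
      using U by (intro dim_sum_image linear_mult is_ideal_part_subspace B sub finU[of _ "p + q"] finU[of _ p]) auto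
    moreover have "mp.dim {b + w * u |b u. b \<in> ?BH \<and> u \<in> ?U} \<le> mp.dim (?H (p + q))"
      using U wH by (intro dim_mono_findim homogeneous_findim) (auto intro!: homogeneous_add)
    moreover have "mp.dim (?H (p + q)) \<le> mp.dim ?BH + 1"
      using codim dim_homogeneous_eq[of n "p + q" B] by simp
    moreover have "{u \<in> ?U. w * u \<in> ?BH} = {u \<in> U. \<forall>w\<in>insert w D'. u * w \<in> B}"
      using U wH by (auto simp: mult.commute)
    ultimately have "mp.dim ?U \<le> mp.dim {u \<in> U. \<forall>w\<in>insert w D'. u * w \<in> B} + 1" by simp
    then show ?case using insert by simp
  qed simp
  \<comment> \<open>Such \<open>u\<close> annihilates \<open>C\<close> because \<open>C\<close> lies
    in \<open>V\<close>, and \<open>D\<close> by construction; together they span S_q, so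
    \<open>nondeg\<close> applies.\<close>
  have "{u \<in> U. \<forall>w\<in>D. u * w \<in> B} \<subseteq> B \<inter> ?H p"
  proof (intro subsetI IntI)
    fix u assume u: "u \<in> {u \<in> U. \<forall>w\<in>D. u * w \<in> B}"
    show uH: "u \<in> ?H p" using u U by auto
    have EB: "u * w \<in> B" if "w \<in> E" for w
      using that u UV C by (cases "w \<in> C") (auto simp: D_def)
    have "u * mpoly_scale c w = mpoly_scale c (u * w)" for c w by (simp add: mpoly_scale_def mult.left_commute)
    then have "mp.subspace {w. u * w \<in> B}"
      using is_ideal_subspace[OF B] by (auto simp: mp.subspace_def distrib_left)
    then have "mp.span E \<subseteq> {w. u * w \<in> B}" using EB by (intro mp.span_minimal) auto
    then show "u \<in> B" using E(4) nondeg[OF uH] by blast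
  qed
  then have "mp.dim {u \<in> U. \<forall>w\<in>D. u * w \<in> B} \<le> mp.dim (B \<inter> ?H p)"
    by (intro dim_mono_findim finU[of _ p]) auto
  moreover have "card E = mp.dim (?H q)" "card C = mp.dim V"
    using E C by (auto intro!: mp.basis_card_eq_dim)
  moreover have "card E = card C + card D"
    unfolding D_def using E(1) finE card_mono[of E C] finite_subset[of C E]
    by (subst card_Diff_subset) auto
  ultimately show ?thesis using step[of D] by simp
qed

section \<open>Noetherianity and regular linear forms\<close>

lemma lookup_monomial_mult:
  fixes x :: "'k::field mpoly"
  shows "lookup (monomial u c * x) (u + m) = c * lookup x m"
proof -
  have "monomial u c * x = (\<Sum>b\<in>keys x. monomial (u + b) (c * lookup x b))"
    by (subst sum_monomials[of x, symmetric]) (simp add: sum_distrib_left mult_single)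
  then have "lookup (monomial u c * x) (u + m) = (\<Sum>b\<in>keys x. if b = m then c * lookup x b else 0)"
    by (auto simp: lookup_sum lookup_single when_def intro!: sum.cong)
  then show ?thesis by (auto simp: in_keys_iff sum.delta)
qed

lemma keys_monomial_mult:
  fixes x :: "'k::field mpoly"
  assumes "m \<in> keys (monomial u c * x)"
  obtains b where "b \<in> keys x" "m = u + b"
  using assms keys_mult[of "monomial u c" x] by (auto split: if_splits)

lemma lookup_const_mult: "lookup (mpoly_const c * x) m = c * lookup x m"
  using lookup_monomial_mult[of 0 c x m] by (simp add: mpoly_const_def)

lemma nat_seq_incseq_subseq:
  fixes s :: "nat \<Rightarrow> nat"
  obtains r :: "nat \<Rightarrow> nat" where "strict_mono r" "incseq (\<lambda>j. s (r j))"
proof -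
  obtain f where f: "strict_mono f" "monoseq (\<lambda>j. s (f j))"
    using seq_monosub[of s] by blast
  show ?thesis
  proof (cases "incseq (\<lambda>j. s (f j))")
    case True
    then show ?thesis using f that by blast
  next
    case False
    then have dec: "decseq (\<lambda>j. s (f j))" using f(2) by (simp add: monoseq_iff)
    \<comment> \<open>A decreasing sequence of naturals reaches its minimum \<open>v\<close> and is
      constant from there on.\<close>
    define v where "v = (LEAST v. v \<in> range (\<lambda>j. s (f j)))"
    have "v \<in> range (\<lambda>j. s (f j))" unfolding v_def by (rule LeastI[of _ "s (f 0)"]) auto
    then obtain N where N: "v = s (f N)" by auto
    have "s (f (N + j)) = v" for j
    proof (rule antisym)
      show "s (f (N + j)) \<le> v" unfolding N using dec by (auto simp: decseq_def)
      show "v \<le> s (f (N + j))" unfolding v_def by (rule Least_le) auto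
    qed
    moreover have "strict_mono (\<lambda>j. f (N + j))" using f(1) by (auto simp: strict_mono_def)
    ultimately show ?thesis by (intro that[of "\<lambda>j. f (N + j)"]) (auto simp: incseq_def)
  qed
qed

text \<open>Refining to a monotone subsequence once per coordinate makes all coordinates up to
  \<open>n\<close> monotone simultaneously; the others vanish.\<close>

lemma dickson:
  fixes m :: "nat \<Rightarrow> (nat \<Rightarrow>\<^sub>0 nat)"
  assumes "\<And>j. keys (m j) \<subseteq> {..n}"
  obtains i j where "i < j" "\<And>k. lookup (m i) k \<le> lookup (m j) k"
proof -
  have "\<exists>r :: nat \<Rightarrow> nat. strict_mono r \<and> (\<forall>k\<in>D. incseq (\<lambda>j. lookup (m (r j)) k))" if "finite D" for D
    using that
  proof (induction D rule: finite_induct)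
    case empty
    then show ?case by (auto intro: exI[of _ id] simp: strict_mono_def)
  next
    case (insert d D)
    then obtain r :: "nat \<Rightarrow> nat"
      where r: "strict_mono r" "\<And>k. k \<in> D \<Longrightarrow> incseq (\<lambda>j. lookup (m (r j)) k)" by blast
    obtain r' :: "nat \<Rightarrow> nat"
      where r': "strict_mono r'" "incseq (\<lambda>j. lookup (m (r (r' j))) d)"
      using nat_seq_incseq_subseq[of "\<lambda>j. lookup (m (r j)) d"] by blast
    have "strict_mono (\<lambda>j. r (r' j))" using r(1) r'(1) by (simp add: strict_mono_def)
    moreover have "incseq (\<lambda>j. lookup (m (r (r' j))) k)" if "k \<in> D" for k
      using r(2)[OF that] r'(1) by (auto simp: incseq_def strict_mono_less_eq)
    ultimately show ?case using r'(2) by (intro exI[of _ "\<lambda>j. r (r' j)"]) auto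
  qed
  from this[of "{..n}"] obtain r :: "nat \<Rightarrow> nat"
    where r: "strict_mono r" "\<And>k. k \<le> n \<Longrightarrow> incseq (\<lambda>j. lookup (m (r j)) k)" by auto
  have "lookup (m (r 0)) k \<le> lookup (m (r 1)) k" for k
  proof (cases "k \<le> n")
    case True
    then show ?thesis using r(2) by (auto simp: incseq_def)
  next
    case False
    then have "k \<notin> keys (m (r 0))" using assms[of "r 0"] by auto
    then show ?thesis by (simp add: in_keys_iff)
  qed
  moreover have "r 0 < r 1" using r(1) by (auto simp: strict_mono_def)
  ultimately show ?thesis using that by blast
qed

lemma finite_monomials: "finite {m :: nat \<Rightarrow>\<^sub>0 nat. keys m \<subseteq> {..n} \<and> total_deg m = q}"
proof (rule finite_imageD)
  let ?F = "{f :: nat \<Rightarrow> nat. \<forall>x. (x \<in> {..n} \<longrightarrow> f x \<in> {..q}) \<and> (x \<notin> {..n} \<longrightarrow> f x = 0)}"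
  have "lookup m i \<le> total_deg m" for m :: "nat \<Rightarrow>\<^sub>0 nat" and i
  proof (cases "i \<in> keys m")
    case True
    then show ?thesis unfolding total_deg_def by (rule member_le_sum) auto
  qed (simp add: in_keys_iff)
  note le = this
  have inF: "lookup m \<in> ?F" if m: "keys m \<subseteq> {..n}" "total_deg m = q" for m :: "nat \<Rightarrow>\<^sub>0 nat"
  proof (intro CollectI allI conjI impI)
    fix x show "lookup m x \<in> {..q}" using le[of m x] m(2) by simp
    assume "x \<notin> {..n}"
    then have "x \<notin> keys m" using m(1) by blast
    then show "lookup m x = 0" by (simp only: not_in_keys_iff_lookup_eq_zero)
  qed
  have "lookup ` {m. keys m \<subseteq> {..n} \<and> total_deg m = q} \<subseteq> ?F"
    by (rule image_subsetI, rule inF) simp_all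
  moreover have "finite ?F" by (rule finite_set_of_finite_funs[OF finite_atMost finite_atMost])
  ultimately show "finite (lookup ` {m. keys m \<subseteq> {..n} \<and> total_deg m = q})"
    by (rule finite_subset)
  show "inj_on lookup {m :: nat \<Rightarrow>\<^sub>0 nat. keys m \<subseteq> {..n} \<and> total_deg m = q}"
    by (rule inj_onI, rule poly_mapping_eqI) (simp only:)
qed

text \<open>The new elements are chosen with least leading monomials, with respect to the
  lexicographic order of \<open>\<Rightarrow>\<^sub>0\<close>. By Dickson's lemma one of these divides a later one.\<close>

lemma noetherian_homogeneous:
  fixes A :: "nat \<Rightarrow> 'k::field mpoly set"
  assumes A: "\<And>j. is_ideal n (A j)" "\<And>j. A j \<subseteq> A (Suc j)"
    and new: "\<And>j. \<exists>q. \<exists>x \<in> homogeneous_part n q. x \<in> A (Suc j) \<and> x \<notin> A j"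
  shows False
proof -
  let ?lm = "\<lambda>x :: 'k mpoly. Max (keys x)"
  have nonzero: "x \<noteq> 0" if "x \<notin> A j" for x j using that A(1)[of j] by (auto simp: is_ideal_def)
  have "\<exists>x q. x \<in> homogeneous_part n q \<and> x \<in> A (Suc j) \<and> x \<notin> A j \<and>
     (\<forall>y. y \<in> homogeneous_part n q \<and> y \<in> A (Suc j) \<and> y \<notin> A j \<longrightarrow> ?lm x \<le> ?lm y)" for j
  proof -
    obtain q where q: "\<exists>x \<in> homogeneous_part n q. x \<in> A (Suc j) \<and> x \<notin> A j" using new by blast
    let ?T = "{x \<in> homogeneous_part n q. x \<in> A (Suc j) \<and> x \<notin> A j}"
    \<comment> \<open>Forms of one degree \<open>q\<close> have finitely many leading monomials, so
      a least one exists without well-foundedness of the order.\<close>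
    have "?lm ` ?T \<subseteq> {m. keys m \<subseteq> {..n} \<and> total_deg m = q}"
    proof
      fix m assume "m \<in> ?lm ` ?T"
      then obtain x where x: "x \<in> ?T" "m = ?lm x" by blast
      then have "keys x \<noteq> {}" using nonzero[of x j] by simp
      then have "m \<in> keys x" using x by simp
      then show "m \<in> {m. keys m \<subseteq> {..n} \<and> total_deg m = q}"
        using x by (auto simp: homogeneous_iff polys_def)
    qed
    then have fin: "finite (?lm ` ?T)" using finite_monomials by (rule finite_subset)
    have "?lm ` ?T \<noteq> {}" using q by blast
    then have "Min (?lm ` ?T) \<in> ?lm ` ?T" using fin by (rule Min_in[rotated])
    then obtain x where x: "x \<in> ?T" "?lm x = Min (?lm ` ?T)" by auto
    have "?lm x \<le> ?lm y" if "y \<in> ?T" for y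
      unfolding x(2) using fin that by (intro Min_le) auto
    then show ?thesis using x(1) by blast
  qed
  then obtain c q where c: "\<And>j. c j \<in> homogeneous_part n (q j)" "\<And>j. c j \<in> A (Suc j)" "\<And>j. c j \<notin> A j"
    and least: "\<And>j y. y \<in> homogeneous_part n (q j) \<Longrightarrow> y \<in> A (Suc j) \<Longrightarrow> y \<notin> A j \<Longrightarrow> ?lm (c j) \<le> ?lm y"
    by metis
  have lm_in: "?lm (c j) \<in> keys (c j)" for j
    using nonzero[OF c(3)[of j]] by simp
  have "keys (?lm (c j)) \<subseteq> {..n}" for j
    using lm_in[of j] c(1)[of j] unfolding homogeneous_iff polys_def by blast
  then obtain i j where ij: "i < j" "\<And>k. lookup (?lm (c i)) k \<le> lookup (?lm (c j)) k"
    using dickson[of "\<lambda>j. ?lm (c j)" n] by blast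
  define u where "u = ?lm (c j) - ?lm (c i)"
  have u: "?lm (c j) = u + ?lm (c i)"
    by (rule poly_mapping_eqI) (simp add: u_def lookup_add lookup_minus ij(2))
  \<comment> \<open>The factor cancels the leading terms: \<open>y\<close> is again a new form of
    degree \<open>q j\<close>, with a smaller leading monomial than \<open>c j\<close>, against the
    choice of \<open>c j\<close>.\<close>
  define \<kappa> where "\<kappa> = lookup (c j) (?lm (c j)) / lookup (c i) (?lm (c i))"
  define y where "y = c j - monomial u \<kappa> * c i"
  have ci: "c i \<in> A j"
  proof -
    have "A (Suc i) \<subseteq> A j" by (rule lift_Suc_mono_le[of A, OF A(2)]) (use ij(1) in simp)
    then show ?thesis using c(2) by blast
  qed
  have ku: "keys u \<subseteq> {..n}"
  proof
    fix k assume "k \<in> keys u"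
    then have "k \<in> keys (?lm (c j))" by (auto simp: u_def lookup_minus in_keys_iff)
    then show "k \<in> {..n}" using \<open>keys (?lm (c j)) \<subseteq> {..n}\<close> by blast
  qed
  have deg: "total_deg (?lm (c k)) = q k" for k
    using c(1)[of k] lm_in[of k] unfolding homogeneous_iff by blast
  have "monomial u \<kappa> \<in> homogeneous_part n (total_deg u)"
    using ku by (auto simp: homogeneous_iff polys_single split: if_splits)
  then have "monomial u \<kappa> * c i \<in> homogeneous_part n (q j)"
    using homogeneous_mult[OF _ c(1)[of i]] deg[of i] deg[of j] u by (metis total_deg_add)
  then have "y \<in> homogeneous_part n (q j)" using c(1) by (simp add: y_def homogeneous_diff)
  moreover have ciA: "monomial u \<kappa> * c i \<in> A j"
    using idlD(4)[OF A(1) ci polys_single[OF ku]] .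
  then have "y \<in> A (Suc j)" unfolding y_def
    using c(2)[of j] A(2)[of j] by (intro is_ideal_diff[OF A(1)]) auto
  moreover have "y \<notin> A j"
    using idlD(3)[OF A(1)[of j] _ ciA, of y] c(3)[of j] by (auto simp: y_def)
  ultimately have le: "?lm (c j) \<le> ?lm y" by (rule least)
  have "y \<noteq> 0" using nonzero \<open>y \<notin> A j\<close> .
  then have my: "?lm y \<in> keys y" by simp
  have "lookup y (?lm (c j)) = 0"
    using lm_in[of i] unfolding y_def lookup_minus
    by (subst (2) u) (simp add: lookup_monomial_mult \<kappa>_def in_keys_iff)
  then have "?lm y \<noteq> ?lm (c j)" using my by (auto simp: in_keys_iff)
  moreover have "?lm y \<le> ?lm (c j)"
  proof -
    have "lookup y (?lm y) \<noteq> 0" using my by (simp add: in_keys_iff)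
    then have "?lm y \<in> keys (c j) \<or> ?lm y \<in> keys (monomial u \<kappa> * c i)"
      by (auto simp: y_def lookup_minus in_keys_iff)
    then show ?thesis
    proof
      assume "?lm y \<in> keys (monomial u \<kappa> * c i)"
      then obtain b where b: "b \<in> keys (c i)" "?lm y = u + b" by (rule keys_monomial_mult)
      then have "b \<le> ?lm (c i)" by simp
      then show ?thesis unfolding u b(2) by (rule add_left_mono)
    qed simp
  qed
  ultimately show False using le by simp
qed

text \<open>By dependent choice, a family without maximal member contains a strictly ascending
  chain; homogeneity provides the new forms that \<open>noetherian_homogeneous\<close>
  excludes.\<close>

lemma exists_maximal_homogeneous_ideal:
  fixes F :: "'k::field mpoly set set"
  assumes ne: "F \<noteq> {}" and homogeneous_ideal: "\<And>A. A \<in> F \<Longrightarrow> homogeneous_ideal n A"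
  shows "\<exists>A\<in>F. \<forall>B\<in>F. A \<subseteq> B \<longrightarrow> A = B"
proof (rule ccontr)
  assume "\<not> ?thesis"
  then have step: "\<exists>B\<in>F. A \<subset> B" if "A \<in> F" for A using that by blast
  have "\<exists>A. \<forall>j. A j \<in> F \<and> A j \<subset> A (Suc j)"
    by (rule dependent_nat_choice) (use ne step in auto)
  then obtain A where A: "\<And>j. A j \<in> F" "\<And>j. A j \<subset> A (Suc j)" by blast
  have idlA: "is_ideal n (A j)" for j by (rule homogeneous_ideal_is_ideal[OF homogeneous_ideal[OF A(1)]])
  have new: "\<exists>q. \<exists>x \<in> homogeneous_part n q. x \<in> A (Suc j) \<and> x \<notin> A j" for j
  proof (rule ccontr)
    assume "\<not> ?thesis"
    then have "A (Suc j) \<subseteq> A j" by (intro homogeneous_ideal_subsetI[OF homogeneous_ideal[OF A(1)] idlA]) blast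
    with A(2)[of j] show False by blast
  qed
  show False by (rule noetherian_homogeneous[of n A, OF idlA _ new]) (use A(2) in auto)
qed

section \<open>Socles, non-zero-divisors and linear forms\<close>

definition max_ideal :: "nat \<Rightarrow> 'k::field mpoly set" where
  "max_ideal n = {p \<in> polys n. lookup p 0 = 0}"

text \<open>The preimage in S of the socle of S/A, that is, the colon ideal (A : m).\<close>

definition socle :: "nat \<Rightarrow> 'k::field mpoly set \<Rightarrow> 'k mpoly set" where
  "socle n A = {x \<in> polys n. \<forall>y\<in>max_ideal n. y * x \<in> A}"

text \<open>The unit ideal is not excluded: modulo it, every \<open>g\<close> qualifies.\<close>

definition nonzerodivisor :: "nat \<Rightarrow> 'k::field mpoly \<Rightarrow> 'k mpoly set \<Rightarrow> bool" where
  "nonzerodivisor n g A \<longleftrightarrow> (\<forall>x\<in>polys n. g * x \<in> A \<longrightarrow> x \<in> A)"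

lemma homogeneous_max_ideal:
  assumes "x \<in> homogeneous_part n p" "1 \<le> p" shows "x \<in> max_ideal n"
proof -
  have "0 \<notin> keys x" using assms by (auto simp: homogeneous_iff)
  then show ?thesis using assms(1) by (simp add: max_ideal_def in_keys_iff)
qed

lemma max_ideal_polys: "x \<in> max_ideal n \<Longrightarrow> x \<in> polys n"
  by (simp add: max_ideal_def)

lemma max_ideal_subset_homogeneous:
  fixes A :: "'k::field mpoly set"
  assumes A: "is_ideal n A" and H: "\<And>p x. 1 \<le> p \<Longrightarrow> x \<in> homogeneous_part n p \<Longrightarrow> x \<in> A"
  shows "max_ideal n \<subseteq> A"
proof
  fix y :: "'k mpoly" assume y: "y \<in> max_ideal n"
  have "hcomp q y \<in> A" for q
  proof (cases "q = 0")
    case True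
    have "hcomp 0 y = 0"
      using y by (intro poly_mapping_eqI) (auto simp: lookup_hcomp total_deg_eq_0_iff max_ideal_def)
    then show ?thesis using True idlD(2)[OF A] by simp
  next
    case False
    then show ?thesis using H[of q "hcomp q y"] y by (simp add: max_ideal_polys)
  qed
  then have "(\<Sum>q\<in>total_deg ` keys y. hcomp q y) \<in> A" by (intro is_ideal_sum[OF A])
  then show "y \<in> A" by (simp add: sum_hcomp')
qed

lemma max_ideal_subset_vars:
  fixes A :: "'k::field mpoly set"
  assumes A: "is_ideal n A" and var: "\<And>i. i \<le> n \<Longrightarrow> mpoly_var i \<in> A"
  shows "max_ideal n \<subseteq> A"
proof (rule max_ideal_subset_homogeneous[OF A])
  fix p and x :: "'k mpoly" assume "1 \<le> p" "x \<in> homogeneous_part n p"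
  then have "x \<in> homogeneous_part n (Suc (p - 1))" by simp
  then show "x \<in> A"
    by (induction rule: homogeneous_Suc_induct) (use A var in \<open>auto intro: idlD\<close>)
qed

text \<open>The coefficient vectors lie on the moment curve: by Vandermonde, any n + 1 of these
  forms with distinct parameters span S_1. One parameter thus suffices for general position.\<close>

definition linear_form :: "nat \<Rightarrow> 'k::field \<Rightarrow> 'k mpoly" where
  "linear_form n t = (\<Sum>i\<le>n. mpoly_const (t ^ i) * mpoly_var i)"

lemma linear_form_homogeneous: "linear_form n t \<in> homogeneous_part n 1"
  unfolding linear_form_def by (intro homogeneous_sum homogeneous_const_mult homogeneous_var) auto

lemma mpoly_const_sum: "mpoly_const (sum f D) = (\<Sum>i\<in>D. mpoly_const (f i))"
  by (induction D rule: infinite_finite_induct) (auto simp: mpoly_const_add)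

text \<open>\<open>c t i\<close> is the \<open>i\<close>-th coefficient of the Lagrange polynomial of the node \<open>t\<close>.\<close>

lemma vandermonde_dual:
  fixes T :: "'k::field set"
  assumes T: "finite T" "card T = Suc n"
  shows "\<exists>c. \<forall>i\<le>n. \<forall>j\<le>n. (\<Sum>t\<in>T. c t i * t ^ j) = (if i = j then 1 else 0)"
proof -
  define L where "L t = (\<Prod>s\<in>T - {t}. [:- s / (t - s), 1 / (t - s):])" for t
  have degL: "Polynomial.degree (L t) \<le> n" if "t \<in> T" for t
  proof -
    have "Polynomial.degree (L t) \<le> sum (Polynomial.degree \<circ> (\<lambda>s. [:- s / (t - s), 1 / (t - s):])) (T - {t})"
      unfolding L_def by (rule degree_prod_sum_le) (use T in auto)
    also have "\<dots> \<le> (\<Sum>s\<in>T - {t}. 1)" by (intro sum_mono) auto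
    also have "\<dots> = n" using T that by simp
    finally show ?thesis .
  qed
  have polyL: "poly (L t) s = (if s = t then 1 else 0)" if "s \<in> T" "t \<in> T" for s t
  proof -
    have "poly (L t) s = (\<Prod>r\<in>T - {t}. (s - r) / (t - r))"
      by (simp add: L_def poly_prod diff_divide_distrib)
    also have "\<dots> = (if s = t then 1 else 0)"
      using that T by (auto intro!: prod.neutral prod_zero)
    finally show ?thesis .
  qed
  \<comment> \<open>A polynomial of degree at most \<open>n\<close> is its own interpolation at n +
    1 nodes; for X^j, comparison of the i-th coefficients gives the dual relations.\<close>
  have interp: "(\<Sum>t\<in>T. Polynomial.smult (t ^ j) (L t)) = Polynomial.monom 1 j" if j: "j \<le> n" for j
  proof (rule ccontr)
    let ?P = "(\<Sum>t\<in>T. Polynomial.smult (t ^ j) (L t)) - Polynomial.monom 1 j"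
    assume "\<not> ?thesis"
    then have ne: "?P \<noteq> 0" by simp
    have "Polynomial.degree (\<Sum>t\<in>T. Polynomial.smult (t ^ j) (L t)) \<le> n"
      using T degL by (intro degree_sum_le) (auto intro: order_trans[OF degree_smult_le])
    moreover have "Polynomial.degree (Polynomial.monom (1 :: 'k) j) \<le> n"
      using j degree_monom_le[of "1 :: 'k" j] by simp
    ultimately have deg: "Polynomial.degree ?P \<le> n" by (rule degree_diff_le)
    have "poly ?P s = 0" if "s \<in> T" for s
    proof -
      have "poly ?P s = (\<Sum>t\<in>T. t ^ j * poly (L t) s) - s ^ j"
        by (simp add: poly_sum poly_monom)
      also have "(\<Sum>t\<in>T. t ^ j * poly (L t) s) = (\<Sum>t\<in>T. if t = s then t ^ j else 0)"
        using that polyL by (intro sum.cong) auto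
      also have "\<dots> = s ^ j" using that T by simp
      finally show ?thesis by simp
    qed
    then have "card T \<le> card {x. poly ?P x = 0}"
      using poly_roots_finite[OF ne] by (intro card_mono) auto
    also have "\<dots> \<le> Polynomial.degree ?P" using card_poly_roots_bound[OF ne] .
    finally show False using deg T by simp
  qed
  have "(\<Sum>t\<in>T. Polynomial.coeff (L t) i * t ^ j) = (if i = j then 1 else 0)" if "i \<le> n" "j \<le> n" for i j
    using arg_cong[OF interp[OF that(2)], of "\<lambda>p. Polynomial.coeff p i"]
    by (simp add: coeff_sum mult.commute)
  then show ?thesis by (intro exI[of _ "\<lambda>t i. Polynomial.coeff (L t) i"]) auto
qed

text \<open>The dual coefficients \<open>c\<close> invert the system of the n + 1 forms of
  \<open>T\<close> and express every variable through them.\<close>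

lemma vars_in_ideal_of_lforms:
  assumes A: "is_ideal n A" and inf: "infinite {t. linear_form n t \<in> A}" and i: "i \<le> n"
  shows "mpoly_var i \<in> A"
proof -
  obtain T where T: "T \<subseteq> {t. linear_form n t \<in> A}" "finite T" "card T = Suc n"
    using infinite_arbitrarily_large[OF inf] by blast
  obtain c where c: "\<And>i j. i \<le> n \<Longrightarrow> j \<le> n \<Longrightarrow> (\<Sum>t\<in>T. c t i * t ^ j) = (if i = j then 1 else 0)"
    using vandermonde_dual[OF T(2,3)] by blast
  have "(\<Sum>t\<in>T. mpoly_const (c t i) * linear_form n t) =
      (\<Sum>t\<in>T. \<Sum>j\<le>n. mpoly_const (c t i * t ^ j) * mpoly_var j)"
    by (simp add: linear_form_def sum_distrib_left mpoly_const_mult mult.assoc)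
  also have "\<dots> = (\<Sum>j\<le>n. mpoly_const (\<Sum>t\<in>T. c t i * t ^ j) * mpoly_var j)"
    by (subst sum.swap) (simp add: mpoly_const_sum sum_distrib_right)
  also have "\<dots> = (\<Sum>j\<le>n. if j = i then mpoly_var j else 0)"
    using c[OF i] by (intro sum.cong) auto
  also have "\<dots> = mpoly_var i" using i by simp
  finally have "mpoly_var i = (\<Sum>t\<in>T. mpoly_const (c t i) * linear_form n t)" by simp
  also have "\<dots> \<in> A" using T(1) by (intro is_ideal_sum[OF A] idlD(4)[OF A]) auto
  finally show ?thesis .
qed

lemma polys_prod: "(\<And>i. i \<in> D \<Longrightarrow> f i \<in> polys n) \<Longrightarrow> prod f D \<in> polys n"
  by (induction D rule: infinite_finite_induct) auto

text \<open>Homogeneous prime avoidance: the maximal annihilators of homogeneous elements of \<open>S/A\<close> are prime,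
  and infinitely many of them would yield an infinite ascending chain of ideals.\<close>

lemma finite_nonregular_lforms:
  fixes A :: "'k::field mpoly set"
  assumes A: "homogeneous_ideal n A" and socle: "socle n A \<subseteq> A"
  shows "finite {t. \<not> nonzerodivisor n (linear_form n t) A}"
proof -
  let ?H = "homogeneous_part n :: nat \<Rightarrow> 'k mpoly set"
  define F where "F = {colon n A c |c q. c \<in> ?H q \<and> c \<notin> A}"
  define M where "M = {P \<in> F. \<forall>Q\<in>F. P \<subseteq> Q \<longrightarrow> P = Q}"
  have Ai: "is_ideal n A" using A by (rule homogeneous_ideal_is_ideal)
  have hidF: "homogeneous_ideal n P" if "P \<in> F" for P
    using that by (auto simp: F_def intro: homogeneous_ideal_colon[OF A])
  \<comment> \<open>Otherwise all variables, hence the maximal ideal, would lie in P = (A : c), and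
    \<open>c\<close> would be a socle element outside \<open>A\<close>.\<close>
  have fin1: "finite {t. linear_form n t \<in> P}" if P: "P \<in> F" for P
  proof (rule ccontr)
    assume "infinite {t. linear_form n t \<in> P}"
    then have "max_ideal n \<subseteq> P"
      using vars_in_ideal_of_lforms homogeneous_ideal_is_ideal[OF hidF[OF P]] by (intro max_ideal_subset_vars) auto
    moreover obtain c q where c: "P = colon n A c" "c \<in> ?H q" "c \<notin> A" using P by (auto simp: F_def)
    ultimately have "c \<in> socle n A" by (auto simp: socle_def colon_def mult.commute)
    with socle c(3) show False by blast
  qed
  \<comment> \<open>A linear form that kills \<open>x\<close> modulo \<open>A\<close> kills each
    component of \<open>x\<close>, one of which is outside \<open>A\<close>; the annihilator of that
    component lies in a maximal one.\<close>
  have bad: "{t. \<not> nonzerodivisor n (linear_form n t) A} \<subseteq> (\<Union>P\<in>M. {t. linear_form n t \<in> P})"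
  proof
    fix t assume "t \<in> {t. \<not> nonzerodivisor n (linear_form n t) A}"
    then obtain x where x: "x \<in> polys n" "linear_form n t * x \<in> A" "x \<notin> A" by (auto simp: nonzerodivisor_def)
    obtain q where q: "hcomp q x \<notin> A"
      using is_ideal_sum[OF Ai, of "total_deg ` keys x" "\<lambda>q. hcomp q x"] x(3) by (auto simp: sum_hcomp')
    have "hcomp (q + 1) (x * linear_form n t) \<in> A" using x A by (simp add: homogeneous_ideal_hcomp mult.commute)
    then have "hcomp q x * linear_form n t \<in> A"
      using hcomp_mult[OF x(1) linear_form_homogeneous, of "q + 1" t] by simp
    then have "linear_form n t \<in> colon n A (hcomp q x)"
      using homogeneous_polys[OF linear_form_homogeneous] by (auto simp: colon_def)
    moreover have "colon n A (hcomp q x) \<in> F"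
      unfolding F_def using q hcomp_homogeneous[OF x(1)] by blast
    ultimately have ne: "{P \<in> F. linear_form n t \<in> P} \<noteq> {}" by blast
    have "\<exists>P\<in>{P \<in> F. linear_form n t \<in> P}. \<forall>Q\<in>{P \<in> F. linear_form n t \<in> P}. P \<subseteq> Q \<longrightarrow> P = Q"
      by (rule exists_maximal_homogeneous_ideal[OF ne]) (use hidF in auto)
    then obtain P where P: "P \<in> F" "linear_form n t \<in> P"
      "\<And>Q. Q \<in> F \<Longrightarrow> linear_form n t \<in> Q \<Longrightarrow> P \<subseteq> Q \<Longrightarrow> P = Q" by auto
    then have "P \<in> M" unfolding M_def by blast
    then show "t \<in> (\<Union>P\<in>M. {t. linear_form n t \<in> P})" using P(2) by blast
  qed
  \<comment> \<open>For \<open>x\<close> outside P = (A : c), the element \<open>c * x\<close> is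
    still outside \<open>A\<close>, and its annihilator contains \<open>P\<close>; by maximality
    they coincide.\<close>
  have prime: "y \<in> P" if P: "P \<in> M" and x: "x \<in> ?H q" "x \<notin> P" and xy: "x * y \<in> P" and y: "y \<in> polys n" for P x y q
  proof -
    obtain c q' where c: "P = colon n A c" "c \<in> ?H q'" "c \<notin> A" using P by (auto simp: F_def M_def)
    have "c * x \<notin> A" "c * x \<in> ?H (q' + q)"
      using x c homogeneous_mult[OF c(2) x(1)] by (auto simp: colon_def)
    then have "colon n A (c * x) \<in> F" by (auto simp: F_def)
    moreover have "P \<subseteq> colon n A (c * x)"
    proof
      fix z assume "z \<in> P"
      then have "z \<in> polys n" "c * z \<in> A" using c(1) by (auto simp: colon_def)
      moreover from this(2) have "x * (c * z) \<in> A"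
        by (rule idlD(4)[OF Ai]) (use x(1) in simp)
      ultimately show "z \<in> colon n A (c * x)" by (simp add: colon_def ac_simps)
    qed
    ultimately have "P = colon n A (c * x)" using P by (auto simp: M_def)
    moreover have "y \<in> colon n A (c * x)" using xy y c by (auto simp: colon_def ac_simps)
    ultimately show ?thesis by simp
  qed
  have "finite M"
  proof (rule ccontr)
    assume "infinite M"
    then obtain P :: "nat \<Rightarrow> 'k mpoly set" where P: "inj P" "range P \<subseteq> M"
      using infinite_countable_subset by blast
    have PM: "P j \<in> M" for j using P(2) by auto
    have "\<exists>c q. P j = colon n A c \<and> c \<in> ?H q \<and> c \<notin> A" for j
      using PM[of j] by (auto simp: F_def M_def)
    then obtain c q where c: "\<And>j. P j = colon n A (c j)" "\<And>j. c j \<in> ?H (q j)" "\<And>j. c j \<notin> A"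
      by metis
    \<comment> \<open>\<open>C j\<close> is \<open>A\<close> enlarged by \<open>c 0\<close>, ...,
      \<open>c (j - 1)\<close>. The chain ascends strictly: factors \<open>r i\<close> in
      \<open>P i\<close> but outside \<open>P j\<close> have a product that kills \<open>C j\<close>
      modulo \<open>A\<close>, yet avoids the prime \<open>P j\<close>.\<close>
    define C where "C = rec_nat A (\<lambda>j B. adjoin n B (c j))"
    have C0: "C 0 = A" and CS: "C (Suc j) = adjoin n (C j) (c j)" for j by (simp_all add: C_def)
    have hidC: "homogeneous_ideal n (C j)" for j
      by (induction j) (auto simp: C0 CS A intro: homogeneous_ideal_adjoin[OF _ c(2)])
    have "c j \<notin> C j" for j
    proof
      assume cj: "c j \<in> C j"
      have "\<exists>r p. r \<in> ?H p \<and> r \<in> P i \<and> r \<notin> P j" if "i < j" for i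
      proof -
        have "\<not> P i \<subseteq> P j"
        proof
          assume "P i \<subseteq> P j"
          then have "P i = P j" using PM[of i] PM[of j] by (auto simp: M_def)
          with P(1) that show False by (auto simp: inj_def)
        qed
        then show ?thesis
          using homogeneous_ideal_subsetI[of n "P i" "P j"] hidF PM[of i] PM[of j] by (auto simp: M_def dest: homogeneous_ideal_is_ideal)
      qed
      then obtain r p where r: "\<And>i. i < j \<Longrightarrow> r i \<in> ?H (p i) \<and> r i \<in> P i \<and> r i \<notin> P j"
        by metis
      have kill: "(\<Prod>i<k. r i) * x \<in> A" if "k \<le> j" "x \<in> C k" for k x
        using that
      proof (induction k arbitrary: x)
        case 0
        then show ?case by (simp add: C0)
      next
        case (Suc k)
        obtain a s where as: "x = a + c k * s" "a \<in> C k" "s \<in> polys n"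
          using Suc.prems(2) by (auto simp: CS adjoin_def)
        have rk: "r k \<in> polys n" "c k * r k \<in> A" using r[of k] Suc.prems(1) c(1)[of k] by (auto simp: colon_def)
        have rp: "(\<Prod>i<k. r i) \<in> polys n"
          using r Suc.prems(1) by (intro polys_prod) (meson Suc_le_lessD homogeneous_polys lessThan_iff less_trans)
        have "(\<Prod>i<k. r i) * a \<in> A" using Suc as(2) by simp
        then have "r k * ((\<Prod>i<k. r i) * a) \<in> A" using rk(1) by (rule idlD(4)[OF Ai])
        moreover have "((\<Prod>i<k. r i) * s) * (c k * r k) \<in> A"
          using rk(2) by (rule idlD(4)[OF Ai]) (use rp as(3) in simp)
        ultimately have "r k * ((\<Prod>i<k. r i) * a) + ((\<Prod>i<k. r i) * s) * (c k * r k) \<in> A"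
          by (rule idlD(3)[OF Ai])
        then show ?case by (simp add: as(1) algebra_simps)
      qed
      have avoid: "(\<Prod>i<k. r i) \<in> polys n \<and> (\<Prod>i<k. r i) \<notin> P j" if "k \<le> j" for k
        using that
      proof (induction k)
        case 0
        then show ?case using c(1)[of j] c(3)[of j] by (simp add: colon_def)
      next
        case (Suc k)
        then show ?case using r[of k] prime[OF PM[of j], of "r k" "p k" "\<Prod>i<k. r i"]
          by (auto simp: mult.commute)
      qed
      have "(\<Prod>i<j. r i) \<in> P j"
        using kill[OF le_refl cj] avoid[of j] unfolding c(1)[of j] colon_def by (simp add: mult.commute)
      with avoid[of j] show False by simp
    qed
    moreover have "c j \<in> C (Suc j)" for j using homogeneous_ideal_is_ideal[OF hidC[of j]] by (simp add: CS adjoin_self)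
    ultimately have "\<exists>q. \<exists>x \<in> ?H q. x \<in> C (Suc j) \<and> x \<notin> C j" for j using c(2) by blast
    moreover have "C j \<subseteq> C (Suc j)" for j unfolding CS by (rule adjoin_superset)
    ultimately show False by (intro noetherian_homogeneous[of n C]) (auto intro: homogeneous_ideal_is_ideal[OF hidC])
  qed
  moreover have "finite {t. linear_form n t \<in> P}" if "P \<in> M" for P using fin1 that by (auto simp: M_def)
  ultimately have "finite (\<Union>P\<in>M. {t. linear_form n t \<in> P})" by blast
  with bad show ?thesis by (rule finite_subset)
qed

section \<open>Socles of complete intersections\<close>

definition socle_zero :: "nat \<Rightarrow> 'k::field mpoly set \<Rightarrow> bool" where
  "socle_zero n A \<longleftrightarrow> socle n A \<subseteq> A"

text \<open>Dimension at most one of the socle of S/A, expressed by the linear dependence of any two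
  representatives, which transfers along relations without the choice of a map.\<close>

definition socle_le_1 :: "nat \<Rightarrow> 'k::field mpoly set \<Rightarrow> bool" where
  "socle_le_1 n A \<longleftrightarrow> (\<forall>x\<in>socle n A. \<forall>y\<in>socle n A.
     \<exists>a b. (a \<noteq> 0 \<or> b \<noteq> 0) \<and> mpoly_const a * x + mpoly_const b * y \<in> A)"

context
  fixes n :: nat and A :: "'k::field mpoly set" and g h :: "'k mpoly"
  assumes A: "is_ideal n A" and g: "g \<in> max_ideal n" "nonzerodivisor n g A" and h: "h \<in> max_ideal n" "nonzerodivisor n h A"
begin

text \<open>\<open>g\<close> lies in the maximal ideal and therefore sends \<open>y\<close> into A +
  hS; \<open>x\<close> is the cofactor of \<open>h\<close>. Whether u x lies in A + gS is decided
  after multiplication by \<open>h\<close>, which cancels modulo \<open>A\<close>.\<close>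

lemma socle_exchange:
  assumes y: "y \<in> socle n (adjoin n A h)"
  shows "\<exists>x\<in>socle n (adjoin n A g). g * y - h * x \<in> A"
proof -
  have yp: "y \<in> polys n" and gp: "g \<in> polys n" and hp: "h \<in> polys n"
    using y g h by (auto simp: socle_def max_ideal_polys)
  have "g * y \<in> adjoin n A h" using y g by (auto simp: socle_def)
  then obtain a x where ax: "g * y = a + h * x" "a \<in> A" "x \<in> polys n" by (auto simp: adjoin_def)
  have "u * x \<in> adjoin n A g" if u: "u \<in> max_ideal n" for u
  proof -
    have up: "u \<in> polys n" using u by (rule max_ideal_polys)
    have "u * y \<in> adjoin n A h" using y u by (auto simp: socle_def)
    then obtain a' w where aw: "u * y = a' + h * w" "a' \<in> A" "w \<in> polys n" by (auto simp: adjoin_def)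
    have "h * (u * x - g * w) = u * (h * x) - g * (h * w)" by (simp add: algebra_simps)
    also have "h * x = g * y - a" using ax(1) by simp
    also have "h * w = u * y - a'" using aw(1) by simp
    finally have "h * (u * x - g * w) = g * a' - u * a" by (simp add: algebra_simps)
    also have "\<dots> \<in> A" using aw(2) ax(2) gp up by (intro is_ideal_diff[OF A] idlD(4)[OF A])
    finally have "u * x - g * w \<in> A" using h(2) up gp ax(3) aw(3) by (simp add: nonzerodivisor_def)
    then have "(u * x - g * w) + g * w \<in> adjoin n A g" using aw(3) by (rule adjI)
    then show ?thesis by simp
  qed
  then have "x \<in> socle n (adjoin n A g)" using ax(3) by (simp add: socle_def)
  moreover have "g * y - h * x \<in> A" using ax(1,2) by simp
  ultimately show ?thesis by blast
qed

text \<open>Injectivity of the correspondence between the two socles; here it is \<open>g\<close>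
  that cancels modulo \<open>A\<close>.\<close>

lemma exchange_mem:
  assumes xy: "g * y - h * x \<in> A" and x: "x \<in> adjoin n A g" and y: "y \<in> polys n"
  shows "y \<in> adjoin n A h"
proof -
  have gp: "g \<in> polys n" and hp: "h \<in> polys n" using g h by (auto simp: max_ideal_polys)
  obtain a w where aw: "x = a + g * w" "a \<in> A" "w \<in> polys n" using x by (auto simp: adjoin_def)
  have "g * (y - h * w) = (g * y - h * x) + h * a" by (simp add: aw(1) algebra_simps)
  also have "\<dots> \<in> A" using xy aw(2) hp by (intro idlD(3)[OF A] idlD(4)[OF A])
  finally have "y - h * w \<in> A" using g(2) y hp aw(3) by (simp add: nonzerodivisor_def)
  then have "(y - h * w) + h * w \<in> adjoin n A h" using aw(3) by (rule adjI)
  then show ?thesis by simp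
qed

lemma socle_zero_exchange: "socle_zero n (adjoin n A g) \<Longrightarrow> socle_zero n (adjoin n A h)"
  using socle_exchange exchange_mem unfolding socle_zero_def by (force simp: socle_def)

text \<open>The relation \<open>g * y - h * x \<in> A\<close> is K-linear, so a dependence between
  \<open>x1\<close> and \<open>x2\<close> is also one between \<open>y1\<close> and
  \<open>y2\<close>, by \<open>exchange_mem\<close>.\<close>

lemma socle_le_1_exchange:
  assumes "socle_le_1 n (adjoin n A g)"
  shows "socle_le_1 n (adjoin n A h)"
  unfolding socle_le_1_def
proof (intro ballI)
  fix y1 y2 assume y: "y1 \<in> socle n (adjoin n A h)" "y2 \<in> socle n (adjoin n A h)"
  obtain x1 where x1: "x1 \<in> socle n (adjoin n A g)" "g * y1 - h * x1 \<in> A" using socle_exchange[OF y(1)] by blast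
  obtain x2 where x2: "x2 \<in> socle n (adjoin n A g)" "g * y2 - h * x2 \<in> A" using socle_exchange[OF y(2)] by blast
  obtain a b where ab: "a \<noteq> 0 \<or> b \<noteq> 0" "mpoly_const a * x1 + mpoly_const b * x2 \<in> adjoin n A g"
    using assms x1 x2 unfolding socle_le_1_def by blast
  have "g * (mpoly_const a * y1 + mpoly_const b * y2) - h * (mpoly_const a * x1 + mpoly_const b * x2)
     = mpoly_const a * (g * y1 - h * x1) + mpoly_const b * (g * y2 - h * x2)"
    by (simp add: algebra_simps)
  also have "\<dots> \<in> A" using x1(2) x2(2) by (intro idlD(3)[OF A] idlD(4)[OF A]) auto
  finally have "mpoly_const a * y1 + mpoly_const b * y2 \<in> adjoin n A h"
    using ab(2) by (rule exchange_mem) (use y in \<open>auto simp: socle_def\<close>)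
  with ab(1) show "\<exists>a b. (a \<noteq> 0 \<or> b \<noteq> 0) \<and> mpoly_const a * y1 + mpoly_const b * y2 \<in> adjoin n A h"
    by blast
qed

end

section \<open>Homogeneous regular sequences and their permutation\<close>

abbreviation list_ideal :: "nat \<Rightarrow> 'k::field mpoly list \<Rightarrow> 'k mpoly set" where
  "list_ideal n xs \<equiv> genideal (mpoly_ring n) (set xs)"

text \<open>The list is in reverse order: the last entry is the first element of the sequence.\<close>

fun regular_list :: "nat \<Rightarrow> 'k::field mpoly list \<Rightarrow> bool" where
  "regular_list n [] \<longleftrightarrow> True"
| "regular_list n (g # xs) \<longleftrightarrow> (\<exists>e\<ge>1. g \<in> homogeneous_part n e) \<and> nonzerodivisor n g (list_ideal n xs) \<and> regular_list n xs"

lemma regular_list_homogeneous: "regular_list n xs \<Longrightarrow> x \<in> set xs \<Longrightarrow> \<exists>e\<ge>1. x \<in> homogeneous_part n e"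
  by (induction xs) auto

lemma regular_list_polys: "regular_list n xs \<Longrightarrow> set xs \<subseteq> polys n"
  using regular_list_homogeneous homogeneous_polys by blast

lemma regular_list_homogeneous_ideal: "regular_list n xs \<Longrightarrow> homogeneous_ideal n (list_ideal n xs)"
  by (rule homogeneous_ideal_genideal) (auto dest: regular_list_homogeneous)

lemma list_ideal_Cons: "regular_list n xs \<Longrightarrow> g \<in> polys n \<Longrightarrow> list_ideal n (g # xs) = adjoin n (list_ideal n xs) g"
  by (simp add: genideal_insert regular_list_polys)

text \<open>The ideal (A : g) is homogeneous, so testing forms is enough.\<close>

lemma nonzerodivisor_homogeneousI:
  assumes A: "homogeneous_ideal n A" and g: "g \<in> homogeneous_part n e"
    and H: "\<And>x q. x \<in> homogeneous_part n q \<Longrightarrow> g * x \<in> A \<Longrightarrow> x \<in> A"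
  shows "nonzerodivisor n g A"
proof -
  have "colon n A g \<subseteq> A"
    by (rule homogeneous_ideal_subsetI[OF homogeneous_ideal_colon[OF A g] homogeneous_ideal_is_ideal[OF A]]) (auto simp: colon_def intro: H)
  then show ?thesis by (auto simp: nonzerodivisor_def colon_def)
qed

text \<open>The point is that \<open>f\<close> is regular modulo \<open>?A\<close> alone: if f x is
  in \<open>?A\<close>, then x = a + g r with f r in \<open>?A\<close>, and \<open>r\<close> has
  smaller degree because \<open>g\<close> has positive degree. Induction on the degree then
  applies.\<close>

lemma regular_list_swap:
  assumes "regular_list n (f # g # xs)"
  shows "regular_list n (g # f # xs)"
proof -
  let ?A = "list_ideal n xs"
  obtain e e' where g: "g \<in> homogeneous_part n e" "1 \<le> e" and f: "f \<in> homogeneous_part n e'" "1 \<le> e'"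
    using assms by auto
  have xs: "regular_list n xs" using assms by simp
  have A: "homogeneous_ideal n ?A" using xs by (rule regular_list_homogeneous_ideal)
  note Ai = homogeneous_ideal_is_ideal[OF A]
  have gp: "g \<in> polys n" and fp: "f \<in> polys n" using f g by auto
  have regg: "nonzerodivisor n g ?A" using assms by simp
  have regf: "nonzerodivisor n f (adjoin n ?A g)" using assms list_ideal_Cons[OF xs gp] by simp
  have fA: "x \<in> ?A" if "x \<in> homogeneous_part n q" "f * x \<in> ?A" for x q
    using that
  proof (induction q arbitrary: x rule: less_induct)
    case (less q)
    have "x \<in> adjoin n ?A g"
      using regf less.prems adjoin_superset[of ?A n g] by (auto simp: nonzerodivisor_def)
    then obtain a r where ar: "x = a + g * r" "a \<in> ?A"
        "r \<in> (if e \<le> q then homogeneous_part n (q - e) else {0})"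
      using adjoin_homogeneous_iff[OF A g(1), of x q] less.prems(1) by blast
    have rp: "r \<in> polys n" using ar(3) by (auto split: if_splits)
    have "g * (f * r) = f * x - f * a" by (simp add: ar(1) algebra_simps)
    also have "\<dots> \<in> ?A" using is_ideal_diff[OF Ai less.prems(2) idlD(4)[OF Ai ar(2) fp]] .
    finally have fr: "f * r \<in> ?A" using regg fp rp by (simp add: nonzerodivisor_def)
    have "r \<in> ?A"
    proof (cases "e \<le> q")
      case True
      then show ?thesis using less.IH[of "q - e" r] ar(3) fr g(2) by simp
    next
      case False
      then show ?thesis using ar(3) idlD(2)[OF Ai] by simp
    qed
    then show ?case unfolding ar(1) using ar(2) gp by (intro idlD(3)[OF Ai] idlD(4)[OF Ai])
  qed
  have "nonzerodivisor n f ?A" using A f(1) fA by (rule nonzerodivisor_homogeneousI)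
  moreover have "nonzerodivisor n g (adjoin n ?A f)"
    unfolding nonzerodivisor_def
  proof (intro ballI impI)
    fix x assume x: "x \<in> polys n" "g * x \<in> adjoin n ?A f"
    then obtain a r where ar: "g * x = a + f * r" "a \<in> ?A" "r \<in> polys n" by (auto simp: adjoin_def)
    \<comment> \<open>As \<open>f\<close> is regular modulo \<open>?A\<close> and \<open>g\<close>,
      the cofactor \<open>r\<close> is a multiple of \<open>g\<close> modulo \<open>?A\<close>,
      after which \<open>g\<close> cancels.\<close>
    have "f * r = - a + g * x" using ar(1) by simp
    also have "\<dots> \<in> adjoin n ?A g" using ar(2) x(1) by (intro adjI is_ideal_uminus[OF Ai])
    finally have "r \<in> adjoin n ?A g" using regf ar(3) by (simp add: nonzerodivisor_def)
    then obtain a' s where as: "r = a' + g * s" "a' \<in> ?A" "s \<in> polys n" by (auto simp: adjoin_def)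
    have "g * (x - f * s) = a + f * a'"
      using ar(1) by (simp add: as(1) algebra_simps)
    also have "\<dots> \<in> ?A" using ar(2) as(2) fp by (intro idlD(3)[OF Ai] idlD(4)[OF Ai])
    finally have "x - f * s \<in> ?A" using regg x(1) fp as(3) by (simp add: nonzerodivisor_def)
    then have "(x - f * s) + f * s \<in> adjoin n ?A f" using as(3) by (rule adjI)
    then show "x \<in> adjoin n ?A f" by simp
  qed
  ultimately show ?thesis using f g xs list_ideal_Cons[OF xs fp] by auto
qed

text \<open>The head of the list is the last element of the sequence, so repeated swaps bring
  \<open>g\<close> from the end of the sequence to its beginning.\<close>

lemma regular_list_move: "regular_list n (g # ys) \<Longrightarrow> regular_list n (ys @ [g])"
proof (induction ys)
  case (Cons y ys)
  from Cons.prems have 1: "regular_list n (y # g # ys)" by (rule regular_list_swap)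
  then have "regular_list n (ys @ [g])" using Cons.IH by simp
  then show ?case using 1 by simp
qed simp

text \<open>\<open>gs\<close> is the part already common to both sequences. A linear form
  \<open>g\<close> regular modulo both truncations exists by \<open>Z\<close>; exchange turns
  \<open>x\<close> into \<open>g\<close> and \<open>g\<close> into \<open>f\<close>, and the
  induction hypothesis compares the sequences after \<open>g\<close> has joined the common
  part.\<close>

lemma exchange_regular_sequences:
  fixes fs xs gs :: "'k::field_char_0 mpoly list"
  assumes "length fs = length xs" "regular_list n (fs @ gs)" "regular_list n (xs @ gs)"
    and Z: "\<And>ys :: 'k mpoly list. regular_list n ys \<Longrightarrow> length ys < length (fs @ gs) \<Longrightarrow> socle_zero n (list_ideal n ys)"
  shows "(socle_zero n (list_ideal n (xs @ gs)) \<longrightarrow> socle_zero n (list_ideal n (fs @ gs))) \<and>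
    (socle_le_1 n (list_ideal n (xs @ gs)) \<longrightarrow> socle_le_1 n (list_ideal n (fs @ gs)))"
  using assms
proof (induction fs xs arbitrary: gs rule: list_induct2)
  case (Cons f fs x xs)
  let ?F = "list_ideal n (fs @ gs)" and ?X = "list_ideal n (xs @ gs)"
  have hF: "regular_list n (fs @ gs)" and hX: "regular_list n (xs @ gs)" using Cons.prems by auto
  have "socle_zero n ?F" "socle_zero n ?X"
    using Cons.prems(3)[OF hF] Cons.prems(3)[OF hX] Cons.hyps by simp_all
  then have "finite ({t. \<not> nonzerodivisor n (linear_form n t) ?F} \<union> {t. \<not> nonzerodivisor n (linear_form n t) ?X})"
    using finite_nonregular_lforms[OF regular_list_homogeneous_ideal[OF hF]] finite_nonregular_lforms[OF regular_list_homogeneous_ideal[OF hX]]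
    by (simp add: socle_zero_def)
  moreover have "infinite (UNIV :: 'k set)" by (rule infinite_UNIV_char_0)
  ultimately obtain t where t: "t \<notin> {t. \<not> nonzerodivisor n (linear_form n t) ?F} \<union> {t. \<not> nonzerodivisor n (linear_form n t) ?X}"
    using ex_new_if_finite by blast
  define g where "g = linear_form n t"
  have g: "g \<in> homogeneous_part n 1" "nonzerodivisor n g ?F" "nonzerodivisor n g ?X"
    using t linear_form_homogeneous by (auto simp: g_def)
  have gp: "g \<in> polys n" using g(1) by simp
  have F': "regular_list n (fs @ (gs @ [g]))" and X': "regular_list n (xs @ (gs @ [g]))"
    using regular_list_move[of n g "fs @ gs"] regular_list_move[of n g "xs @ gs"] g hF hX by auto
  have IH: "(socle_zero n (list_ideal n (xs @ gs @ [g])) \<longrightarrow> socle_zero n (list_ideal n (fs @ gs @ [g]))) \<and>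
      (socle_le_1 n (list_ideal n (xs @ gs @ [g])) \<longrightarrow> socle_le_1 n (list_ideal n (fs @ gs @ [g])))"
    using F' X' by (rule Cons.IH) (use Cons.prems(3) in auto)
  have "list_ideal n (fs @ gs @ [g]) = list_ideal n (g # fs @ gs)" "list_ideal n (xs @ gs @ [g]) = list_ideal n (g # xs @ gs)"
    by (rule arg_cong[of _ _ "genideal (mpoly_ring n)"]; auto)+
  then have eqs: "list_ideal n (fs @ gs @ [g]) = adjoin n ?F g" "list_ideal n (xs @ gs @ [g]) = adjoin n ?X g"
    using list_ideal_Cons[OF hF gp] list_ideal_Cons[OF hX gp] by simp_all
  obtain e e' where f: "f \<in> homogeneous_part n e" "1 \<le> e" "nonzerodivisor n f ?F"
     and x: "x \<in> homogeneous_part n e'" "1 \<le> e'" "nonzerodivisor n x ?X" using Cons.prems by auto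
  have eqf: "list_ideal n ((f # fs) @ gs) = adjoin n ?F f" and eqx: "list_ideal n ((x # xs) @ gs) = adjoin n ?X x"
    using list_ideal_Cons[OF hF, of f] list_ideal_Cons[OF hX, of x] f x by auto
  have m: "g \<in> max_ideal n" "f \<in> max_ideal n" "x \<in> max_ideal n"
    using homogeneous_max_ideal[OF g(1)] homogeneous_max_ideal[OF f(1,2)] homogeneous_max_ideal[OF x(1,2)] by auto
  note Fi = homogeneous_ideal_is_ideal[OF regular_list_homogeneous_ideal[OF hF]] and Xi = homogeneous_ideal_is_ideal[OF regular_list_homogeneous_ideal[OF hX]]
  show ?case
    unfolding eqf eqx
    using IH[unfolded eqs] socle_zero_exchange[OF Xi m(3) x(3) m(1) g(3)]
      socle_zero_exchange[OF Fi m(1) g(2) m(2) f(3)]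
      socle_le_1_exchange[OF Xi m(3) x(3) m(1) g(3)]
      socle_le_1_exchange[OF Fi m(1) g(2) m(2) f(3)]
    by blast
qed simp

section \<open>Ideals generated by variables, with membership tested on monomials\<close>

definition var_ideal :: "nat \<Rightarrow> nat \<Rightarrow> 'k::field mpoly set" where
  "var_ideal n k = {p \<in> polys n. \<forall>m\<in>keys p. \<exists>i<k. 0 < lookup m i}"

lemma is_ideal_var_ideal: "is_ideal n (var_ideal n k :: 'k::field mpoly set)"
proof -
  have add: "x + y \<in> var_ideal n k" if "x \<in> var_ideal n k" "y \<in> var_ideal n k" for x y :: "'k mpoly"
  proof -
    have "keys (x + y) \<subseteq> keys x \<union> keys y" by (rule Poly_Mapping.keys_add)
    then show ?thesis using that by (auto simp: var_ideal_def)
  qed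
  have mult: "r * x \<in> var_ideal n k" if x: "x \<in> var_ideal n k" and r: "r \<in> polys n" for x r :: "'k mpoly"
    unfolding var_ideal_def
  proof (intro CollectI conjI ballI)
    show "r * x \<in> polys n" using x r by (simp add: var_ideal_def)
    fix m assume "m \<in> keys (r * x)"
    then obtain a b where "b \<in> keys x" "m = a + b" using keys_mult[of r x] by auto
    then show "\<exists>i<k. 0 < lookup m i" using x by (auto simp: var_ideal_def lookup_add)
  qed
  have "var_ideal n k \<subseteq> (polys n :: 'k mpoly set)" "(0 :: 'k mpoly) \<in> var_ideal n k"
    by (auto simp: var_ideal_def)
  then show ?thesis unfolding is_ideal_def using add mult by blast
qed

lemma lookup_var_mult: "lookup (mpoly_var i * x) (monomial i 1 + m) = lookup x m"
  unfolding mpoly_var_def by (simp only: lookup_monomial_mult mult_1)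

lemma var_in_polys: "i \<le> n \<Longrightarrow> mpoly_var i \<in> polys n"
  using homogeneous_polys[OF homogeneous_var] .

lemma genideal_vars:
  assumes k: "k \<le> Suc n"
  shows "genideal (mpoly_ring n) (mpoly_var ` {..<k}) = (var_ideal n k :: 'k::field mpoly set)"
proof
  have vars: "mpoly_var ` {..<k} \<subseteq> (polys n :: 'k mpoly set)" using k by (auto intro!: var_in_polys)
  have "mpoly_var ` {..<k} \<subseteq> (var_ideal n k :: 'k mpoly set)"
    using k by (auto simp: var_ideal_def mpoly_var_def polys_single lookup_single when_def)
  then show "genideal (mpoly_ring n) (mpoly_var ` {..<k}) \<subseteq> (var_ideal n k :: 'k mpoly set)"
    by (intro mpoly.genideal_minimal) (auto simp: ideal_iff_is_ideal is_ideal_var_ideal)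
  have G: "is_ideal n (genideal (mpoly_ring n) (mpoly_var ` {..<k} :: 'k mpoly set))"
    using vars by (rule is_ideal_genideal)
  show "var_ideal n k \<subseteq> genideal (mpoly_ring n) (mpoly_var ` {..<k} :: 'k mpoly set)"
  proof
    fix p :: "'k mpoly" assume p: "p \<in> var_ideal n k"
    have "monomial m (lookup p m) \<in> genideal (mpoly_ring n) (mpoly_var ` {..<k})" if m: "m \<in> keys p" for m
    proof -
      obtain i where i: "i < k" "0 < lookup m i" using p m by (auto simp: var_ideal_def)
      have km: "keys m \<subseteq> {..n}" using p m by (auto simp: var_ideal_def polys_def)
      have "keys (m - monomial i 1) \<subseteq> {..n}"
      proof
        fix j assume "j \<in> keys (m - monomial i 1)"
        then have "j \<in> keys m" by (auto simp: in_keys_iff lookup_minus)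
        then show "j \<in> {..n}" using km by blast
      qed
      then have "monomial (m - monomial i 1) (lookup p m) \<in> polys n" by (rule polys_single)
      moreover have "mpoly_var i \<in> genideal (mpoly_ring n) (mpoly_var ` {..<k} :: 'k mpoly set)"
      proof (rule subsetD)
        show "mpoly_var ` {..<k} \<subseteq> genideal (mpoly_ring n) (mpoly_var ` {..<k} :: 'k mpoly set)"
          using vars by (intro mpoly.genideal_self) simp
      qed (use i in simp)
      ultimately have "mpoly_var i * monomial (m - monomial i 1) (lookup p m)
          \<in> genideal (mpoly_ring n) (mpoly_var ` {..<k})"
        by (intro idlD(5)[OF G])
      then show ?thesis using monomial_decompose[OF i(2), of "lookup p m"] by simp
    qed
    then have "(\<Sum>m\<in>keys p. monomial m (lookup p m)) \<in> genideal (mpoly_ring n) (mpoly_var ` {..<k})"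
      by (rule is_ideal_sum[OF G])
    then show "p \<in> genideal (mpoly_ring n) (mpoly_var ` {..<k})" by (simp add: sum_monomials)
  qed
qed

text \<open>Multiplication by x_k leaves the exponents of x_0, ..., x_(k-1) unchanged.\<close>

lemma nonzerodivisor_var: "k \<le> n \<Longrightarrow> nonzerodivisor n (mpoly_var k) (var_ideal n k)"
  unfolding nonzerodivisor_def
proof (intro ballI impI)
  fix x :: "'a mpoly" assume k: "k \<le> n" and x: "x \<in> polys n" "mpoly_var k * x \<in> var_ideal n k"
  show "x \<in> var_ideal n k"
    unfolding var_ideal_def
  proof (intro CollectI conjI ballI x(1))
    fix m assume "m \<in> keys x"
    then have "monomial k 1 + m \<in> keys (mpoly_var k * x)"
      by (simp only: in_keys_iff lookup_var_mult not_False_eq_True)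
    then obtain i where i: "i < k" "0 < lookup (monomial k 1 + m) i"
      using x(2) unfolding var_ideal_def by blast
    then have "0 < lookup m i" by (simp add: lookup_add lookup_single when_def)
    with i(1) show "\<exists>i<k. 0 < lookup m i" by blast
  qed
qed

fun vars_list :: "nat \<Rightarrow> 'k::field mpoly list" where
  "vars_list 0 = []"
| "vars_list (Suc k) = mpoly_var k # vars_list k"

lemma set_vars_list: "set (vars_list k) = mpoly_var ` {..<k}"
  by (induction k) (auto simp: lessThan_Suc)

lemma length_vars_list [simp]: "length (vars_list k) = k"
  by (induction k) auto

lemma list_ideal_vars_list: "k \<le> Suc n \<Longrightarrow> list_ideal n (vars_list k) = var_ideal n k"
  by (simp add: set_vars_list genideal_vars)

lemma regular_list_vars_list: "k \<le> Suc n \<Longrightarrow> regular_list n (vars_list k)"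
proof (induction k)
  case (Suc k)
  then show ?case using homogeneous_var[of k n]
    by (auto simp: list_ideal_vars_list[simplified] nonzerodivisor_var intro!: exI[of _ 1])
qed simp

lemma var_ideal_all: "var_ideal n (Suc n) = max_ideal n"
proof -
  have "(\<exists>i<Suc n. 0 < lookup m i) \<longleftrightarrow> m \<noteq> 0" if "keys m \<subseteq> {..n}" for m :: "nat \<Rightarrow>\<^sub>0 nat"
  proof
    assume "m \<noteq> 0"
    then obtain i where "i \<in> keys m" by (metis keys_eq_empty all_not_in_conv)
    moreover from this have "i < Suc n" using that by auto
    ultimately show "\<exists>i<Suc n. 0 < lookup m i" by (auto simp: in_keys_iff)
  qed auto
  then have "(\<forall>m\<in>keys p. \<exists>i<Suc n. 0 < lookup m i) \<longleftrightarrow> 0 \<notin> keys p" if "p \<in> polys n" for p :: "'a mpoly"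
    using that unfolding polys_def by blast
  then show ?thesis unfolding var_ideal_def max_ideal_def by (auto simp: in_keys_iff)
qed

lemma var_in_max_ideal: "i \<le> n \<Longrightarrow> mpoly_var i \<in> max_ideal n"
  using homogeneous_max_ideal[OF homogeneous_var] by simp

lemma socle_zero_vars: "k \<le> n \<Longrightarrow> socle_zero n (var_ideal n k)"
  using nonzerodivisor_var[of k n] var_in_max_ideal[of k n] by (auto simp: socle_zero_def socle_def nonzerodivisor_def)

lemma socle_le_1_vars: "socle_le_1 n (max_ideal n :: 'k::field mpoly set)"
  unfolding socle_le_1_def
proof (intro ballI)
  fix x y :: "'k mpoly" assume xy: "x \<in> socle n (max_ideal n)" "y \<in> socle n (max_ideal n)"
  then have p: "x \<in> polys n" "y \<in> polys n" by (auto simp: socle_def)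
  show "\<exists>a b. (a \<noteq> 0 \<or> b \<noteq> 0) \<and> mpoly_const a * x + mpoly_const b * y \<in> max_ideal n"
  proof (cases "lookup x 0 = 0")
    case True
    then show ?thesis using p by (intro exI[of _ 1] exI[of _ 0]) (auto simp: max_ideal_def)
  next
    case False
    then show ?thesis using p
      by (intro exI[of _ "lookup y 0"] exI[of _ "- lookup x 0"]) (auto simp: max_ideal_def lookup_add lookup_const_mult)
  qed
qed

text \<open>The comparison is with the first variables, for which the socle is read off directly.
  The strong induction provides the vanishing socles \<open>Z\<close> of shorter sequences, from
  which the regular linear forms of the exchange come.\<close>

theorem socle_regular_sequence:
  fixes fs :: "'k::field_char_0 mpoly list"
  assumes "regular_list n fs" "length fs \<le> Suc n"
  shows "if length fs \<le> n then socle_zero n (list_ideal n fs) else socle_le_1 n (list_ideal n fs)"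
  using assms
proof (induction "length fs" arbitrary: fs rule: less_induct)
  case less
  let ?k = "length fs"
  have Z: "socle_zero n (list_ideal n ys)" if "regular_list n ys" "length ys < length (fs @ [])" for ys :: "'k mpoly list"
    using less.hyps[of ys] that less.prems by simp
  let ?V = "vars_list ?k :: 'k mpoly list"
  have eq: "list_ideal n ?V = var_ideal n ?k" using less.prems(2) by (rule list_ideal_vars_list)
  have "(socle_zero n (list_ideal n (?V @ [])) \<longrightarrow> socle_zero n (list_ideal n (fs @ []))) \<and>
    (socle_le_1 n (list_ideal n (?V @ [])) \<longrightarrow> socle_le_1 n (list_ideal n (fs @ [])))"
    by (rule exchange_regular_sequences) (use less.prems regular_list_vars_list Z in auto)
  then have *: "socle_zero n (var_ideal n ?k :: 'k mpoly set) \<longrightarrow> socle_zero n (list_ideal n fs)"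
      "socle_le_1 n (var_ideal n ?k :: 'k mpoly set) \<longrightarrow> socle_le_1 n (list_ideal n fs)"
    unfolding append_Nil2 eq by simp_all
  show ?case
  proof (cases "?k \<le> n")
    case True
    then show ?thesis using *(1) socle_zero_vars by auto
  next
    case False
    then have "?k = Suc n" using less.prems(2) by simp
    then show ?thesis using *(2) by (simp add: var_ideal_all socle_le_1_vars)
  qed
qed

section \<open>Hilbert series and top-degree pairings\<close>

definition hilb_series :: "nat \<Rightarrow> 'k::field mpoly set \<Rightarrow> int fps" where
  "hilb_series n A = Abs_fps (\<lambda>p. int (hilb n A p))"

lemma nth_hilb_series [simp]: "fps_nth (hilb_series n A) p = int (hilb n A p)"
  by (simp add: hilb_series_def)

lemma nonzerodivisor_colon: "is_ideal n A \<Longrightarrow> g \<in> polys n \<Longrightarrow> nonzerodivisor n g A \<Longrightarrow> colon n A g = A"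
  using colon_superset[of n A g] by (auto simp: nonzerodivisor_def colon_def)

lemma hilb_adjoin_nonzerodivisor:
  assumes A: "homogeneous_ideal n A" and g: "g \<in> homogeneous_part n e" "nonzerodivisor n g A"
  shows "hilb n (adjoin n A g) p + (if e \<le> p then hilb n A (p - e) else 0) = hilb n A p"
  using hilb_adjoin[OF A g(1), of p] nonzerodivisor_colon[OF homogeneous_ideal_is_ideal[OF A] _ g(2)] g(1) by (simp split: if_splits)

lemma hilb_series_adjoin:
  assumes A: "homogeneous_ideal n A" and g: "g \<in> homogeneous_part n e" "nonzerodivisor n g A"
  shows "hilb_series n (adjoin n A g) = hilb_series n A * (1 - fps_X ^ e)"
proof (rule fps_ext)
  fix p
  have "fps_nth (hilb_series n A * (1 - fps_X ^ e)) p = int (hilb n A p) - (if p < e then 0 else int (hilb n A (p - e)))"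
    by (simp add: right_diff_distrib fps_X_power_mult_right_nth)
  then show "fps_nth (hilb_series n (adjoin n A g)) p = fps_nth (hilb_series n A * (1 - fps_X ^ e)) p"
    using hilb_adjoin_nonzerodivisor[OF assms, of p] by auto
qed

lemma hilb_series_list_ideal:
  fixes xs :: "'k::field mpoly list"
  assumes "regular_list n xs" "list_all2 (\<lambda>x e. x \<in> homogeneous_part n e) xs es"
  shows "hilb_series n (list_ideal n xs) = hilb_series n {0 :: 'k mpoly} * (\<Prod>e\<leftarrow>es. 1 - fps_X ^ e)"
  using assms(2,1)
proof (induction rule: list_all2_induct)
  case Nil
  then show ?case by (simp add: genideal_empty)
next
  case (Cons x xs e es)
  then have xs: "regular_list n xs" "nonzerodivisor n x (list_ideal n xs)" by auto
  have "hilb_series n (list_ideal n (x # xs)) = hilb_series n (list_ideal n xs) * (1 - fps_X ^ e)"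
    using hilb_series_adjoin[OF regular_list_homogeneous_ideal[OF xs(1)] Cons.hyps(1) xs(2)] Cons.hyps(1) list_ideal_Cons[OF xs(1), of x] by simp
  then show ?case using Cons.IH[OF xs(1)] by (simp add: ac_simps)
qed

lemma dim_homogeneous_0: "mp.dim (homogeneous_part n 0 :: 'k::field mpoly set) = 1"
proof -
  have "homogeneous_part n 0 = mp.span {1 :: 'k mpoly}"
    by (auto simp: homogeneous_0_iff mp.span_singleton mpoly_scale_def image_iff)
  then show ?thesis using mp.dim_span_eq_card_independent[of "{1 :: 'k mpoly}"] by simp
qed

lemma is_ideal_max_ideal: "is_ideal n (max_ideal n :: 'k::field mpoly set)"
  using is_ideal_var_ideal[of n "Suc n"] by (simp add: var_ideal_all)

lemma hilb_series_max_ideal: "hilb_series n (max_ideal n :: 'k::field mpoly set) = 1"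
proof (rule fps_ext)
  fix p
  have "hilb n (max_ideal n :: 'k mpoly set) p = (if p = 0 then 1 else 0)"
  proof (cases "p = 0")
    case True
    have "max_ideal n \<inter> homogeneous_part n 0 = {0 :: 'k mpoly}"
      by (auto simp: homogeneous_0_iff max_ideal_def mpoly_const_def intro!: exI[of _ "0 :: 'k"])
    then show ?thesis using True mp.dim_le_card[of "{0 :: 'k mpoly}" "{}"] by (simp add: hilb_def dim_homogeneous_0)
  next
    case False
    then have "homogeneous_part n p \<subseteq> (max_ideal n :: 'k mpoly set)" using homogeneous_max_ideal[of _ n p] by auto
    then show ?thesis using False by (simp add: hilb_eq_0_iff is_ideal_max_ideal)
  qed
  then show "fps_nth (hilb_series n (max_ideal n :: 'k mpoly set)) p = fps_nth 1 p" by simp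
qed

text \<open>The variables form a regular sequence with quotient K, of Hilbert series 1; this
  determines the series of S with no count of monomials.\<close>

lemma hilb_series_zero: "hilb_series n {0 :: 'k::field mpoly} * (1 - fps_X) ^ Suc n = 1"
proof -
  have "list_all2 (\<lambda>x e. x \<in> homogeneous_part n e) (vars_list k :: 'k mpoly list) (replicate k 1)" if "k \<le> Suc n" for k
    using that by (induction k) (auto simp: homogeneous_var[simplified])
  from hilb_series_list_ideal[OF regular_list_vars_list[of "Suc n" n] this[of "Suc n"]]
  have "hilb_series n (list_ideal n (vars_list (Suc n)) :: 'k mpoly set) = hilb_series n {0 :: 'k mpoly} * (1 - fps_X) ^ Suc n"
    by simp
  then show ?thesis
    by (simp only: list_ideal_vars_list[OF order_refl] var_ideal_all hilb_series_max_ideal)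
qed

definition geom_poly :: "nat \<Rightarrow> int poly" where
  "geom_poly d = (\<Sum>k<d. Polynomial.monom 1 k)"

lemma coeff_geom_poly: "Polynomial.coeff (geom_poly d) k = (if k < d then 1 else 0)"
  by (simp add: geom_poly_def coeff_sum coeff_monom sum.delta)

lemma degree_geom_poly: "1 \<le> d \<Longrightarrow> Polynomial.degree (geom_poly d) = d - 1"
  by (intro antisym degree_le le_degree) (auto simp: coeff_geom_poly)

lemma geom_poly_fps: "fps_of_poly (geom_poly d) = (\<Sum>k<d. fps_X ^ k)"
  by (simp add: geom_poly_def fps_of_poly_sum fps_of_poly_monom)

lemma one_minus_X_power: "(1 - fps_X ^ d :: int fps) = (1 - fps_X) * fps_of_poly (geom_poly d)"
  by (simp add: geom_poly_fps one_diff_power_eq)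

text \<open>The product will be the Hilbert series of S/(Q + zS), so this fixes the last nonzero
  degree of that ring and the dimension one there.\<close>

lemma degree_lead_prod_geom_poly:
  assumes "\<And>j. j \<in> D \<Longrightarrow> 1 \<le> d j" "finite D"
  shows "Polynomial.degree (\<Prod>j\<in>D. geom_poly (d j)) = (\<Sum>j\<in>D. d j - 1) \<and>
    Polynomial.lead_coeff (\<Prod>j\<in>D. geom_poly (d j)) = 1"
proof
  have lc: "Polynomial.lead_coeff (geom_poly (d j)) = 1" if "j \<in> D" for j
    using assms(1)[OF that] by (simp add: degree_geom_poly coeff_geom_poly)
  then have "geom_poly (d j) \<noteq> 0" if "j \<in> D" for j using that by fastforce
  then show "Polynomial.degree (\<Prod>j\<in>D. geom_poly (d j)) = (\<Sum>j\<in>D. d j - 1)"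
    using assms degree_geom_poly by (subst degree_prod_eq_sum_degree) (auto intro!: sum.cong)
  show "Polynomial.lead_coeff (\<Prod>j\<in>D. geom_poly (d j)) = 1"
    using lc by (simp add: lead_coeff_prod)
qed

section \<open>Socle elements and the top degree of graded Artinian quotients\<close>

lemma const_mult_mem_iff:
  assumes "is_ideal n B" "x \<in> polys n" "c \<noteq> 0"
  shows "mpoly_const c * x \<in> B \<longleftrightarrow> x \<in> B"
proof
  assume "mpoly_const c * x \<in> B"
  then have "mpoly_const (1 / c) * (mpoly_const c * x) \<in> B" by (rule idlD(4)[OF assms(1)]) simp
  moreover have "mpoly_const (1 / c) * (mpoly_const c * x) = x"
    using assms(3) by (simp add: mult.assoc[symmetric] flip: mpoly_const_mult)
  ultimately show "x \<in> B" by simp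
qed (auto intro: idlD(4)[OF assms(1)])

lemma socle_memI:
  assumes B: "is_ideal n B" and x: "x \<in> polys n"
    and H: "\<And>p y. 1 \<le> p \<Longrightarrow> y \<in> homogeneous_part n p \<Longrightarrow> x * y \<in> B"
  shows "x \<in> socle n B"
proof -
  have "max_ideal n \<subseteq> colon n B x"
    by (rule max_ideal_subset_homogeneous[OF is_ideal_colon[OF B x]]) (auto simp: colon_def H)
  then show ?thesis using x by (auto simp: socle_def colon_def mult.commute)
qed

lemma socle_top_degree:
  fixes B :: "'k::field mpoly set"
  assumes B: "is_ideal n B" and top: "\<And>p. a < p \<Longrightarrow> homogeneous_part n p \<subseteq> B" and s: "s \<in> homogeneous_part n a"
  shows "s \<in> socle n B"
proof (rule socle_memI[OF B])
  fix p and y :: "'k mpoly" assume "1 \<le> p" "y \<in> homogeneous_part n p"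
  then show "s * y \<in> B" using homogeneous_mult[OF s, of y p] top[of "a + p"] by auto
qed (use s in simp)

text \<open>For \<open>u\<close> outside \<open>B\<close>, choose \<open>w\<close> of maximal degree
  with u w outside \<open>B\<close>. Then u w and \<open>s\<close> are both socle elements modulo
  \<open>B\<close>, so the bound on the socle forces u w into degree \<open>a\<close> and
  \<open>w\<close> into degree \<open>q\<close>, against \<open>uB\<close>.\<close>

lemma nondegenerate_top:
  fixes B :: "'k::field mpoly set"
  assumes B: "homogeneous_ideal n B" and socle: "socle_le_1 n B"
    and top: "\<And>p. a < p \<Longrightarrow> homogeneous_part n p \<subseteq> B"
    and s: "s \<in> homogeneous_part n a" "s \<notin> B"
    and u: "u \<in> homogeneous_part n p" and pq: "p + q = a"
    and uB: "\<And>w. w \<in> homogeneous_part n q \<Longrightarrow> u * w \<in> B"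
  shows "u \<in> B"
proof (rule ccontr)
  assume nu: "u \<notin> B"
  note Bi = homogeneous_ideal_is_ideal[OF B]
  define R where "R = {r. \<exists>w\<in>homogeneous_part n r. u * w \<notin> B}"
  have "0 \<in> R" using nu homogeneous_1[of n] by (auto simp: R_def intro!: bexI[of _ 1])
  have "r \<le> a" if r: "r \<in> R" for r
  proof (rule ccontr)
    assume "\<not> r \<le> a"
    then have "homogeneous_part n (p + r) \<subseteq> B" using top by simp
    then show False using r homogeneous_mult[OF u] by (auto simp: R_def)
  qed
  then have fin: "finite R" by (intro finite_subset[of R "{..a}"]) auto
  define r where "r = Max R"
  have "r \<in> R" unfolding r_def using fin \<open>0 \<in> R\<close> by (intro Max_in) auto
  then obtain w where w: "w \<in> homogeneous_part n r" "u * w \<notin> B" by (auto simp: R_def)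
  have nR: "r' \<notin> R" if "r < r'" for r' using Max_ge[OF fin, of r'] that by (auto simp: r_def)
  have uw: "u * w \<in> homogeneous_part n (p + r)" using u w(1) by (rule homogeneous_mult)
  have "u * w \<in> socle n B"
  proof (rule socle_memI[OF Bi])
    fix p' and y :: "'k mpoly" assume "1 \<le> p'" "y \<in> homogeneous_part n p'"
    then show "(u * w) * y \<in> B"
      using nR[of "r + p'"] homogeneous_mult[OF w(1), of y p'] by (auto simp: R_def mult.assoc)
  qed (use uw in simp)
  moreover have "s \<in> socle n B" using Bi top s(1) by (rule socle_top_degree)
  ultimately obtain c1 c2 where c: "c1 \<noteq> 0 \<or> c2 \<noteq> 0" "mpoly_const c1 * (u * w) + mpoly_const c2 * s \<in> B"
    using socle unfolding socle_le_1_def by blast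
  have neq: "p + r \<noteq> a" using pq w uB by auto
  have h1: "mpoly_const c1 * (u * w) \<in> homogeneous_part n (p + r)" using uw by (rule homogeneous_const_mult)
  have h2: "mpoly_const c2 * s \<in> homogeneous_part n a" using s(1) by (rule homogeneous_const_mult)
  \<comment> \<open>The two terms of the relation have different degrees, so each of them lies in
    \<open>B\<close> by homogeneity.\<close>
  have "mpoly_const c1 * (u * w) \<in> B"
    using homogeneous_ideal_hcomp[OF B c(2), of "p + r"] neq
    by (simp add: hcomp_add hcomp_of_homogeneous[OF h1] hcomp_of_homogeneous[OF h2])
  moreover have "mpoly_const c2 * s \<in> B"
    using homogeneous_ideal_hcomp[OF B c(2), of a] neq
    by (simp add: hcomp_add hcomp_of_homogeneous[OF h1] hcomp_of_homogeneous[OF h2])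
  ultimately show False
    using c(1) const_mult_mem_iff[OF Bi, of "u * w" c1] const_mult_mem_iff[OF Bi, of s c2] uw s w(2)
    by auto
qed

text \<open>All forms of degree \<open>a\<close> are socle elements, hence pairwise dependent modulo
  \<open>B\<close>; one of them generates the degree together with \<open>B\<close>, at the cost of
  dim S_0 = 1.\<close>

lemma hilb_top_le_1:
  fixes B :: "'k::field mpoly set"
  assumes B: "homogeneous_ideal n B" and socle: "socle_le_1 n B"
    and top: "\<And>p. a < p \<Longrightarrow> homogeneous_part n p \<subseteq> B"
  shows "hilb n B a \<le> 1"
proof (cases "homogeneous_part n a \<subseteq> B")
  case True
  then show ?thesis using hilb_eq_0_iff[OF homogeneous_ideal_is_ideal[OF B], of a] by simp
next
  case False
  note Bi = homogeneous_ideal_is_ideal[OF B]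
  obtain s where s: "s \<in> homogeneous_part n a" "s \<notin> B" using False by blast
  have "homogeneous_part n a \<subseteq> adjoin n B s"
  proof
    fix y :: "'k mpoly" assume y: "y \<in> homogeneous_part n a"
    obtain c1 c2 where c: "c1 \<noteq> 0 \<or> c2 \<noteq> 0" "mpoly_const c1 * s + mpoly_const c2 * y \<in> B"
      using socle socle_top_degree[OF Bi top s(1)] socle_top_degree[OF Bi top y] unfolding socle_le_1_def by blast
    have "c2 \<noteq> 0"
    proof
      assume "c2 = 0"
      then show False using c const_mult_mem_iff[OF Bi, of s c1] s by simp
    qed
    have "(mpoly_const c1 * s + mpoly_const c2 * y) + s * (- mpoly_const c1) \<in> adjoin n B s"
      using c(2) by (rule adjI) simp
    then have "mpoly_const c2 * y \<in> adjoin n B s" by (simp add: mult.commute)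
    then show "y \<in> adjoin n B s"
      using const_mult_mem_iff[OF is_ideal_adjoin[OF Bi], of s y c2] s y \<open>c2 \<noteq> 0\<close> by simp
  qed
  then have "hilb n (adjoin n B s) a = 0" using hilb_eq_0_iff[OF is_ideal_adjoin[OF Bi, of s]] s by simp
  then show ?thesis
    using hilb_adjoin[OF B s(1), of a] dim_homogeneous_0[where 'k='k, of n] by (simp add: hilb_def)
qed

text \<open>The Hilbert function modulo \<open>z\<close> is the first difference, so the sum
  telescopes.\<close>

lemma hilb_partial_sum:
  assumes A: "homogeneous_ideal n A" and z: "z \<in> homogeneous_part n 1" "nonzerodivisor n z A"
  shows "(\<Sum>p\<le>m. hilb n (adjoin n A z) p) = hilb n A m"
proof (induction m)
  case 0
  then show ?case using hilb_adjoin_nonzerodivisor[OF assms, of 0] by simp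
next
  case (Suc m)
  then show ?case using hilb_adjoin_nonzerodivisor[OF assms, of "Suc m"] by simp
qed

lemma adjoin_mono: "A \<subseteq> B \<Longrightarrow> adjoin n A g \<subseteq> adjoin n B g"
  by (auto simp: adjoin_def)

text \<open>Above \<open>a\<close> the first difference vanishes.\<close>

lemma hilb_stable:
  assumes A: "homogeneous_ideal n A" and z: "z \<in> homogeneous_part n 1" "nonzerodivisor n z A"
    and top: "\<And>p. a < p \<Longrightarrow> homogeneous_part n p \<subseteq> adjoin n A z" and N: "a \<le> N"
  shows "hilb n A N = hilb n A a"
  using N
proof (induction N rule: dec_induct)
  case (step N)
  then have "hilb n (adjoin n A z) (Suc N) = 0"
    using top[of "Suc N"] hilb_eq_0_iff[OF is_ideal_adjoin[OF homogeneous_ideal_is_ideal[OF A]], of z] z by simp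
  then show ?case using hilb_adjoin_nonzerodivisor[OF A z, of "Suc N"] step by simp
qed simp

section \<open>Liaison\<close>

text \<open>Saturation tested on forms of all high degrees, which suits the grading;
  \<open>saturation_eq_sat_ideal\<close> identifies it with the union of colon ideals by
  powers.\<close>

definition sat_ideal :: "nat \<Rightarrow> 'k::field mpoly set \<Rightarrow> 'k mpoly set" where
  "sat_ideal n J = {x \<in> polys n. \<exists>k. \<forall>q\<ge>k. \<forall>y\<in>homogeneous_part n q. x * y \<in> J}"

lemma sat_ideal_superset: "is_ideal n J \<Longrightarrow> J \<subseteq> sat_ideal n J"
  unfolding sat_ideal_def using idlD(1,5) homogeneous_polys by blast

lemma homogeneous_ideal_sat_ideal:
  fixes J :: "'k::field mpoly set"
  assumes J: "homogeneous_ideal n J"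
  shows "homogeneous_ideal n (sat_ideal n J)"
proof -
  note Ji = homogeneous_ideal_is_ideal[OF J]
  have add: "x + y \<in> sat_ideal n J" if xy: "x \<in> sat_ideal n J" "y \<in> sat_ideal n J" for x y
  proof -
    obtain k l where "\<forall>q\<ge>k. \<forall>w\<in>homogeneous_part n q. x * w \<in> J" "\<forall>q\<ge>l. \<forall>w\<in>homogeneous_part n q. y * w \<in> J"
      using xy by (auto simp: sat_ideal_def)
    then have "\<forall>q\<ge>max k l. \<forall>w\<in>homogeneous_part n q. (x + y) * w \<in> J"
      by (auto simp: distrib_right intro: idlD(3)[OF Ji])
    moreover have "x + y \<in> polys n" using xy by (auto simp: sat_ideal_def)
    ultimately show ?thesis unfolding sat_ideal_def by blast
  qed
  have mult: "r * x \<in> sat_ideal n J" if x: "x \<in> sat_ideal n J" and r: "r \<in> polys n" for x r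
  proof -
    obtain k where "\<forall>q\<ge>k. \<forall>w\<in>homogeneous_part n q. x * w \<in> J" using x by (auto simp: sat_ideal_def)
    then have "\<forall>q\<ge>k. \<forall>w\<in>homogeneous_part n q. r * (x * w) \<in> J"
      using r by (auto intro: idlD(4)[OF Ji])
    then have "\<forall>q\<ge>k. \<forall>w\<in>homogeneous_part n q. (r * x) * w \<in> J" by (simp add: mult.assoc)
    moreover have "r * x \<in> polys n" using x r by (auto simp: sat_ideal_def)
    ultimately show ?thesis unfolding sat_ideal_def by blast
  qed
  have comp: "hcomp i x \<in> sat_ideal n J" if x: "x \<in> sat_ideal n J" for x i
  proof -
    obtain k where k: "\<And>q w. k \<le> q \<Longrightarrow> w \<in> homogeneous_part n q \<Longrightarrow> x * w \<in> J" and xp: "x \<in> polys n"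
      using x by (auto simp: sat_ideal_def)
    have "hcomp i x * w \<in> J" if "k \<le> q" "w \<in> homogeneous_part n q" for q w
      using homogeneous_ideal_hcomp[OF J k[OF that], of "i + q"] hcomp_mult[OF xp that(2), of "i + q"] by simp
    then show ?thesis using xp unfolding sat_ideal_def by auto
  qed
  have "sat_ideal n J \<subseteq> polys n" "0 \<in> sat_ideal n J" using idlD(2)[OF Ji] by (auto simp: sat_ideal_def)
  then show ?thesis using add mult comp unfolding homogeneous_ideal_def is_ideal_def by blast
qed

text \<open>Above degree \<open>a\<close> every form is c + z r with \<open>c\<close> in
  \<open>J\<close>, so the annihilation of z x by forms of high degree passes to
  \<open>x\<close>.\<close>

lemma nonzerodivisor_sat_ideal:
  fixes J :: "'k::field mpoly set"
  assumes J: "homogeneous_ideal n J" and z: "z \<in> homogeneous_part n 1"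
    and top: "\<And>p. a < p \<Longrightarrow> homogeneous_part n p \<subseteq> adjoin n J z"
  shows "nonzerodivisor n z (sat_ideal n J)"
  unfolding nonzerodivisor_def
proof (intro ballI impI)
  note Ji = homogeneous_ideal_is_ideal[OF J]
  fix x assume x: "x \<in> polys n" "z * x \<in> sat_ideal n J"
  then obtain k where k: "\<And>q w. k \<le> q \<Longrightarrow> w \<in> homogeneous_part n q \<Longrightarrow> (z * x) * w \<in> J"
    by (auto simp: sat_ideal_def)
  \<comment> \<open>The bound puts \<open>w\<close> above degree \<open>a\<close> and its cofactor
    \<open>r\<close>, of degree q - 1, at degree \<open>k\<close> or more.\<close>
  have "x * w \<in> J" if q: "k + a + 1 \<le> q" and w: "w \<in> homogeneous_part n q" for q w
  proof -
    have "w \<in> adjoin n J z \<inter> homogeneous_part n q" using top[of q] q w by auto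
    then obtain c r where cr: "c \<in> J" "r \<in> homogeneous_part n (q - 1)" "w = c + z * r"
      using adjoin_homogeneous_iff[OF J z, of w q] q by auto
    have "x * c + (z * x) * r \<in> J"
      using cr(1,2) x(1) k[of "q - 1" r] q by (intro idlD(3)[OF Ji _ k] idlD(4)[OF Ji]) auto
    then show ?thesis by (simp add: cr(3) algebra_simps)
  qed
  then show "x \<in> sat_ideal n J" using x(1) unfolding sat_ideal_def by blast
qed

text \<open>Beyond \<open>N\<close> and \<open>a\<close>, multiplication by \<open>z\<close> is onto
  between pieces of S/J of equal dimension, hence injective. So z^k x in \<open>J\<close> forces
  \<open>x\<close> into \<open>J\<close>, and saturation changes nothing there.\<close>

lemma hilb_sat_ideal_eventually:
  fixes J :: "'k::field mpoly set"
  assumes J: "homogeneous_ideal n J" and z: "z \<in> homogeneous_part n 1"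
    and top: "\<And>p. a < p \<Longrightarrow> homogeneous_part n p \<subseteq> adjoin n J z"
    and const: "\<And>p. N \<le> p \<Longrightarrow> hilb n J p = hilb n J N"
    and p: "N \<le> p" "a \<le> p"
  shows "hilb n (sat_ideal n J) p = hilb n J p"
proof -
  note Ji = homogeneous_ideal_is_ideal[OF J]
  have zp: "z \<in> polys n" using z by simp
  have eq: "J \<inter> homogeneous_part n q = colon n J z \<inter> homogeneous_part n q" if "p \<le> q" for q
  proof (rule hilb_eq_imp_eq[OF Ji colon_superset[OF Ji zp]])
    have "hilb n (adjoin n J z) (Suc q) = 0"
      using hilb_eq_0_iff[OF is_ideal_adjoin[OF Ji zp]] top[of "Suc q"] that p by simp
    then show "hilb n J q \<le> hilb n (colon n J z) q"
      using hilb_adjoin[OF J z, of "Suc q"] const[of q] const[of "Suc q"] that p by simp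
  qed
  have kill: "x \<in> J" if "z ^ k * x \<in> J" "x \<in> homogeneous_part n q" "p \<le> q" for k x q
    using that
  proof (induction k)
    case (Suc k)
    have "z ^ k \<in> homogeneous_part n k"
      by (induction k) (use homogeneous_1 homogeneous_mult[OF z] in auto)
    then have h: "z ^ k * x \<in> homogeneous_part n (k + q)" using Suc.prems(2) by (rule homogeneous_mult)
    moreover have "z ^ k * x \<in> colon n J z" using Suc.prems(1) h by (simp add: colon_def mult.assoc)
    ultimately have "z ^ k * x \<in> J" using eq[of "k + q"] Suc.prems(3) by auto
    then show ?case using Suc by blast
  qed simp
  have zk: "z ^ k \<in> homogeneous_part n k" for k
    by (induction k) (use homogeneous_1 homogeneous_mult[OF z] in auto)
  have "sat_ideal n J \<inter> homogeneous_part n p = J \<inter> homogeneous_part n p"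
  proof (intro equalityI subsetI)
    fix x assume x: "x \<in> sat_ideal n J \<inter> homogeneous_part n p"
    then obtain k where "\<forall>y\<in>homogeneous_part n k. x * y \<in> J" by (auto simp: sat_ideal_def)
    then have "x * z ^ k \<in> J" using zk[of k] by blast
    then have "z ^ k * x \<in> J" by (simp add: mult.commute)
    then show "x \<in> J \<inter> homogeneous_part n p" using kill[of k x p] x by auto
  qed (use sat_ideal_superset[OF Ji] in auto)
  then show ?thesis by (simp add: hilb_def)
qed

section \<open>The saturation \<open>I\<close> and the colon ideal \<open>W\<close>, linked through
  \<open>Q\<close>\<close>

context
  fixes n a d0 N :: nat and Q J W I B :: "'k::field mpoly set" and f0 z :: "'k mpoly"
  assumes Q: "homogeneous_ideal n Q" and f0: "f0 \<in> homogeneous_part n d0"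
    and z: "z \<in> homogeneous_part n 1" and zQ: "nonzerodivisor n z Q"
    and socle: "socle_le_1 n (adjoin n Q z)"
    and top: "\<And>p. a < p \<Longrightarrow> homogeneous_part n p \<subseteq> adjoin n Q z"
    and top_ne: "\<not> homogeneous_part n a \<subseteq> adjoin n Q z"
    and J_eq: "J = adjoin n Q f0" and W_eq: "W = colon n Q f0" and I_eq: "I = sat_ideal n J" and B_eq: "B = adjoin n Q z"
    and const: "\<And>p. N \<le> p \<Longrightarrow> hilb n J p = hilb n J N"
begin

lemma liaison_ideals:
  shows "homogeneous_ideal n J" "homogeneous_ideal n W" "homogeneous_ideal n I" "homogeneous_ideal n B" "Q \<subseteq> J" "Q \<subseteq> W" "J \<subseteq> I"
    "B \<subseteq> adjoin n W z" "B \<subseteq> adjoin n I z" "B \<subseteq> adjoin n J z"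
proof -
  show J: "homogeneous_ideal n J" unfolding J_eq by (rule homogeneous_ideal_adjoin[OF Q f0])
  show W: "homogeneous_ideal n W" unfolding W_eq by (rule homogeneous_ideal_colon[OF Q f0])
  show I: "homogeneous_ideal n I" unfolding I_eq by (rule homogeneous_ideal_sat_ideal[OF J])
  show B: "homogeneous_ideal n B" unfolding B_eq by (rule homogeneous_ideal_adjoin[OF Q z])
  show QJ: "Q \<subseteq> J" unfolding J_eq by (rule adjoin_superset)
  show QW: "Q \<subseteq> W" unfolding W_eq using homogeneous_ideal_is_ideal[OF Q] f0 by (intro colon_superset) auto
  show JI: "J \<subseteq> I" unfolding I_eq by (rule sat_ideal_superset[OF homogeneous_ideal_is_ideal[OF J]])
  show "B \<subseteq> adjoin n W z" "B \<subseteq> adjoin n I z" "B \<subseteq> adjoin n J z"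
    unfolding B_eq using QW QJ JI by (intro adjoin_mono; blast)+
qed

lemma liaison_top:
  "a < p \<Longrightarrow> homogeneous_part n p \<subseteq> adjoin n W z"
  "a < p \<Longrightarrow> homogeneous_part n p \<subseteq> adjoin n I z"
  "a < p \<Longrightarrow> homogeneous_part n p \<subseteq> adjoin n J z"
  using top liaison_ideals(8-10) unfolding B_eq by blast+

lemma liaison_nonzerodivisor: "nonzerodivisor n z W" "nonzerodivisor n z I"
proof -
  have fp: "f0 \<in> polys n" and zp: "z \<in> polys n" using f0 z by auto
  show "nonzerodivisor n z W"
    using zQ fp zp unfolding nonzerodivisor_def W_eq colon_def
    by (auto simp: mult.left_commute[of f0 z])
  show "nonzerodivisor n z I"
    unfolding I_eq by (rule nonzerodivisor_sat_ideal[OF liaison_ideals(1) z liaison_top(3)])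
qed

text \<open>From f0 W \<subseteq> Q one gets W J \<subseteq> Q. A member \<open>x\<close> of
  \<open>I\<close> reaches \<open>J\<close> after multiplication by a power of \<open>z\<close>, and
  \<open>z\<close> cancels modulo \<open>Q\<close>.\<close>

lemma liaison_annihilates:
  assumes w: "w \<in> W" and x: "x \<in> I"
  shows "w * x \<in> Q"
proof -
  note Qi = homogeneous_ideal_is_ideal[OF Q]
  have wp: "w \<in> polys n" and xp: "x \<in> polys n" and zp: "z \<in> polys n"
    using w x z by (auto simp: W_eq colon_def I_eq sat_ideal_def)
  have wJ: "w * y \<in> Q" if yJ: "y \<in> J" for y
  proof -
    obtain q r where qr: "y = q + f0 * r" "q \<in> Q" "r \<in> polys n" using yJ unfolding J_eq adjoin_def by blast
    have "w * q + r * (f0 * w) \<in> Q"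
    proof (rule idlD(3)[OF Qi])
      show "w * q \<in> Q" using qr(2) wp by (rule idlD(4)[OF Qi])
      have "f0 * w \<in> Q" using w by (simp add: W_eq colon_def)
      then show "r * (f0 * w) \<in> Q" using qr(3) by (rule idlD(4)[OF Qi])
    qed
    then show ?thesis by (simp add: qr(1) algebra_simps)
  qed
  obtain k where k: "\<forall>y\<in>homogeneous_part n k. x * y \<in> J" using x by (auto simp: I_eq sat_ideal_def)
  have "z ^ k \<in> homogeneous_part n k"
    by (induction k) (use homogeneous_1 homogeneous_mult[OF z] in auto)
  then have "w * (x * z ^ k) \<in> Q" using k wJ by blast
  then have "z ^ k * (w * x) \<in> Q" by (simp add: ac_simps)
  then show ?thesis
  proof (induction k)
    case (Suc k)
    have "z ^ k \<in> polys n" by (induction k) (use zp in auto)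
    then have "z ^ k * (w * x) \<in> polys n" using wp xp by simp
    with Suc.prems zQ have "z ^ k * (w * x) \<in> Q" by (simp add: nonzerodivisor_def mult.assoc)
    then show ?case by (rule Suc.IH)
  qed simp
qed

lemma liaison_le:
  assumes pq: "p + q = a"
  shows "hilb n B p \<le> hilb n (adjoin n W z) p + hilb n (adjoin n I z) q"
proof -
  let ?H = "homogeneous_part n :: nat \<Rightarrow> 'k mpoly set"
  let ?U = "adjoin n W z \<inter> ?H p" and ?V = "adjoin n I z \<inter> ?H q"
  have zp: "z \<in> polys n" using z by simp
  note Bh = liaison_ideals(4)
  obtain s where s: "s \<in> ?H a" "s \<notin> B" using top_ne by (auto simp: B_eq)
  have "mp.dim ?U + mp.dim ?V \<le> mp.dim (B \<inter> ?H p) + mp.dim (?H q)"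
  proof (rule dim_annihilating_pair[OF homogeneous_ideal_is_ideal[OF Bh]])
    show "mp.subspace ?U" "mp.subspace ?V"
      using liaison_ideals(2,3) zp by (intro is_ideal_part_subspace is_ideal_adjoin homogeneous_ideal_is_ideal; simp)+
    fix u v assume "u \<in> ?U" "v \<in> ?V"
    then obtain w r x s where *: "u = w + z * r" "w \<in> W" "r \<in> polys n" "v = x + z * s" "x \<in> I" "s \<in> polys n"
      by (auto simp: adjoin_def)
    have "w \<in> polys n" "x \<in> polys n"
      using *(2,5) homogeneous_ideal_is_ideal liaison_ideals(2,3) by (blast dest: idlD)+
    \<comment> \<open>Modulo \<open>z\<close> the product of w + z r and x + z s is w x, which lies
      in \<open>Q\<close>.\<close>
    then have "w * x + z * (r * x + w * s + z * r * s) \<in> B"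
      unfolding B_eq using * zp by (intro adjI liaison_annihilates) auto
    then show "u * v \<in> B" by (simp add: *(1,4) algebra_simps)
  next
    fix u assume "u \<in> ?H p" "\<And>w. w \<in> ?H q \<Longrightarrow> u * w \<in> B"
    then show "u \<in> B"
      using nondegenerate_top[OF Bh socle[folded B_eq] top[folded B_eq] s _ pq] by blast
  next
    show "hilb n B (p + q) \<le> 1"
      using hilb_top_le_1[OF Bh socle[folded B_eq] top[folded B_eq]] pq by simp
  qed auto
  then show ?thesis
    using dim_homogeneous_eq[of n p B] dim_homogeneous_eq[of n p "adjoin n W z"]
      dim_homogeneous_eq[of n q "adjoin n I z"] by linarith
qed

theorem liaison_eq:
  assumes p: "p \<le> a"
  shows "hilb n B p = hilb n (adjoin n W z) p + hilb n (adjoin n I z) (a - p)"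
proof -
  \<comment> \<open>\<open>M\<close> is at least \<open>N\<close> and \<open>a\<close>, so that all
    Hilbert functions have their stable values there; degree M + d0 of \<open>Q\<close> and
    \<open>J\<close> corresponds to degree \<open>M\<close> of \<open>W\<close>.\<close>
  define M where "M = N + a"
  have "(\<Sum>p\<le>a. hilb n B p) = hilb n Q a"
    unfolding B_eq by (rule hilb_partial_sum[OF Q z zQ])
  also have "\<dots> = hilb n Q (M + d0)"
    by (rule hilb_stable[OF Q z zQ top, symmetric]) (auto simp: M_def)
  also have "\<dots> = hilb n J (M + d0) + hilb n W M"
    using hilb_adjoin[OF Q f0, of "M + d0"] by (simp add: J_eq W_eq)
  also have "hilb n J (M + d0) = hilb n I (M + d0)"
    unfolding I_eq
    by (rule hilb_sat_ideal_eventually[OF liaison_ideals(1) z liaison_top(3) const, symmetric]) (auto simp: M_def)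
  also have "\<dots> = hilb n I a"
    by (rule hilb_stable[OF liaison_ideals(3) z liaison_nonzerodivisor(2) liaison_top(2)]) (auto simp: M_def)
  also have "hilb n W M = hilb n W a"
    by (rule hilb_stable[OF liaison_ideals(2) z liaison_nonzerodivisor(1) liaison_top(1)]) (auto simp: M_def)
  also have "hilb n I a = (\<Sum>p\<le>a. hilb n (adjoin n I z) p)"
    by (rule hilb_partial_sum[OF liaison_ideals(3) z liaison_nonzerodivisor(2), symmetric])
  also have "\<dots> = (\<Sum>p\<le>a. hilb n (adjoin n I z) (a - p))"
    by (rule sum.reindex_bij_witness[of _ "\<lambda>p. a - p" "\<lambda>p. a - p"]) auto
  also have "hilb n W a = (\<Sum>p\<le>a. hilb n (adjoin n W z) p)"
    by (rule hilb_partial_sum[OF liaison_ideals(2) z liaison_nonzerodivisor(1), symmetric])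
  finally have "(\<Sum>p\<le>a. hilb n B p) = (\<Sum>p\<le>a. hilb n (adjoin n W z) p + hilb n (adjoin n I z) (a - p))"
    by (simp add: sum.distrib add.commute)
  then show ?thesis
    by (rule sum_mono_inv) (use p liaison_le in auto)
qed

text \<open>Multiplying H_J = H_Q - t^d0 H_W by 1 - t replaces \<open>Q\<close> and \<open>W\<close>
  by their sections with \<open>z\<close>; \<open>liaison_eq\<close> then expresses the section of
  \<open>W\<close> by that of \<open>Q\<close> and the reversed section of \<open>I\<close>.\<close>

theorem liaison_series:
  "hilb_series n J * (1 - fps_X) = hilb_series n B * (1 - fps_X ^ d0) +
     fps_X ^ d0 * Abs_fps (\<lambda>p. if p \<le> a then int (hilb n (adjoin n I z) (a - p)) else 0)"
proof -
  have B: "hilb_series n B = hilb_series n Q * (1 - fps_X)"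
    unfolding B_eq using hilb_series_adjoin[OF Q z zQ] by simp
  have W: "hilb_series n W * (1 - fps_X) = hilb_series n (adjoin n W z)"
    using hilb_series_adjoin[OF liaison_ideals(2) z liaison_nonzerodivisor(1)] by simp
  have J: "hilb_series n J = hilb_series n Q - fps_X ^ d0 * hilb_series n W"
  proof (rule fps_ext)
    fix p
    show "fps_nth (hilb_series n J) p = fps_nth (hilb_series n Q - fps_X ^ d0 * hilb_series n W) p"
      using hilb_adjoin[OF Q f0, of p] by (auto simp: fps_X_power_mult_nth J_eq W_eq split: if_splits)
  qed
  have "hilb_series n (adjoin n W z) = hilb_series n B - Abs_fps (\<lambda>p. if p \<le> a then int (hilb n (adjoin n I z) (a - p)) else 0)"
  proof (rule fps_ext)
    fix p
    show "fps_nth (hilb_series n (adjoin n W z)) p =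
       fps_nth (hilb_series n B - Abs_fps (\<lambda>p. if p \<le> a then int (hilb n (adjoin n I z) (a - p)) else 0)) p"
    proof (cases "p \<le> a")
      case True
      then show ?thesis using liaison_eq by simp
    next
      case False
      then have "homogeneous_part n p \<subseteq> B" "homogeneous_part n p \<subseteq> adjoin n W z"
        using top liaison_top(1) by (auto simp: B_eq)
      then have "hilb n B p = 0" "hilb n (adjoin n W z) p = 0"
        using hilb_eq_0_iff[OF homogeneous_ideal_is_ideal[OF liaison_ideals(4)], of p]
          hilb_eq_0_iff[OF is_ideal_adjoin[OF homogeneous_ideal_is_ideal[OF liaison_ideals(2)]], of z p] z by auto
      then show ?thesis using False by simp
    qed
  qed
  note V = this
  have "hilb_series n J * (1 - fps_X) = hilb_series n Q * (1 - fps_X) - fps_X ^ d0 * (hilb_series n W * (1 - fps_X))"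
    by (simp add: J algebra_simps)
  also have "\<dots> = hilb_series n B - fps_X ^ d0 * (hilb_series n B -
      Abs_fps (\<lambda>p. if p \<le> a then int (hilb n (adjoin n I z) (a - p)) else 0))"
    using B W V by simp
  finally show ?thesis by (simp add: algebra_simps)
qed

lemma liaison_series_I: "hilb_series n I * (1 - fps_X) = hilb_series n (adjoin n I z)"
  using hilb_series_adjoin[OF liaison_ideals(3) z liaison_nonzerodivisor(2)] by simp

end

section \<open>Comparison with the definitions by quotient rings\<close>

text \<open>Follows the inductive definition of \<open>dimension\<close> along a basis: each new
  basis vector is one line extension.\<close>

lemma dimension_span:
  fixes B :: "'k::field mpoly set"
  assumes "finite B" "mp.independent B" "B \<subseteq> polys n"
  shows "ring.dimension (mpoly_ring n) (card B) (range mpoly_const) (mp.span B)"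
  using assms
proof (induction B rule: finite_induct)
  case empty
  then show ?case using mpoly.zero_dim[of n "range mpoly_const"] by simp
next
  case (insert b B)
  have ind: "mp.independent B" "b \<notin> mp.span B"
    using insert.prems(1) insert.hyps(2) by (auto simp: mp.independent_insert)
  have "mpoly.dimension n (Suc (card B)) (range mpoly_const)
      (mpoly.line_extension n (range mpoly_const) b (mp.span B))"
    using insert ind by (intro mpoly.Suc_dim) auto
  moreover have "mpoly.line_extension n (range mpoly_const) b (mp.span B) = mp.span (insert b B)"
  proof -
    have "mp.span (insert b B) = {x. \<exists>c. x - mpoly_scale c b \<in> mp.span B}" by (rule mp.span_insert)
    also have "\<dots> = {mpoly_const c * b + s |c s. s \<in> mp.span B}"
    proof (intro equalityI subsetI)
      fix x assume "x \<in> {x. \<exists>c. x - mpoly_scale c b \<in> mp.span B}"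
      then obtain c where "x - mpoly_const c * b \<in> mp.span B" by (auto simp: mpoly_scale_def)
      moreover have "x = mpoly_const c * b + (x - mpoly_const c * b)" by simp
      ultimately show "x \<in> {mpoly_const c * b + s |c s. s \<in> mp.span B}" by blast
    next
      fix x assume "x \<in> {mpoly_const c * b + s |c s. s \<in> mp.span B}"
      then obtain c s where "x = mpoly_scale c b + s" "s \<in> mp.span B" by (auto simp: mpoly_scale_def)
      then have "x - mpoly_scale c b \<in> mp.span B" by simp
      then show "x \<in> {x. \<exists>c. x - mpoly_scale c b \<in> mp.span B}" by blast
    qed
    also have "\<dots> = mpoly.line_extension n (range mpoly_const) b (mp.span B)"
      by (auto simp: mpoly.line_extension_def set_add_def' r_coset_def)
    finally show ?thesis ..
  qed
  ultimately show ?case using insert.hyps by simp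
qed

lemma dimension_subspace:
  fixes V :: "'k::field mpoly set"
  assumes V: "mp.subspace V" "findim V" "V \<subseteq> polys n"
  shows "ring.dimension (mpoly_ring n) (mp.dim V) (range mpoly_const) V"
proof -
  obtain B where B: "B \<subseteq> V" "mp.independent B" "V \<subseteq> mp.span B" "card B = mp.dim V"
    using mp.basis_exists by blast
  have "mp.span B = V" using B V(1) by (intro mp.span_subspace)
  moreover have "finite B" using findim_independent_finite[OF V(2)] B by blast
  ultimately show ?thesis using dimension_span[of B n] B V(3) by auto
qed

lemma subfield_consts: "subfield (range mpoly_const) (mpoly_ring n :: 'k::field mpoly ring)"
proof (rule mpoly.subfieldI)
  show "subcring (range mpoly_const) (mpoly_ring n :: 'k mpoly ring)"
  proof (rule mpoly.subcringI')
    show "subring (range mpoly_const) (mpoly_ring n :: 'k mpoly ring)"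
    proof (rule mpoly.subringI)
      show "range mpoly_const \<subseteq> carrier (mpoly_ring n :: 'k mpoly ring)" by auto
      show "\<one>\<^bsub>mpoly_ring n\<^esub> \<in> (range mpoly_const :: 'k mpoly set)"
        using mpoly_const_1 by (metis mpoly_ring_simps(4) rangeI)
    next
      fix h :: "'k mpoly" assume "h \<in> range mpoly_const"
      then obtain c where "h = mpoly_const c" by auto
      moreover have "- mpoly_const c = mpoly_const (- c)" by (simp add: mpoly_const_def single_uminus)
      ultimately have "\<ominus>\<^bsub>mpoly_ring n\<^esub> h = mpoly_const (- c)" by simp
      then show "\<ominus>\<^bsub>mpoly_ring n\<^esub> h \<in> range mpoly_const" by simp
    qed (auto simp flip: mpoly_const_add mpoly_const_mult)
  qed
  have inv: "mpoly_const c \<in> Units (mpoly_ring n \<lparr>carrier := range mpoly_const\<rparr>)" if "c \<noteq> 0" for c :: 'k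
  proof -
    have "mpoly_const (1 / c) * mpoly_const c = 1" "mpoly_const c * mpoly_const (1 / c) = 1"
      using that by (simp_all flip: mpoly_const_mult)
    then show ?thesis unfolding Units_def by auto
  qed
  have c0: "mpoly_const c = 0 \<longleftrightarrow> c = 0" for c :: 'k
  proof
    assume "mpoly_const c = 0"
    then have "lookup (mpoly_const c) 0 = 0" by simp
    then show "c = 0" by (simp add: mpoly_const_def)
  qed simp
  show "Units (mpoly_ring n \<lparr>carrier := range mpoly_const\<rparr>) = range mpoly_const - {\<zero>\<^bsub>mpoly_ring n\<^esub> :: 'k mpoly}"
  proof (intro equalityI subsetI)
    fix x :: "'k mpoly" assume "x \<in> range mpoly_const - {\<zero>\<^bsub>mpoly_ring n\<^esub>}"
    then obtain c where "x = mpoly_const c" "x \<noteq> 0" by auto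
    then show "x \<in> Units (mpoly_ring n \<lparr>carrier := range mpoly_const\<rparr>)" using inv c0 by simp
  qed (auto simp: Units_def)
qed

lemma quotient_coset_eq_zero_iff:
  assumes J: "is_ideal n J" and x: "x \<in> polys n"
  shows "J +>\<^bsub>mpoly_ring n\<^esub> x = J \<longleftrightarrow> x \<in> J"
proof -
  have Ji: "ideal J (mpoly_ring n)" using J by (simp add: ideal_iff_is_ideal)
  have J0: "J +>\<^bsub>mpoly_ring n\<^esub> 0 = J"
    using mpoly.a_rcos_zero[OF Ji, of 0] idlD(2)[OF J] by simp
  show ?thesis
    using mpoly.quotient_eq_iff_same_a_r_cos[OF Ji, of x 0] x J0 by auto
qed

lemma zero_Quot [simp]: "\<zero>\<^bsub>R Quot J\<^esub> = J"
  by (simp add: FactRing_def)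

lemma carrier_update: "carrier (R\<lparr>carrier := E\<rparr>) = E"
  by simp

text \<open>Rank-nullity for S_p -> (S/J)_p with kernel J_p. It requires 1 \<noteq> 0 in the
  quotient, so the unit ideal is treated apart.\<close>

lemma hilbert_function_eq_hilb:
  fixes J :: "'k::field mpoly set"
  assumes J: "is_ideal n J"
  shows "hilbert_function n J p = hilb n J p"
proof -
  let ?S = "mpoly_ring n :: 'k mpoly ring"
  let ?R = "?S Quot J"
  let ?\<pi> = "(+>\<^bsub>?S\<^esub>) J"
  let ?H = "homogeneous_part n p :: 'k mpoly set"
  have Ji: "ideal J ?S" using J by (simp add: ideal_iff_is_ideal)
  interpret h: ring_hom_ring ?S ?R ?\<pi> using Ji by (rule ideal.rcos_ring_hom_ring)
  have K: "(\<lambda>c. ?\<pi> (mpoly_const c)) ` UNIV = ?\<pi> ` range mpoly_const" by auto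
  have HF: "hilbert_function n J p = h.S.dim (?\<pi> ` range mpoly_const) (?\<pi> ` ?H)"
    by (simp add: hilbert_function_def K)
  show ?thesis
  proof (cases "1 \<in> J")
    case False
    have ne: "\<one>\<^bsub>?R\<^esub> \<noteq> \<zero>\<^bsub>?R\<^esub>"
      using quotient_coset_eq_zero_iff[OF J, of 1] False by (simp add: FactRing_def)
    have "?\<pi> x = J \<longleftrightarrow> x \<in> J" if "x \<in> ?H" for x
      using quotient_coset_eq_zero_iff[OF J homogeneous_polys[OF that]] .
    moreover have "a_kernel (?S \<lparr>carrier := ?H\<rparr>) ?R ?\<pi> = {x \<in> ?H. ?\<pi> x = J}"
      by (simp only: a_kernel_def' carrier_update zero_Quot)
    ultimately have "a_kernel (?S \<lparr>carrier := ?H\<rparr>) ?R ?\<pi> = J \<inter> ?H" by blast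
    moreover have "mpoly.dimension n (mp.dim (J \<inter> ?H)) (range mpoly_const) (J \<inter> ?H)"
      by (rule dimension_subspace)
        (auto intro: is_ideal_part_subspace J findim_subset[OF homogeneous_findim[of n p]])
    moreover have "mpoly.dimension n (mp.dim ?H) (range mpoly_const) ?H"
      by (rule dimension_subspace) (auto intro: homogeneous_subspace homogeneous_findim)
    ultimately have "h.S.dimension (hilb n J p) (?\<pi> ` range mpoly_const) (?\<pi> ` ?H)"
      unfolding hilb_def using h.rank_nullity_theorem[OF subfield_consts ne] by simp
    then show ?thesis
      using h.S.dimI[OF h.img_is_subfield(2)[OF subfield_consts ne]] by (simp add: HF over_def)
  next
    case True
    then have JP: "J = polys n" using idlD(4)[OF J True] idlD(1)[OF J] by auto
    then have \<pi>: "?\<pi> x = J" if "x \<in> polys n" for x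
      using quotient_coset_eq_zero_iff[OF J that] that by simp
    have eqs: "?\<pi> ` range mpoly_const = {\<zero>\<^bsub>?R\<^esub>}" "?\<pi> ` ?H = {\<zero>\<^bsub>?R\<^esub>}" "carrier ?R = {\<zero>\<^bsub>?R\<^esub>}"
    proof -
      have const: "?\<pi> ` A = {\<zero>\<^bsub>?R\<^esub>}" if "A \<subseteq> polys n" "x \<in> A" for A x
      proof -
        have "?\<pi> ` A = (\<lambda>_. J) ` A" using \<pi> that(1) by (intro image_cong) auto
        then show ?thesis using that(2) by auto
      qed
      show "?\<pi> ` range mpoly_const = {\<zero>\<^bsub>?R\<^esub>}" by (rule const[of _ "mpoly_const 0"]) (rule image_subsetI, simp, rule rangeI)
      show "?\<pi> ` ?H = {\<zero>\<^bsub>?R\<^esub>}" by (rule const[OF _ homogeneous_0]) auto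
      have "carrier ?R = ?\<pi> ` polys n" by (auto simp: FactRing_def A_RCOSETS_def')
      also have "\<dots> = {\<zero>\<^bsub>?R\<^esub>}" by (rule const[OF order_refl polys_0])
      finally show "carrier ?R = {\<zero>\<^bsub>?R\<^esub>}" .
    qed
    \<comment> \<open>In the zero ring no vector lies outside \<open>{\<zero>}\<close>, so only the
      empty basis derives a dimension; the definite description in \<open>dim\<close> then yields
      0.\<close>
    have "m = 0 \<and> E = {\<zero>\<^bsub>?R\<^esub>}" if "h.S.dimension m {\<zero>\<^bsub>?R\<^esub>} E" for m E
      using that
    proof (induction m "{\<zero>\<^bsub>?R\<^esub>}" E rule: h.S.dimension.induct)
      case (Suc_dim v E m)
      then show ?case using eqs(3) by auto
    qed simp
    then have "h.S.dim {\<zero>\<^bsub>?R\<^esub>} {\<zero>\<^bsub>?R\<^esub>} = 0"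
      unfolding h.S.dim_def by (intro the_equality h.S.dimension.zero_dim) blast
    moreover have "hilb n J p = 0" using hilb_eq_0_iff[OF J] JP by auto
    ultimately show ?thesis by (simp only: HF eqs)
  qed
qed

lemma irrelevant_ideal_eq: "irrelevant_ideal n = max_ideal n"
  using genideal_vars[of "Suc n" n] by (simp add: irrelevant_ideal_def var_ideal_all lessThan_Suc_atMost)

text \<open>The k-th power of the irrelevant ideal contains all forms of degree at least k, and its
  members have no monomial of lower degree. Annihilation by the power and by those forms is
  therefore the same condition.\<close>

lemma saturation_eq_sat_ideal:
  fixes J :: "'k::field mpoly set"
  assumes J: "is_ideal n J"
  shows "saturation (mpoly_ring n) J (irrelevant_ideal n) = sat_ideal n J"
proof -
  define P where "P k = ideal_power (mpoly_ring n) (max_ideal n :: 'k mpoly set) k" for k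
  have P0: "P 0 = polys n" and PS: "P (Suc k) = ideal_prod (mpoly_ring n) (max_ideal n) (P k)" for k
    by (simp_all add: P_def)
  have deg: "x \<in> P k \<Longrightarrow> x \<in> polys n \<and> (\<forall>m\<in>keys x. k \<le> total_deg m)" for x k
  proof (induction k arbitrary: x)
    case (Suc k)
    from Suc.prems[unfolded PS] show ?case
    proof (induction rule: ideal_prod.induct)
      case (prod i j)
      have i: "1 \<le> total_deg m" if "m \<in> keys i" for m
        using that prod(1) total_deg_eq_0_iff[of m] by (cases "m = 0") (auto simp: max_ideal_def in_keys_iff)
      have "Suc k \<le> total_deg m" if "m \<in> keys (i * j)" for m
      proof -
        obtain a b where "a \<in> keys i" "b \<in> keys j" "m = a + b" using \<open>m \<in> keys (i * j)\<close> keys_mult[of i j] by auto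
        then show ?thesis using i[of a] Suc.IH[OF prod(2)] by (auto simp: total_deg_add)
      qed
      then show ?case using Suc.IH[OF prod(2)] prod(1) by (simp add: max_ideal_polys)
    next
      case (sum s1 s2)
      then show ?case using Poly_Mapping.keys_add[of s1 s2] by auto
    qed
  qed (simp add: P0)
  have mem: "k \<le> q \<Longrightarrow> x \<in> homogeneous_part n q \<Longrightarrow> x \<in> P k" for k q x
  proof (induction k arbitrary: q x)
    case (Suc k)
    have zero: "0 \<in> max_ideal n" "0 \<in> P k" using Suc.IH[of "Suc k" 0] by (auto simp: max_ideal_def)
    from Suc.prems have "x \<in> homogeneous_part n (Suc (q - 1))" by simp
    then show ?case
    proof (induction rule: homogeneous_Suc_induct)
      case zero
      show ?case using ideal_prod.prod[OF \<open>0 \<in> max_ideal n\<close> \<open>0 \<in> P k\<close>, of "mpoly_ring n"] by (simp add: PS)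
    next
      case (add u v)
      then show ?case using ideal_prod.sum[of u "mpoly_ring n" "max_ideal n" "P k" v] by (simp add: PS)
    next
      case (mult i y)
      then have "y \<in> P k" using Suc.IH[of "q - 1" y] Suc.prems(1) by simp
      then show ?case using ideal_prod.prod[OF var_in_max_ideal[OF mult(1)], of y "P k" "mpoly_ring n"] by (simp add: PS)
    qed
  qed (auto simp: P0)
  have "(\<forall>b\<in>P k. x * b \<in> J) \<longleftrightarrow> (\<forall>q\<ge>k. \<forall>y\<in>homogeneous_part n q. x * y \<in> J)" for x k
  proof (intro iffI ballI allI impI)
    fix b assume b: "b \<in> P k" and H: "\<forall>q\<ge>k. \<forall>y\<in>homogeneous_part n q. x * y \<in> J"
    have "x * hcomp q b \<in> J" if "q \<in> total_deg ` keys b" for q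
      using H deg[OF b] that hcomp_homogeneous[of b n q] by blast
    then have "(\<Sum>q\<in>total_deg ` keys b. x * hcomp q b) \<in> J" by (rule is_ideal_sum[OF J])
    then show "x * b \<in> J" by (simp add: sum_hcomp' flip: sum_distrib_left)
  qed (use mem in blast)
  then show ?thesis
    by (auto simp: saturation_def colon_ideal_def sat_ideal_def irrelevant_ideal_eq P_def)
qed

lemma regular_sequence_regular_list:
  assumes nonzerodivisor: "regular_sequence (mpoly_ring n) xs"
    and deg: "\<And>x. x \<in> set xs \<Longrightarrow> \<exists>e\<ge>1. x \<in> homogeneous_part n e"
  shows "regular_list n (rev xs)"
proof -
  have "regular_list n (rev (take i xs))" if "i \<le> length xs" for i
    using that
  proof (induction i)
    case (Suc i)
    then have eq: "rev (take (Suc i) xs) = xs ! i # rev (take i xs)" by (simp add: take_Suc_conv_app_nth)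
    have "nonzerodivisor n (xs ! i) (list_ideal n (rev (take i xs)))"
      using nonzerodivisor Suc.prems by (auto simp: regular_sequence_def nonzerodivisor_def)
    then show ?case unfolding eq using Suc deg[of "xs ! i"] by auto
  qed simp
  from this[of "length xs"] show ?thesis by simp
qed

text \<open>A constant in the sequence is a unit or zero. A unit generates everything; if zero is
  regular modulo the earlier elements, these already generate everything.\<close>

lemma regular_sequence_degree_pos:
  assumes nonzerodivisor: "regular_sequence (mpoly_ring n) xs" and x: "x \<in> set xs" "x \<in> homogeneous_part n d"
  shows "1 \<le> d"
proof (rule ccontr)
  assume "\<not> 1 \<le> d"
  then have "d = 0" by simp
  then obtain c where c: "x = mpoly_const c" using x(2) homogeneous_0_iff by blast
  have sub: "set xs \<subseteq> polys n" using nonzerodivisor by (simp add: regular_sequence_def)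
  note G = is_ideal_genideal[OF sub]
  have "set xs \<subseteq> genideal (mpoly_ring n) (set xs)" using sub by (intro mpoly.genideal_self) simp
  have "1 \<in> genideal (mpoly_ring n) (set xs)"
  proof (cases "c = 0")
    case True
    obtain i where i: "i < length xs" "x = xs ! i" using x(1) by (auto simp: in_set_conv_nth)
    have sub': "set (take i xs) \<subseteq> set xs" by (rule set_take_subset)
    have "x * 1 \<in> genideal (mpoly_ring n) (set (take i xs))"
      using True c idlD(2)[OF is_ideal_genideal[OF order_trans[OF sub' sub]]] by simp
    then have "1 \<in> genideal (mpoly_ring n) (set (take i xs))"
      using nonzerodivisor i by (auto simp: regular_sequence_def)
    moreover have "genideal (mpoly_ring n) (set (take i xs)) \<subseteq> genideal (mpoly_ring n) (set xs)"
      using sub sub' by (intro mpoly.subset_Idl_subset) auto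
    ultimately show ?thesis by blast
  next
    case False
    have "mpoly_const c * 1 \<in> genideal (mpoly_ring n) (set xs)"
      using c x(1) \<open>set xs \<subseteq> genideal (mpoly_ring n) (set xs)\<close> by auto
    then show ?thesis using const_mult_mem_iff[OF G, of 1 c] False by simp
  qed
  then have "r \<in> genideal (mpoly_ring n) (set xs)" if "r \<in> polys n" for r
    using idlD(4)[OF G, of 1 r] that by simp
  then have "genideal (mpoly_ring n) (set xs) = polys n" using idlD(1)[OF G] by blast
  then show False using nonzerodivisor by (simp add: regular_sequence_def)
qed

section \<open>The Hilbert series of the saturation\<close>

text \<open>Differences of consecutive values are the coefficients of \<open>P\<close>. In this form
  the existence of \<open>G\<close> enters the liaison argument.\<close>

lemma hilb_eventually_const:
  fixes A :: "'k::field mpoly set"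
  assumes "hilb_series n A * (1 - fps_X) = fps_of_poly P" and p: "Polynomial.degree P \<le> p"
  shows "hilb n A p = hilb n A (Polynomial.degree P)"
  using p
proof (induction p rule: dec_induct)
  case (step p)
  have "fps_nth (hilb_series n A * (1 - fps_X)) (Suc p) = int (hilb n A (Suc p)) - int (hilb n A p)"
    by (simp add: right_diff_distrib)
  then show ?case using step assms(1) by (simp add: coeff_eq_0)
qed simp

context
  fixes n :: nat and f :: "nat \<Rightarrow> ('k::field_char_0) mpoly" and d :: "nat \<Rightarrow> nat"
    and J I :: "'k mpoly set" and G F :: "int poly"
  assumes homogeneous: "\<And>i. i \<le> n \<Longrightarrow> f i \<in> homogeneous_part n (d i)"
    and J_def: "J = genideal (mpoly_ring n) (f ` {0..n})"
    and regular: "regular_sequence (mpoly_ring n) (map f [1..<n + 1])"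
    and I_def: "I = saturation (mpoly_ring n) J (irrelevant_ideal n)"
    and G: "hilbert_series n J * (1 - fps_X) = fps_of_poly G"
    and F: "hilbert_series n I * (1 - fps_X) = fps_of_poly F"
begin

lemma degree_pos:
  assumes j: "j \<in> {1..n}" shows "1 \<le> d j"
proof (rule regular_sequence_degree_pos[OF regular])
  have "j \<in> set [1..<n + 1]" using j by auto
  then show "f j \<in> set (map f [1..<n + 1])" by (simp only: set_map imageI)
  show "f j \<in> homogeneous_part n (d j)" using homogeneous j by simp
qed

text \<open>The third claim realizes the coefficients of \<open>F\<close> as the Hilbert function of
  S/(I + zS); the symmetry of \<open>F\<close> is proved on that quotient.\<close>

theorem hilbert_series_saturation:
  defines "a \<equiv> \<Sum>j\<in>{1..n}. d j - 1"
  shows "fps_of_poly G = fps_of_poly (\<Prod>j\<in>{1..n}. geom_poly (d j)) * (1 - fps_X ^ d 0) +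
      fps_X ^ d 0 * Abs_fps (\<lambda>p. if p \<le> a then Polynomial.coeff F (a - p) else 0)"
    and "Polynomial.degree F \<le> a"
    and "\<exists>z \<in> homogeneous_part n 1. nonzerodivisor n z I \<and> homogeneous_ideal n I \<and>
      (\<forall>p. int (hilb n (adjoin n I z) p) = Polynomial.coeff F p)"
proof -
  define fs where "fs = rev (map f [1..<n + 1])"
  define Q where "Q = list_ideal n fs"
  define P where "P = (\<Prod>j\<in>{1..n}. geom_poly (d j))"
  have fs: "regular_list n fs"
    unfolding fs_def
  proof (rule regular_sequence_regular_list[OF regular])
    fix x assume "x \<in> set (map f [1..<n + 1])"
    moreover have "set [1..<n + 1] = {1..n}" by auto
    ultimately have "x \<in> f ` {1..n}" by (simp only: set_map)
    then obtain j where "j \<in> {1..n}" "x = f j" by blast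
    then show "\<exists>e\<ge>1. x \<in> homogeneous_part n e"
      using degree_pos[of j] homogeneous[of j] by auto
  qed
  have len: "length fs = n" by (simp add: fs_def)
  have Q: "homogeneous_ideal n Q" unfolding Q_def by (rule regular_list_homogeneous_ideal[OF fs])
  have f0: "f 0 \<in> homogeneous_part n (d 0)" using homogeneous by simp
  \<comment> \<open>A sequence of length \<open>n\<close> in n + 1 variables still has vanishing
    socle, so only finitely many of the linear forms are zero divisors modulo
    \<open>Q\<close>.\<close>
  have "socle_zero n Q" using socle_regular_sequence[OF fs] len by (simp add: Q_def)
  then have "finite {t. \<not> nonzerodivisor n (linear_form n t) Q}"
    using finite_nonregular_lforms[OF Q] by (simp add: socle_zero_def)
  then obtain t where t: "nonzerodivisor n (linear_form n t) Q"
    using ex_new_if_finite[OF infinite_UNIV_char_0[where 'a='k]] by blast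
  define z where "z = linear_form n t"
  have z: "z \<in> homogeneous_part n 1" "nonzerodivisor n z Q" using t linear_form_homogeneous by (auto simp: z_def)
  have zfs: "regular_list n (z # fs)" using z fs by (auto simp: Q_def)
  have B_eq: "list_ideal n (z # fs) = adjoin n Q z" unfolding Q_def using fs z(1) by (intro list_ideal_Cons) auto
  have socle: "socle_le_1 n (adjoin n Q z)"
    using socle_regular_sequence[OF zfs] len by (simp only: B_eq) (simp add: len)
  have la: "list_all2 (\<lambda>x e. x \<in> homogeneous_part n e) (z # fs) (1 # rev (map d [1..<n + 1]))"
    using z(1) homogeneous
    by (simp add: fs_def list_all2_map1 list_all2_map2 list_all2_same del: upt.simps)
  have "hilb_series n (adjoin n Q z) = hilb_series n {0 :: 'k mpoly} * (\<Prod>e\<leftarrow>1 # rev (map d [1..<n + 1]). 1 - fps_X ^ e)"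
    using hilb_series_list_ideal[OF zfs la] by (simp only: B_eq)
  also have "(\<Prod>e\<leftarrow>1 # rev (map d [1..<n + 1]). 1 - fps_X ^ e :: int fps) =
      (1 - fps_X) * (\<Prod>j\<leftarrow>rev [1..<n + 1]. 1 - fps_X ^ d j)"
    by (simp add: rev_map o_def)
  also have "(\<Prod>j\<leftarrow>rev [1..<n + 1]. 1 - fps_X ^ d j :: int fps) = (\<Prod>j\<in>set (rev [1..<n + 1]). 1 - fps_X ^ d j)"
    by (rule prod.distinct_set_conv_list[symmetric]) simp
  also have "set (rev [1..<n + 1]) = {1..n}" by auto
  also have "(\<Prod>j\<in>{1..n}. 1 - fps_X ^ d j :: int fps) = (1 - fps_X) ^ n * fps_of_poly P"
    by (simp add: one_minus_X_power prod.distrib P_def fps_of_poly_prod)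
  \<comment> \<open>The factors 1 - t, one from \<open>z\<close> and one from each f_j, cancel the
    denominator of the Hilbert series of S.\<close>
  finally have "hilb_series n (adjoin n Q z) = (hilb_series n {0 :: 'k mpoly} * (1 - fps_X) ^ Suc n) * fps_of_poly P"
    by (simp add: ac_simps)
  then have HB: "hilb_series n (adjoin n Q z) = fps_of_poly P" by (simp only: hilb_series_zero mult_1)
  have hB: "int (hilb n (adjoin n Q z) p) = Polynomial.coeff P p" for p
    using arg_cong[OF HB, of "\<lambda>s. fps_nth s p"] by simp
  have degP: "Polynomial.degree P = a" "Polynomial.lead_coeff P = 1"
    using degree_lead_prod_geom_poly[of "{1..n}" d] degree_pos by (auto simp: P_def a_def)
  have Bi: "is_ideal n (adjoin n Q z)" using homogeneous_ideal_is_ideal[OF homogeneous_ideal_adjoin[OF Q z(1)]] .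
  have top: "homogeneous_part n p \<subseteq> adjoin n Q z" if "a < p" for p
    using hB[of p] coeff_eq_0[of P p] degP that hilb_eq_0_iff[OF Bi, of p] by simp
  have top_ne: "\<not> homogeneous_part n a \<subseteq> adjoin n Q z"
    using hB[of a] degP hilb_eq_0_iff[OF Bi, of a] by auto
  have J_eq: "J = adjoin n Q (f 0)"
  proof -
    have "f ` {0..n} = insert (f 0) (set fs)"
    proof -
      have "{0..n} = insert 0 (set [1..<n + 1])" by auto
      then show ?thesis by (simp only: fs_def set_rev set_map image_insert)
    qed
    then show ?thesis
      unfolding J_def Q_def using genideal_insert[OF regular_list_polys[OF fs], of "f 0"] f0 by simp
  qed
  have Jh: "homogeneous_ideal n J" unfolding J_eq by (rule homogeneous_ideal_adjoin[OF Q f0])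
  have I_eq: "I = sat_ideal n J" unfolding I_def by (rule saturation_eq_sat_ideal[OF homogeneous_ideal_is_ideal[OF Jh]])
  have Ih: "homogeneous_ideal n I" unfolding I_eq by (rule homogeneous_ideal_sat_ideal[OF Jh])
  have HJ: "hilbert_series n J = hilb_series n J" and HI: "hilbert_series n I = hilb_series n I"
    by (simp_all add: hilbert_series_def hilb_series_def hilbert_function_eq_hilb homogeneous_ideal_is_ideal Jh Ih)
  have const: "hilb n J p = hilb n J (Polynomial.degree G)" if "Polynomial.degree G \<le> p" for p
    using G that unfolding HJ by (rule hilb_eventually_const)
  note L = Q f0 z socle top top_ne J_eq refl I_eq refl const
  have regI: "nonzerodivisor n z I" using liaison_nonzerodivisor(2)[OF L] .
  have "hilb_series n I * (1 - fps_X) = hilb_series n (adjoin n I z)" using liaison_series_I[OF L] .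
  then have HIz: "hilb_series n (adjoin n I z) = fps_of_poly F" using F HI by simp
  have hI: "int (hilb n (adjoin n I z) p) = Polynomial.coeff F p" for p
    using arg_cong[OF HIz, of "\<lambda>s. fps_nth s p"] by simp
  then show "\<exists>z \<in> homogeneous_part n 1. nonzerodivisor n z I \<and> homogeneous_ideal n I \<and>
      (\<forall>p. int (hilb n (adjoin n I z) p) = Polynomial.coeff F p)"
    using z(1) regI Ih by blast
  show "Polynomial.degree F \<le> a"
  proof (rule degree_le, intro allI impI)
    fix p assume "a < p"
    then have "hilb n (adjoin n I z) p = 0"
      using liaison_top(2)[OF L] hilb_eq_0_iff[OF is_ideal_adjoin[OF homogeneous_ideal_is_ideal[OF Ih]], of z p] z(1) by simp
    then show "Polynomial.coeff F p = 0" using hI[of p] by simp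
  qed
  show "fps_of_poly G = fps_of_poly (\<Prod>j\<in>{1..n}. geom_poly (d j)) * (1 - fps_X ^ d 0) +
      fps_X ^ d 0 * Abs_fps (\<lambda>p. if p \<le> a then Polynomial.coeff F (a - p) else 0)"
    using liaison_series[OF L] G HJ by (simp add: hI HB P_def cong: if_cong)
qed

end

text \<open>The pairing inequality for U = S_p and V = B_q gives
  \<open>hilb n B p \<le> hilb n B q\<close> whenever p + q is the top degree; exchanging p and q
  gives equality.\<close>

lemma socle_le_1_imp_symmetric:
  fixes B :: "'k::field mpoly set"
  assumes B: "homogeneous_ideal n B" and socle: "socle_le_1 n B"
    and F: "\<And>p. int (hilb n B p) = Polynomial.coeff F p" and i: "i \<le> Polynomial.degree F"
  shows "Polynomial.coeff F (Polynomial.degree F - i) = Polynomial.coeff F i"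
proof (cases "F = 0")
  case False
  let ?H = "homogeneous_part n :: nat \<Rightarrow> 'k mpoly set" and ?s = "Polynomial.degree F"
  note Bi = homogeneous_ideal_is_ideal[OF B]
  have top: "?H p \<subseteq> B" if "?s < p" for p
    using F[of p] coeff_eq_0[OF that] hilb_eq_0_iff[OF Bi, of p] by simp
  have "Polynomial.lead_coeff F \<noteq> 0" using False by simp
  then have "hilb n B ?s \<noteq> 0" using F[of ?s] by (metis of_nat_0)
  then have "\<not> ?H ?s \<subseteq> B" using hilb_eq_0_iff[OF Bi, of ?s] by simp
  then obtain s where s: "s \<in> ?H ?s" "s \<notin> B" by blast
  have le: "hilb n B p \<le> hilb n B q" if pq: "p + q = ?s" for p q
  proof -
    have "mp.dim (?H p) + mp.dim (B \<inter> ?H q) \<le> mp.dim (B \<inter> ?H p) + mp.dim (?H q)"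
    proof (rule dim_annihilating_pair[OF Bi homogeneous_subspace order_refl is_ideal_part_subspace[OF Bi]])
      fix u assume "u \<in> ?H p" "\<And>w. w \<in> ?H q \<Longrightarrow> u * w \<in> B"
      then show "u \<in> B" using nondegenerate_top[OF B socle top s _ pq] by blast
    next
      show "hilb n B (p + q) \<le> 1" using hilb_top_le_1[OF B socle top] pq by simp
    next
      fix u v assume "u \<in> ?H p" "v \<in> B \<inter> ?H q"
      then show "u * v \<in> B" by (intro idlD(4)[OF Bi]) auto
    qed auto
    then show ?thesis using dim_homogeneous_eq[of n p B] dim_homogeneous_eq[of n q B] by linarith
  qed
  have "hilb n B (?s - i) = hilb n B i" using le[of "?s - i" i] le[of i "?s - i"] i by simp
  then show ?thesis using F[of i] F[of "?s - i"] by simp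
qed simp

section \<open>Evaluation of polynomials at t and 1/t in Laurent series\<close>

lemma laurent_eval_pCons: "laurent_eval (pCons c p) z = of_int c + z * laurent_eval p z"
  by (simp add: laurent_eval_def map_poly_pCons)

lemma laurent_eval_X: "laurent_eval p fls_X = fps_to_fls (fps_of_poly p)"
proof (induction p)
  case 0
  then show ?case by (simp add: laurent_eval_def)
next
  case (pCons c p)
  have "of_int c = fps_to_fls (fps_const c)"
    by (metis fps_of_int fps_to_fls_of_int of_int_eq_id id_apply)
  then show ?case using pCons
    by (simp add: laurent_eval_pCons fps_of_poly_pCons fls_times_fps_to_fls)
qed

lemma laurent_eval_sum:
  assumes "Polynomial.degree p \<le> N"
  shows "laurent_eval p z = (\<Sum>i\<le>N. of_int (Polynomial.coeff p i) * z ^ i)"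
proof -
  define q where "q = (map_poly of_int p :: int fls poly)"
  have c: "Polynomial.coeff q i = of_int (Polynomial.coeff p i)" for i by (simp add: q_def coeff_map_poly)
  then have "Polynomial.degree q \<le> N" using assms by (intro degree_le) (simp add: coeff_eq_0)
  then have "(\<Sum>i\<le>N. Polynomial.coeff q i * z ^ i) = (\<Sum>i\<le>Polynomial.degree q. Polynomial.coeff q i * z ^ i)"
    by (intro sum.mono_neutral_right) (auto simp: coeff_eq_0)
  then show ?thesis by (simp add: laurent_eval_def poly_altdef c flip: q_def)
qed

lemma fps_to_fls_sum: "fps_to_fls (sum g A) = (\<Sum>i\<in>A. fps_to_fls (g i))"
  by (induction A rule: infinite_finite_induct) auto

text \<open>Multiplication by t^N reverses the coefficients and leaves a power series;
  \<open>N\<close> may exceed the degree, as in the first formula.\<close>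

lemma laurent_eval_X_inv:
  assumes "Polynomial.degree p \<le> N"
  shows "fls_X_intpow (int N) * laurent_eval p fls_X_inv =
    fps_to_fls (Abs_fps (\<lambda>i. if i \<le> N then Polynomial.coeff p (N - i) else 0))"
proof -
  have X: "fls_X_intpow (int N) * fls_X_inv ^ i = (fps_to_fls (fps_X ^ (N - i)) :: int fls)" if "i \<le> N" for i
  proof -
    have "fls_X_intpow (int N) * fls_X_inv ^ i = (fls_X_intpow (int N) * fls_X_intpow (- int i) :: int fls)"
      by (simp only: fls_X_inv_power_conv_shift_1 minus_minus)
    also have "\<dots> = fls_X_intpow (int (N - i))"
      using that by (subst fls_X_intpow_times_fls_X_intpow) (simp add: of_nat_diff)
    also have "\<dots> = fls_X ^ (N - i)" by (simp only: fls_X_power_conv_shift_1)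
    finally show ?thesis by (simp add: fps_to_fls_power)
  qed
  have "fls_X_intpow (int N) * laurent_eval p fls_X_inv =
      (\<Sum>i\<le>N. of_int (Polynomial.coeff p i) * (fls_X_intpow (int N) * fls_X_inv ^ i))"
    by (simp add: laurent_eval_sum[OF assms] sum_distrib_left mult.left_commute)
  also have "\<dots> = (\<Sum>i\<le>N. fps_to_fls (fps_const (Polynomial.coeff p i) * fps_X ^ (N - i)))"
  proof (intro sum.cong refl)
    fix i assume i: "i \<in> {..N}"
    have "of_int c = fps_to_fls (fps_const c)" for c :: int
      by (metis fps_of_int fps_to_fls_of_int of_int_eq_id id_apply)
    then show "of_int (Polynomial.coeff p i) * (fls_X_intpow (int N) * fls_X_inv ^ i) =
        fps_to_fls (fps_const (Polynomial.coeff p i) * fps_X ^ (N - i))"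
      using X[of i] i by (simp add: fls_times_fps_to_fls)
  qed
  also have "\<dots> = fps_to_fls (\<Sum>i\<le>N. fps_const (Polynomial.coeff p i) * fps_X ^ (N - i))"
    by (rule fps_to_fls_sum[symmetric])
  also have "(\<Sum>i\<le>N. fps_const (Polynomial.coeff p i) * fps_X ^ (N - i)) =
      Abs_fps (\<lambda>i. if i \<le> N then Polynomial.coeff p (N - i) else 0)"
  proof (rule fps_ext)
    fix k
    have "fps_nth (\<Sum>i\<le>N. fps_const (Polynomial.coeff p i) * fps_X ^ (N - i)) k =
        (\<Sum>i\<le>N. if k = N - i then Polynomial.coeff p i else 0)"
      by (simp add: fps_sum_nth fps_X_power_nth if_distrib cong: if_cong)
    also have "\<dots> = (\<Sum>i\<le>N. if k \<le> N \<and> i = N - k then Polynomial.coeff p i else 0)"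
      by (intro sum.cong) auto
    also have "\<dots> = (if k \<le> N then Polynomial.coeff p (N - k) else 0)" by (auto simp: sum.delta)
    finally show "fps_nth (\<Sum>i\<le>N. fps_const (Polynomial.coeff p i) * fps_X ^ (N - i)) k =
        fps_nth (Abs_fps (\<lambda>i. if i \<le> N then Polynomial.coeff p (N - i) else 0)) k" by simp
  qed
  finally show ?thesis .
qed

section \<open>Socles over local rings of finite injective dimension\<close>

lemma module_self_module:
  assumes "cring R" shows "module R (self_module R)"
proof -
  interpret cring R by fact
  show ?thesis
  proof (rule moduleI)
    show "cring R" by fact
    show "abelian_group (self_module R)"
    proof (rule abelian_groupI)
      fix x assume "x \<in> carrier (self_module R)"
      then show "\<exists>y\<in>carrier (self_module R). y \<oplus>\<^bsub>self_module R\<^esub> x = \<zero>\<^bsub>self_module R\<^esub>"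
        by (intro bexI[of _ "\<ominus>\<^bsub>R\<^esub> x"]) (auto simp: self_module_def l_neg)
    qed (auto simp: self_module_def a_ac)
  qed (auto simp: self_module_def l_distr r_distr m_assoc)
qed

lemma self_module_simps:
  "carrier (self_module R) = carrier R" "x \<oplus>\<^bsub>self_module R\<^esub> y = x \<oplus>\<^bsub>R\<^esub> y"
  "\<zero>\<^bsub>self_module R\<^esub> = \<zero>\<^bsub>R\<^esub>" "a \<odot>\<^bsub>self_module R\<^esub> x = a \<otimes>\<^bsub>R\<^esub> x"
  by (simp_all add: self_module_def)

lemma submodule_ideal:
  assumes "cring R" "ideal A R" shows "submodule A R (self_module R)"
proof -
  interpret A: ideal A R by fact
  interpret S: module R "self_module R" using assms(1) by (rule module_self_module)
  show ?thesis
  proof (rule S.submoduleI)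
    fix a assume a: "a \<in> A"
    have "\<ominus>\<^bsub>R\<^esub> a \<in> carrier (self_module R)" "\<ominus>\<^bsub>R\<^esub> a \<oplus>\<^bsub>self_module R\<^esub> a = \<zero>\<^bsub>self_module R\<^esub>"
      using a A.a_subset by (auto simp: self_module_simps A.l_neg)
    then have "\<ominus>\<^bsub>self_module R\<^esub> a = \<ominus>\<^bsub>R\<^esub> a"
      using a A.a_subset by (intro S.minus_equality) (auto simp: self_module_simps)
    then show "\<ominus>\<^bsub>self_module R\<^esub> a \<in> A" using a A.a_inv_closed by simp
  qed (use A.a_subset in \<open>auto simp: self_module_simps A.I_l_closed\<close>)
qed

lemma mod_homD:
  assumes "h \<in> mod_hom R M N"
  shows "x \<in> carrier M \<Longrightarrow> h x \<in> carrier N"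
    "x \<in> carrier M \<Longrightarrow> y \<in> carrier M \<Longrightarrow> h (x \<oplus>\<^bsub>M\<^esub> y) = h x \<oplus>\<^bsub>N\<^esub> h y"
    "a \<in> carrier R \<Longrightarrow> x \<in> carrier M \<Longrightarrow> h (a \<odot>\<^bsub>M\<^esub> x) = a \<odot>\<^bsub>N\<^esub> h x"
  using assms by (auto simp: mod_hom_def)

lemma mod_hom_zero:
  assumes h: "h \<in> mod_hom R M N" and M: "module R M" and N: "module R N"
  shows "h \<zero>\<^bsub>M\<^esub> = \<zero>\<^bsub>N\<^esub>"
proof -
  interpret M: module R M by fact
  interpret N: module R N by fact
  have "h (\<zero>\<^bsub>R\<^esub> \<odot>\<^bsub>M\<^esub> \<zero>\<^bsub>M\<^esub>) = \<zero>\<^bsub>R\<^esub> \<odot>\<^bsub>N\<^esub> h \<zero>\<^bsub>M\<^esub>"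
    by (rule mod_homD(3)[OF h]) auto
  then show ?thesis using mod_homD(1)[OF h] by simp
qed

lemma mod_hom_minus:
  assumes h: "h \<in> mod_hom R M N" and M: "module R M" and N: "module R N"
    and xy: "x \<in> carrier M" "y \<in> carrier M"
  shows "h (x \<ominus>\<^bsub>M\<^esub> y) = h x \<ominus>\<^bsub>N\<^esub> h y"
proof -
  interpret M: module R M by fact
  interpret N: module R N by fact
  have "h (x \<ominus>\<^bsub>M\<^esub> y) \<oplus>\<^bsub>N\<^esub> h y = h x"
    using mod_homD(2)[OF h, of "x \<ominus>\<^bsub>M\<^esub> y" y] xy by (simp add: M.minus_eq M.a_assoc M.l_neg)
  then show ?thesis
    using mod_homD(1)[OF h] xy by (metis M.minus_closed N.minus_eq N.add.inv_solve_right')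
qed

text \<open>A homomorphism from an ideal extends to \<open>R\<close> itself, where it is determined
  by the image \<open>e\<close> of 1.\<close>

lemma injective_extension:
  assumes R: "cring R" and N: "injective_module R N" and A: "ideal A R"
    and h: "\<And>x. x \<in> A \<Longrightarrow> h x \<in> carrier N"
      "\<And>x y. x \<in> A \<Longrightarrow> y \<in> A \<Longrightarrow> h (x \<oplus>\<^bsub>R\<^esub> y) = h x \<oplus>\<^bsub>N\<^esub> h y"
      "\<And>r x. r \<in> carrier R \<Longrightarrow> x \<in> A \<Longrightarrow> h (r \<otimes>\<^bsub>R\<^esub> x) = r \<odot>\<^bsub>N\<^esub> h x"
  shows "\<exists>e\<in>carrier N. \<forall>a\<in>A. h a = a \<odot>\<^bsub>N\<^esub> e"
proof -
  interpret cring R by fact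
  interpret A: ideal A R by fact
  have "h \<in> mod_hom R ((self_module R)\<lparr>carrier := A\<rparr>) N"
    using h by (auto simp: mod_hom_def self_module_def)
  then obtain g where g: "g \<in> mod_hom R (self_module R) N" "\<forall>x\<in>A. g x = h x"
    using N submodule_ideal[OF R A] module_self_module[OF R] unfolding injective_module_def by blast
  have "h a = a \<odot>\<^bsub>N\<^esub> g \<one>\<^bsub>R\<^esub>" if "a \<in> A" for a
    using mod_homD(3)[OF g(1), of a "\<one>\<^bsub>R\<^esub>"] g(2) that A.a_subset by (auto simp: self_module_simps)
  moreover have "g \<one>\<^bsub>R\<^esub> \<in> carrier N"
    using mod_homD(1)[OF g(1), of "\<one>\<^bsub>R\<^esub>"] by (simp add: self_module_simps)
  ultimately show ?thesis by blast
qed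

text \<open>Baer's criterion for the extension of a homomorphism from \<open>A\<close> to \<open>A + R b\<close>; the homomorphism
  in question maps \<open>A\<close> to zero and \<open>b\<close> to \<open>v\<close>.\<close>

definition cyclic_baer :: "('a, 'b) ring_scheme \<Rightarrow> 'a \<Rightarrow> ('a, 'm) module \<Rightarrow> 'm set \<Rightarrow> bool" where
  "cyclic_baer R z N X \<longleftrightarrow> (\<forall>A b v. ideal A R \<longrightarrow> z \<in> A \<longrightarrow> b \<in> carrier R \<longrightarrow> v \<in> X \<longrightarrow>
     (\<forall>r\<in>carrier R. r \<otimes>\<^bsub>R\<^esub> b \<in> A \<longrightarrow> r \<odot>\<^bsub>N\<^esub> v = \<zero>\<^bsub>N\<^esub>) \<longrightarrow>
     (\<exists>u\<in>X. (\<forall>a\<in>A. a \<odot>\<^bsub>N\<^esub> u = \<zero>\<^bsub>N\<^esub>) \<and> b \<odot>\<^bsub>N\<^esub> u = v))"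

text \<open>The assignment a + r b -> r v on A + R b is well defined by \<open>wd\<close>; extension
  to \<open>R\<close> makes it multiplication with some \<open>u\<close>.\<close>

lemma injective_cyclic_extension:
  assumes N: "injective_module R N" and A: "ideal A R" and b: "b \<in> carrier R" and v: "v \<in> carrier N"
    and wd: "\<And>r. r \<in> carrier R \<Longrightarrow> r \<otimes>\<^bsub>R\<^esub> b \<in> A \<Longrightarrow> r \<odot>\<^bsub>N\<^esub> v = \<zero>\<^bsub>N\<^esub>"
  shows "\<exists>u\<in>carrier N. (\<forall>a\<in>A. a \<odot>\<^bsub>N\<^esub> u = \<zero>\<^bsub>N\<^esub>) \<and> b \<odot>\<^bsub>N\<^esub> u = v"
proof -
  have "module R N" using N by (simp add: injective_module_def)
  then interpret N: module R N .
  interpret A: ideal A R by fact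
  define B where "B = A <+>\<^bsub>R\<^esub> PIdl\<^bsub>R\<^esub> b"
  have B: "ideal B R" unfolding B_def
    by (rule N.R.add_ideals[OF A N.R.cgenideal_ideal[OF b]])
  have memB: "x \<in> B \<longleftrightarrow> (\<exists>a\<in>A. \<exists>r\<in>carrier R. x = a \<oplus>\<^bsub>R\<^esub> r \<otimes>\<^bsub>R\<^esub> b)" for x
    by (auto simp: B_def set_add_def' cgenideal_def)
  \<comment> \<open>The representation a + r b is not unique; two of them differ by (r - r') b in
    \<open>A\<close>, so every choice gives the same value.\<close>
  define h where "h x = (SOME w. \<exists>a\<in>A. \<exists>r\<in>carrier R. x = a \<oplus>\<^bsub>R\<^esub> r \<otimes>\<^bsub>R\<^esub> b \<and> w = r \<odot>\<^bsub>N\<^esub> v)" for x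
  have h: "h (a \<oplus>\<^bsub>R\<^esub> r \<otimes>\<^bsub>R\<^esub> b) = r \<odot>\<^bsub>N\<^esub> v" if ar: "a \<in> A" "r \<in> carrier R" for a r
  proof -
    let ?P = "\<lambda>w. \<exists>a'\<in>A. \<exists>r'\<in>carrier R. a \<oplus>\<^bsub>R\<^esub> r \<otimes>\<^bsub>R\<^esub> b = a' \<oplus>\<^bsub>R\<^esub> r' \<otimes>\<^bsub>R\<^esub> b \<and> w = r' \<odot>\<^bsub>N\<^esub> v"
    have "?P (r \<odot>\<^bsub>N\<^esub> v)" using ar by blast
    then have "?P (h (a \<oplus>\<^bsub>R\<^esub> r \<otimes>\<^bsub>R\<^esub> b))" unfolding h_def by (rule someI)
    then obtain a' r' where *: "a' \<in> A" "r' \<in> carrier R" "a \<oplus>\<^bsub>R\<^esub> r \<otimes>\<^bsub>R\<^esub> b = a' \<oplus>\<^bsub>R\<^esub> r' \<otimes>\<^bsub>R\<^esub> b"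
      "h (a \<oplus>\<^bsub>R\<^esub> r \<otimes>\<^bsub>R\<^esub> b) = r' \<odot>\<^bsub>N\<^esub> v" by blast
    have c: "a \<in> carrier R" "a' \<in> carrier R" using ar(1) *(1) A.a_subset by auto
    have "(r \<ominus>\<^bsub>R\<^esub> r') \<otimes>\<^bsub>R\<^esub> b = (a \<oplus>\<^bsub>R\<^esub> r \<otimes>\<^bsub>R\<^esub> b) \<ominus>\<^bsub>R\<^esub> a \<ominus>\<^bsub>R\<^esub> r' \<otimes>\<^bsub>R\<^esub> b"
      using c ar(2) *(2) b by algebra
    also have "\<dots> = a' \<ominus>\<^bsub>R\<^esub> a"
      unfolding *(3) using c ar(2) *(2) b by algebra
    also have "\<dots> \<in> A" using ar(1) *(1) by (simp add: N.R.minus_eq)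
    finally have "(r \<ominus>\<^bsub>R\<^esub> r') \<odot>\<^bsub>N\<^esub> v = \<zero>\<^bsub>N\<^esub>" using wd ar(2) *(2) by simp
    then have "r \<odot>\<^bsub>N\<^esub> v \<oplus>\<^bsub>N\<^esub> \<ominus>\<^bsub>N\<^esub> (r' \<odot>\<^bsub>N\<^esub> v) = \<zero>\<^bsub>N\<^esub>"
      using ar(2) *(2) v by (simp add: N.R.minus_eq N.smult_l_distr N.smult_l_minus)
    then have "r \<odot>\<^bsub>N\<^esub> v = r' \<odot>\<^bsub>N\<^esub> v"
      using ar(2) *(2) v by (metis N.M.add.inv_closed N.M.minus_equality N.M.minus_minus N.smult_closed)
    then show ?thesis using *(4) by simp
  qed
  have "\<exists>e\<in>carrier N. \<forall>a\<in>B. h a = a \<odot>\<^bsub>N\<^esub> e"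
  proof (rule injective_extension[OF N.R.is_cring N B])
    fix x assume "x \<in> B"
    then show "h x \<in> carrier N" using h v by (auto simp: memB)
  next
    fix x y assume "x \<in> B" "y \<in> B"
    then obtain a r a' r' where *: "a \<in> A" "r \<in> carrier R" "x = a \<oplus>\<^bsub>R\<^esub> r \<otimes>\<^bsub>R\<^esub> b"
      "a' \<in> A" "r' \<in> carrier R" "y = a' \<oplus>\<^bsub>R\<^esub> r' \<otimes>\<^bsub>R\<^esub> b" unfolding memB by blast
    have c: "a \<in> carrier R" "a' \<in> carrier R" using *(1,4) A.a_subset by auto
    have "x \<oplus>\<^bsub>R\<^esub> y = (a \<oplus>\<^bsub>R\<^esub> a') \<oplus>\<^bsub>R\<^esub> (r \<oplus>\<^bsub>R\<^esub> r') \<otimes>\<^bsub>R\<^esub> b"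
      unfolding *(3,6) using c *(2,5) b by algebra
    then have "h (x \<oplus>\<^bsub>R\<^esub> y) = (r \<oplus>\<^bsub>R\<^esub> r') \<odot>\<^bsub>N\<^esub> v"
      using h[of "a \<oplus>\<^bsub>R\<^esub> a'" "r \<oplus>\<^bsub>R\<^esub> r'"] *(1,2,4,5) by simp
    then show "h (x \<oplus>\<^bsub>R\<^esub> y) = h x \<oplus>\<^bsub>N\<^esub> h y"
      using h[of a r] h[of a' r'] * v by (simp add: N.smult_l_distr)
  next
    fix s x assume s: "s \<in> carrier R" and "x \<in> B"
    then obtain a r where *: "a \<in> A" "r \<in> carrier R" "x = a \<oplus>\<^bsub>R\<^esub> r \<otimes>\<^bsub>R\<^esub> b" unfolding memB by blast
    have c: "a \<in> carrier R" using *(1) A.a_subset by auto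
    have "s \<otimes>\<^bsub>R\<^esub> x = (s \<otimes>\<^bsub>R\<^esub> a) \<oplus>\<^bsub>R\<^esub> (s \<otimes>\<^bsub>R\<^esub> r) \<otimes>\<^bsub>R\<^esub> b"
      unfolding *(3) using c *(2) b s by algebra
    then have "h (s \<otimes>\<^bsub>R\<^esub> x) = (s \<otimes>\<^bsub>R\<^esub> r) \<odot>\<^bsub>N\<^esub> v"
      using h[of "s \<otimes>\<^bsub>R\<^esub> a" "s \<otimes>\<^bsub>R\<^esub> r"] * s A.I_l_closed by simp
    then show "h (s \<otimes>\<^bsub>R\<^esub> x) = s \<odot>\<^bsub>N\<^esub> h x"
      using h[of a r] * v s by (simp add: N.smult_assoc1)
  qed
  then obtain u where u: "u \<in> carrier N" "\<And>a. a \<in> B \<Longrightarrow> h a = a \<odot>\<^bsub>N\<^esub> u" by blast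
  have "a \<odot>\<^bsub>N\<^esub> u = \<zero>\<^bsub>N\<^esub>" if a: "a \<in> A" for a
  proof -
    have "a = a \<oplus>\<^bsub>R\<^esub> \<zero>\<^bsub>R\<^esub> \<otimes>\<^bsub>R\<^esub> b" using a A.a_subset b by auto
    then show ?thesis using u(2)[of a] h[of a "\<zero>\<^bsub>R\<^esub>"] a v memB[of a] by (metis N.R.zero_closed N.smult_l_null)
  qed
  moreover have "b \<odot>\<^bsub>N\<^esub> u = v"
  proof -
    have "b = \<zero>\<^bsub>R\<^esub> \<oplus>\<^bsub>R\<^esub> \<one>\<^bsub>R\<^esub> \<otimes>\<^bsub>R\<^esub> b" using b by simp
    then show ?thesis using u(2)[of b] h[of "\<zero>\<^bsub>R\<^esub>" "\<one>\<^bsub>R\<^esub>"] A.zero_closed v memB[of b]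
      by (metis N.R.one_closed N.smult_one)
  qed
  ultimately show ?thesis using u(1) by blast
qed

text \<open>The intended case is S/I localized at the irrelevant ideal, with the class of a linear
  form as \<open>z\<close>. \<open>noeth\<close> is the maximum condition and \<open>nil\<close>
  says that nonzero cyclic modules over R/z have a nonzero socle; in this form both pass from S/I to
  its localization.\<close>

locale local_parameter = cring R for R (structure) +
  fixes M :: "'a set" and z :: 'a
  assumes M: "ideal M R" and one_notin: "\<one> \<notin> M"
    and unit: "\<And>r. r \<in> carrier R \<Longrightarrow> r \<notin> M \<Longrightarrow> r \<in> Units R"
    and z: "z \<in> M" and z_regular: "\<And>a. a \<in> carrier R \<Longrightarrow> z \<otimes> a = \<zero> \<Longrightarrow> a = \<zero>"
    and noeth: "\<And>F. F \<noteq> {} \<Longrightarrow> (\<And>A. A \<in> F \<Longrightarrow> ideal A R) \<Longrightarrow> \<exists>A\<in>F. \<forall>B\<in>F. A \<subseteq> B \<longrightarrow> A = B"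
    and nil: "\<And>A. ideal A R \<Longrightarrow> z \<in> A \<Longrightarrow> A \<noteq> carrier R \<Longrightarrow>
      \<exists>b\<in>carrier R - A. \<forall>m\<in>M. m \<otimes> b \<in> A"
begin

lemma M_carrier: "m \<in> M \<Longrightarrow> m \<in> carrier R"
  using ideal.Icarr[OF M] .

lemma z_carrier: "z \<in> carrier R"
  using M_carrier[OF z] .

text \<open>Used by contraposition: for \<open>b\<close> outside \<open>A\<close>, every
  \<open>r\<close> with r b in \<open>A\<close> belongs to \<open>M\<close>.\<close>

lemma unit_cancel_mem:
  assumes A: "ideal A R" and r: "r \<in> carrier R" "r \<notin> M" and b: "b \<in> carrier R" and rb: "r \<otimes> b \<in> A"
  shows "b \<in> A"
proof -
  have u: "r \<in> Units R" using unit r by simp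
  then have "inv r \<otimes> (r \<otimes> b) \<in> A" using rb ideal.I_l_closed[OF A] by simp
  moreover have "inv r \<otimes> (r \<otimes> b) = b" using u r b by (simp flip: m_assoc)
  ultimately show ?thesis by simp
qed

lemma socle_element:
  obtains s where "s \<in> carrier R" "s \<notin> PIdl z" "\<And>m. m \<in> M \<Longrightarrow> m \<otimes> s \<in> PIdl z"
proof -
  have zI: "ideal (PIdl z) R" using z_carrier by (rule cgenideal_ideal)
  have "\<one> \<notin> PIdl z"
    using one_notin cgenideal_minimal[OF M z] by blast
  then have "PIdl z \<noteq> carrier R" by auto
  then show ?thesis using nil[OF zI cgenideal_self[OF z_carrier]] that by blast
qed

text \<open>Among the solutions \<open>q \<in> N\<close> of the extension problem, one with a maximal conductor
  \<open>{r. r q \<in> Z}\<close> lies in \<open>Z\<close>: otherwise it can be corrected at an element that \<open>M\<close> maps into the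
  conductor, since the socle of \<open>R/z\<close> reaches every element of \<open>\<delta> N\<close> killed by \<open>M\<close>.\<close>

lemma cyclic_baer_kernel:
  assumes N: "injective_module R N" and N': "module R N'" and \<delta>: "\<delta> \<in> mod_hom R N N'"
    and Z: "Z = {x \<in> carrier N. \<delta> x = \<zero>\<^bsub>N'\<^esub>}"
    and div: "\<And>y. y \<in> Z \<Longrightarrow> \<exists>y'\<in>Z. y = z \<odot>\<^bsub>N\<^esub> y'"
    and X: "cyclic_baer R z N' (\<delta> ` carrier N)"
  shows "cyclic_baer R z N Z"
  unfolding cyclic_baer_def
proof (intro allI impI)
  fix A b v
  assume A: "ideal A R" and zA: "z \<in> A" and b: "b \<in> carrier R" and v: "v \<in> Z"
    and wd: "\<forall>r\<in>carrier R. r \<otimes> b \<in> A \<longrightarrow> r \<odot>\<^bsub>N\<^esub> v = \<zero>\<^bsub>N\<^esub>"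
  have modN: "module R N" using N by (simp add: injective_module_def)
  interpret N: module R N by (rule modN)
  interpret N': module R N' by (rule N')
  note \<delta>c = mod_homD(1)[OF \<delta>] and \<delta>s = mod_homD(3)[OF \<delta>] and \<delta>a = mod_homD(2)[OF \<delta>]
    and \<delta>m = mod_hom_minus[OF \<delta> modN N'] and \<delta>0 = mod_hom_zero[OF \<delta> modN N']
  define K where "K q = {r \<in> carrier R. \<delta> (r \<odot>\<^bsub>N\<^esub> q) = \<zero>\<^bsub>N'\<^esub>}" for q
  define C where "C = {q \<in> carrier N. (\<forall>a\<in>A. a \<odot>\<^bsub>N\<^esub> q = \<zero>\<^bsub>N\<^esub>) \<and> b \<odot>\<^bsub>N\<^esub> q = v}"
  have K: "ideal (K q) R" if q: "q \<in> carrier N" for q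
  proof (rule idealI)
    show "ring R" by (rule local.ring_axioms)
    show "subgroup (K q) (add_monoid R)"
    proof (rule add.subgroupI)
      fix r assume r: "r \<in> K q"
      then have "\<delta> ((\<ominus> r) \<odot>\<^bsub>N\<^esub> q) = (\<ominus> r) \<odot>\<^bsub>N'\<^esub> \<delta> q" using q \<delta>s by (simp add: K_def)
      also have "\<dots> = \<ominus>\<^bsub>N'\<^esub> (r \<odot>\<^bsub>N'\<^esub> \<delta> q)" using r q \<delta>c by (simp add: K_def N'.smult_l_minus)
      also have "r \<odot>\<^bsub>N'\<^esub> \<delta> q = \<zero>\<^bsub>N'\<^esub>" using r q \<delta>s[of r q] by (simp add: K_def)
      finally show "\<ominus> r \<in> K q" using r q by (simp add: K_def)
    next
      show "K q \<noteq> {}" using q \<delta>0 by (auto simp: K_def intro!: exI[of _ \<zero>])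
    qed (use q \<delta>a in \<open>auto simp: K_def N.smult_l_distr\<close>)
    show "x \<otimes> a \<in> K q" if "a \<in> K q" "x \<in> carrier R" for a x
      using that q \<delta>s by (simp add: K_def N.smult_assoc1)
    then show "a \<otimes> x \<in> K q" if "a \<in> K q" "x \<in> carrier R" for a x
      using that m_comm[of a x] by (auto simp: K_def)
  qed
  have vN: "v \<in> carrier N" using v Z by simp
  have "\<exists>q\<in>carrier N. (\<forall>a\<in>A. a \<odot>\<^bsub>N\<^esub> q = \<zero>\<^bsub>N\<^esub>) \<and> b \<odot>\<^bsub>N\<^esub> q = v"
    by (rule injective_cyclic_extension[OF N A b vN]) (use wd in blast)
  then have "C \<noteq> {}" unfolding C_def by blast
  then have "\<exists>B\<in>K ` C. \<forall>B'\<in>K ` C. B \<subseteq> B' \<longrightarrow> B = B'"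
    by (intro noeth) (auto intro: K simp: C_def)
  then obtain q where q: "q \<in> C" and max: "\<And>q'. q' \<in> C \<Longrightarrow> K q \<subseteq> K q' \<Longrightarrow> K q = K q'" by blast
  have qN: "q \<in> carrier N" and Aq: "\<And>a. a \<in> A \<Longrightarrow> a \<odot>\<^bsub>N\<^esub> q = \<zero>\<^bsub>N\<^esub>" and bq: "b \<odot>\<^bsub>N\<^esub> q = v"
    using q by (auto simp: C_def)
  have AK: "A \<subseteq> K q" using Aq \<delta>0 ideal.Icarr[OF A] by (auto simp: K_def)
  have "K q = carrier R"
  proof (rule ccontr)
    assume "K q \<noteq> carrier R"
    then obtain b' where b': "b' \<in> carrier R" "b' \<notin> K q" "\<And>m. m \<in> M \<Longrightarrow> m \<otimes> b' \<in> K q"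
      using nil[OF K[OF qN]] AK zA by blast
    obtain s where s: "s \<in> carrier R" "s \<notin> PIdl z" "\<And>m. m \<in> M \<Longrightarrow> m \<otimes> s \<in> PIdl z"
      using socle_element by blast
    have zI: "ideal (PIdl z) R" using z_carrier by (rule cgenideal_ideal)
    \<comment> \<open>\<open>M\<close> kills both \<open>?v\<close> and the class of
      \<open>s\<close> in R/z, so sending \<open>s\<close> to \<open>?v\<close> is well defined, and
      the hypothesis \<open>X\<close> extends this within the image of
      \<open>\<delta>\<close>.\<close>
    let ?v = "\<delta> (b' \<odot>\<^bsub>N\<^esub> q)"
    have vX: "?v \<in> \<delta> ` carrier N" using b'(1) qN by simp
    have Mv: "m \<odot>\<^bsub>N'\<^esub> ?v = \<zero>\<^bsub>N'\<^esub>" if "m \<in> M" for m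
      using b'(3)[OF that] M_carrier[OF that] b'(1) qN \<delta>s[of m "b' \<odot>\<^bsub>N\<^esub> q"]
      by (simp add: K_def N.smult_assoc1)
    have "\<forall>r\<in>carrier R. r \<otimes> s \<in> PIdl z \<longrightarrow> r \<odot>\<^bsub>N'\<^esub> ?v = \<zero>\<^bsub>N'\<^esub>"
      using Mv unit_cancel_mem[OF zI _ _ s(1)] s(2) by blast
    then obtain u where u: "u \<in> \<delta> ` carrier N" "\<And>a. a \<in> PIdl z \<Longrightarrow> a \<odot>\<^bsub>N'\<^esub> u = \<zero>\<^bsub>N'\<^esub>" "s \<odot>\<^bsub>N'\<^esub> u = ?v"
      using X zI cgenideal_self[OF z_carrier] s(1) vX unfolding cyclic_baer_def by metis
    \<comment> \<open>The product z e lies in \<open>Z\<close> and is therefore z y with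
      \<open>y\<close> in \<open>Z\<close>; the difference e - y has the same image under
      \<open>\<delta>\<close> and is killed by \<open>z\<close>.\<close>
    obtain e where e: "e \<in> carrier N" "u = \<delta> e" using u(1) by blast
    have "z \<odot>\<^bsub>N\<^esub> e \<in> Z"
      using u(2)[OF cgenideal_self[OF z_carrier]] e z_carrier \<delta>s by (simp add: Z)
    then obtain y where y: "y \<in> Z" "z \<odot>\<^bsub>N\<^esub> e = z \<odot>\<^bsub>N\<^esub> y" using div by blast
    have yN: "y \<in> carrier N" "\<delta> y = \<zero>\<^bsub>N'\<^esub>" using y(1) by (auto simp: Z)
    define e' where "e' = e \<ominus>\<^bsub>N\<^esub> y"
    have e': "e' \<in> carrier N" using e yN by (simp add: e'_def)
    have \<delta>e': "\<delta> e' = u" using \<delta>m[OF e(1) yN(1)] yN(2) e \<delta>c[OF e(1)] by (simp add: e'_def N'.M.minus_eq)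
    have ze': "z \<odot>\<^bsub>N\<^esub> e' = \<zero>\<^bsub>N\<^esub>"
      using y(2) e(1) yN(1) z_carrier
      by (simp add: e'_def N.M.minus_eq N.smult_r_distr N.smult_r_minus N.M.r_neg)
    define t where "t = s \<odot>\<^bsub>N\<^esub> e'"
    have tN: "t \<in> carrier N" using s(1) e' by (simp add: t_def)
    have \<delta>t: "\<delta> t = ?v" using \<delta>s[OF s(1) e'] \<delta>e' u(3) by (simp add: t_def)
    \<comment> \<open>m s is a multiple of \<open>z\<close>, which kills \<open>e'\<close>. Hence
      sending \<open>b'\<close> to \<open>t\<close> and \<open>K q\<close> to zero is well
      defined.\<close>
    have Mt: "m \<odot>\<^bsub>N\<^esub> t = \<zero>\<^bsub>N\<^esub>" if m: "m \<in> M" for m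
    proof -
      obtain c where c: "c \<in> carrier R" "m \<otimes> s = c \<otimes> z" using s(3)[OF m] by (auto simp: cgenideal_def)
      have "m \<odot>\<^bsub>N\<^esub> t = (c \<otimes> z) \<odot>\<^bsub>N\<^esub> e'"
        using M_carrier[OF m] s(1) e' by (simp add: t_def flip: N.smult_assoc1 c(2))
      then show ?thesis using c(1) z_carrier e' ze' by (simp add: N.smult_assoc1)
    qed
    have "\<exists>w\<in>carrier N. (\<forall>a\<in>K q. a \<odot>\<^bsub>N\<^esub> w = \<zero>\<^bsub>N\<^esub>) \<and> b' \<odot>\<^bsub>N\<^esub> w = t"
      by (rule injective_cyclic_extension[OF N K[OF qN] b'(1) tN])
        (use Mt unit_cancel_mem[OF K[OF qN] _ _ b'(1)] b'(2) in blast)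
    then obtain w where w: "w \<in> carrier N" "\<And>a. a \<in> K q \<Longrightarrow> a \<odot>\<^bsub>N\<^esub> w = \<zero>\<^bsub>N\<^esub>" "b' \<odot>\<^bsub>N\<^esub> w = t" by blast
    \<comment> \<open>Subtracting \<open>w\<close> leaves the action of \<open>K q\<close> unchanged
      and moves the multiple by \<open>b'\<close> into \<open>Z\<close>, so the conductor grows by
      \<open>b'\<close>.\<close>
    define q' where "q' = q \<ominus>\<^bsub>N\<^esub> w"
    have q'N: "q' \<in> carrier N" using qN w(1) by (simp add: q'_def)
    have smul_q': "r \<odot>\<^bsub>N\<^esub> q' = r \<odot>\<^bsub>N\<^esub> q \<ominus>\<^bsub>N\<^esub> r \<odot>\<^bsub>N\<^esub> w" if "r \<in> carrier R" for r
      using that qN w(1) by (simp add: q'_def N.M.minus_eq N.smult_r_distr N.smult_r_minus)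
    have same: "r \<odot>\<^bsub>N\<^esub> q' = r \<odot>\<^bsub>N\<^esub> q" if "r \<in> K q" for r
      using smul_q'[of r] w(2)[OF that] that qN by (auto simp: K_def N.M.minus_eq)
    have "b \<in> K q" using b bq v by (simp add: K_def Z)
    then have "q' \<in> C" using same AK Aq bq q'N by (auto simp: C_def)
    moreover have "K q \<subseteq> K q'" using same by (auto simp: K_def)
    moreover have "b' \<in> K q'"
    proof -
      have "\<delta> (b' \<odot>\<^bsub>N\<^esub> q') = ?v \<ominus>\<^bsub>N'\<^esub> \<delta> t"
        using smul_q'[OF b'(1)] \<delta>m[of "b' \<odot>\<^bsub>N\<^esub> q" t] w(3) tN b'(1) qN by simp
      then show ?thesis using \<delta>t b'(1) \<delta>c[of "b' \<odot>\<^bsub>N\<^esub> q"] qN by (simp add: K_def N'.M.minus_eq N'.M.r_neg)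
    qed
    ultimately show False using max[of q'] b'(2) by blast
  qed
  then have "\<one> \<in> K q" by simp
  then have "q \<in> Z" using qN by (simp add: K_def Z)
  then show "\<exists>u\<in>Z. (\<forall>a\<in>A. a \<odot>\<^bsub>N\<^esub> u = \<zero>\<^bsub>N\<^esub>) \<and> b \<odot>\<^bsub>N\<^esub> u = v" using Aq bq by blast
qed

text \<open>\<open>cyclic_baer\<close> is carried down the resolution to \<open>Z 1\<close>, the
  image of \<open>E 0\<close>. There the class of s1/z becomes \<open>s1\<close> times an element
  killed by \<open>z\<close> and \<open>s2\<close>, and lifting this element to \<open>E 0\<close>
  gives the ring element that separates \<open>s1\<close> from \<open>s2\<close>.\<close>

theorem socle_dependent:
  fixes s1 s2 :: 'a
  assumes inj_dim: "finite_self_injective_dimension R"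
    and s: "s1 \<in> carrier R" "s2 \<in> carrier R"
    and socle: "\<And>m. m \<in> M \<Longrightarrow> m \<otimes> s1 \<in> PIdl z" "\<And>m. m \<in> M \<Longrightarrow> m \<otimes> s2 \<in> PIdl z"
  shows "\<exists>a\<in>carrier R. \<exists>b\<in>carrier R. (a \<notin> M \<or> b \<notin> M) \<and> a \<otimes> s1 \<oplus> b \<otimes> s2 \<in> PIdl z"
proof (rule ccontr)
  assume "\<not> ?thesis"
  then have indep: "a \<in> M \<and> b \<in> M"
    if "a \<in> carrier R" "b \<in> carrier R" "a \<otimes> s1 \<oplus> b \<otimes> s2 \<in> PIdl z" for a b
    using that by blast
  obtain E :: "nat \<Rightarrow> ('a, nat \<Rightarrow> 'a) module" and \<epsilon> \<delta> d
    where res: "injective_resolution R (self_module R) E \<epsilon> \<delta>" and fin: "\<forall>i > d. carrier (E i) = {\<zero>\<^bsub>E i\<^esub>}"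
    using inj_dim unfolding finite_self_injective_dimension_def by blast
  have E: "injective_module R (E i)" for i using res by (simp add: injective_resolution_def)
  have modE: "module R (E i)" for i using E[of i] by (simp add: injective_module_def)
  have \<epsilon>: "\<epsilon> \<in> mod_hom R (self_module R) (E 0)" and \<epsilon>_inj: "inj_on \<epsilon> (carrier R)"
    and \<delta>: "\<delta> i \<in> mod_hom R (E i) (E (Suc i))" for i
    using res by (auto simp: injective_resolution_def self_module_simps)
  have ker0: "\<epsilon> ` carrier R = {x \<in> carrier (E 0). \<delta> 0 x = \<zero>\<^bsub>E 1\<^esub>}"
    and ker: "\<delta> i ` carrier (E i) = {x \<in> carrier (E (Suc i)). \<delta> (Suc i) x = \<zero>\<^bsub>E (Suc (Suc i))\<^esub>}" for i
    using res by (auto simp: injective_resolution_def self_module_simps a_kernel_def')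
  have zI: "ideal (PIdl z) R" using z_carrier by (rule cgenideal_ideal)
  have PIdl_iff: "x \<in> PIdl z \<longleftrightarrow> (\<exists>c\<in>carrier R. x = z \<otimes> c)" for x
    using z_carrier m_comm by (auto simp: cgenideal_def)
  define Z where "Z i = {x \<in> carrier (E i). \<delta> i x = \<zero>\<^bsub>E (Suc i)\<^esub>}" for i
  have ZS: "Z (Suc i) = \<delta> i ` carrier (E i)" for i using ker by (simp add: Z_def)
  \<comment> \<open>\<open>z\<close> is regular, so it may be sent to any \<open>x\<close>;
    injectivity extends this map from zR to \<open>R\<close>.\<close>
  have divisible: "\<exists>x'\<in>carrier (E i). x = z \<odot>\<^bsub>E i\<^esub> x'" if x: "x \<in> carrier (E i)" for i x
  proof -
    interpret N: module R "E i" by (rule modE)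
    have "\<exists>u\<in>carrier (E i). (\<forall>a\<in>{\<zero>}. a \<odot>\<^bsub>E i\<^esub> u = \<zero>\<^bsub>E i\<^esub>) \<and> z \<odot>\<^bsub>E i\<^esub> u = x"
    proof (rule injective_cyclic_extension[OF E zeroideal z_carrier x])
      fix r assume "r \<in> carrier R" "r \<otimes> z \<in> {\<zero>}"
      then have "r = \<zero>" using z_regular[of r] z_carrier m_comm[of r z] by simp
      then show "r \<odot>\<^bsub>E i\<^esub> x = \<zero>\<^bsub>E i\<^esub>" using x by simp
    qed
    then show ?thesis by blast
  qed
  \<comment> \<open>Descends from d + 1, where the module is zero. Each \<open>Z (Suc i)\<close> is
    an image of the divisible module \<open>E i\<close>; the induction stops at \<open>Z 1\<close>
    because \<open>Z 0\<close> is a copy of \<open>R\<close>, which is not divisible by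
    \<open>z\<close>.\<close>
  have baer: "cyclic_baer R z (E (Suc i)) (Z (Suc i))" if "i \<le> d" for i
    using that
  proof (induction i rule: inc_induct)
    case base
    interpret N: module R "E (Suc d)" by (rule modE)
    have "carrier (E (Suc d)) = {\<zero>\<^bsub>E (Suc d)\<^esub>}" using fin by simp
    moreover have "\<zero>\<^bsub>E (Suc d)\<^esub> \<in> Z (Suc d)"
      using mod_hom_zero[OF \<delta> modE modE] by (simp add: Z_def)
    ultimately have Z0: "Z (Suc d) = {\<zero>\<^bsub>E (Suc d)\<^esub>}" by (auto simp: Z_def)
    show ?case
      unfolding cyclic_baer_def Z0 by (auto dest: ideal.Icarr)
  next
    case (step i)
    show ?case
    proof (rule cyclic_baer_kernel[OF E modE \<delta>])
      show "Z (Suc i) = {x \<in> carrier (E (Suc i)). \<delta> (Suc i) x = \<zero>\<^bsub>E (Suc (Suc i))\<^esub>}" by (simp add: Z_def)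
      show "cyclic_baer R z (E (Suc (Suc i))) (\<delta> (Suc i) ` carrier (E (Suc i)))"
        using step.IH by (simp add: ZS)
      fix y assume "y \<in> Z (Suc i)"
      then obtain x where x: "x \<in> carrier (E i)" "y = \<delta> i x" by (auto simp: ZS)
      then obtain x' where x': "x' \<in> carrier (E i)" "x = z \<odot>\<^bsub>E i\<^esub> x'" using divisible by blast
      have "y = z \<odot>\<^bsub>E (Suc i)\<^esub> \<delta> i x'" using x(2) x' mod_homD(3)[OF \<delta> z_carrier] by simp
      then show "\<exists>y'\<in>Z (Suc i). y = z \<odot>\<^bsub>E (Suc i)\<^esub> y'" using x'(1) by (auto simp: ZS)
    qed
  qed
  have baer1: "cyclic_baer R z (E 1) (Z 1)" using baer[of 0] by simp
  interpret N: module R "E 0" by (rule modE)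
  interpret N1: module R "E 1" by (rule modE)
  have \<delta>0: "\<delta> 0 \<in> mod_hom R (E 0) (E 1)" using \<delta>[of 0] by simp
  note \<delta>c = mod_homD(1)[OF \<delta>0] and \<delta>s = mod_homD(3)[OF \<delta>0] and \<delta>m = mod_hom_minus[OF \<delta>0 modE modE]
  note \<epsilon>c = mod_homD(1)[OF \<epsilon>, unfolded self_module_simps] and \<epsilon>a = mod_homD(2)[OF \<epsilon>, unfolded self_module_simps]
    and \<epsilon>s = mod_homD(3)[OF \<epsilon>, unfolded self_module_simps]
  have \<delta>\<epsilon>: "\<delta> 0 (\<epsilon> r) = \<zero>\<^bsub>E 1\<^esub>" if "r \<in> carrier R" for r using ker0 that by blast
  have Z1: "Z 1 = \<delta> 0 ` carrier (E 0)" using ZS[of 0] by simp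
  have z_cancel: "c = c'" if "c \<in> carrier R" "c' \<in> carrier R" "z \<otimes> c = z \<otimes> c'" for c c'
  proof -
    have "z \<otimes> (c \<ominus> c') = z \<otimes> c \<ominus> z \<otimes> c'" using that(1,2) z_carrier by algebra
    also have "\<dots> = \<zero>" using that z_carrier by (simp add: r_neg minus_eq)
    finally have "c \<ominus> c' = \<zero>" using z_regular that(1,2) by simp
    then show ?thesis using that(1,2) r_right_minus_eq by blast
  qed
  \<comment> \<open>\<open>c m\<close> is m s1 / z. The homomorphism \<open>c\<close> from
    \<open>M\<close> to \<open>R\<close>, followed by \<open>\<epsilon>\<close>, is multiplication
    with some \<open>e1\<close>, which stands for s1/z in \<open>E 0\<close>.\<close>
  define c where "c m = (THE c. c \<in> carrier R \<and> m \<otimes> s1 = z \<otimes> c)" for m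
  have c: "c m \<in> carrier R" "m \<otimes> s1 = z \<otimes> c m" if m: "m \<in> M" for m
  proof -
    obtain c0 where c0: "c0 \<in> carrier R" "m \<otimes> s1 = z \<otimes> c0" using socle(1)[OF m] by (auto simp: PIdl_iff)
    then have "c m = c0" unfolding c_def using z_cancel by (intro the_equality) auto
    then show "c m \<in> carrier R" "m \<otimes> s1 = z \<otimes> c m" using c0 by auto
  qed
  have c_unique: "c m = c0" if "m \<in> M" "c0 \<in> carrier R" "m \<otimes> s1 = z \<otimes> c0" for m c0
    using z_cancel[of "c m" c0] c[OF that(1)] that by simp
  have "\<exists>e\<in>carrier (E 0). \<forall>m\<in>M. \<epsilon> (c m) = m \<odot>\<^bsub>E 0\<^esub> e"
  proof (rule injective_extension[OF is_cring E M])
    fix m assume "m \<in> M" then show "\<epsilon> (c m) \<in> carrier (E 0)" using c \<epsilon>c by simp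
  next
    fix m m' assume m: "m \<in> M" "m' \<in> M"
    note mc = M_carrier[OF m(1)] M_carrier[OF m(2)]
    have "(m \<oplus> m') \<otimes> s1 = m \<otimes> s1 \<oplus> m' \<otimes> s1" using mc s(1) by algebra
    also have "\<dots> = z \<otimes> (c m \<oplus> c m')" using c m z_carrier by (simp add: r_distr)
    finally have "c (m \<oplus> m') = c m \<oplus> c m'"
      using m c M by (intro c_unique) (auto intro: additive_subgroup.a_closed[OF ideal.axioms(1)])
    then show "\<epsilon> (c (m \<oplus> m')) = \<epsilon> (c m) \<oplus>\<^bsub>E 0\<^esub> \<epsilon> (c m')" using \<epsilon>a c m by simp
  next
    fix r m assume r: "r \<in> carrier R" and m: "m \<in> M"
    have "(r \<otimes> m) \<otimes> s1 = r \<otimes> (m \<otimes> s1)" using r M_carrier[OF m] s(1) by algebra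
    also have "\<dots> = r \<otimes> (z \<otimes> c m)" using c(2)[OF m] by simp
    also have "\<dots> = z \<otimes> (r \<otimes> c m)" using c(1)[OF m] r z_carrier by algebra
    finally have "c (r \<otimes> m) = r \<otimes> c m"
      using m r c(1)[OF m] ideal.I_l_closed[OF M m r] by (intro c_unique) auto
    then show "\<epsilon> (c (r \<otimes> m)) = r \<odot>\<^bsub>E 0\<^esub> \<epsilon> (c m)" using \<epsilon>s r c(1)[OF m] by simp
  qed
  then obtain e1 where e1: "e1 \<in> carrier (E 0)" "\<And>m. m \<in> M \<Longrightarrow> m \<odot>\<^bsub>E 0\<^esub> e1 = \<epsilon> (c m)" by force
  have "c z = s1" using c_unique[OF z s(1)] by simp
  then have ze1: "z \<odot>\<^bsub>E 0\<^esub> e1 = \<epsilon> s1" using e1(2)[OF z] by simp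
  let ?w1 = "\<delta> 0 e1"
  have Mw1: "m \<odot>\<^bsub>E 1\<^esub> ?w1 = \<zero>\<^bsub>E 1\<^esub>" if "m \<in> M" for m
    using \<delta>s[OF M_carrier[OF that] e1(1)] e1(2)[OF that] \<delta>\<epsilon>[OF c(1)[OF that]] by simp
  \<comment> \<open>By independence, r s1 in (z, s2) forces \<open>r\<close> into \<open>M\<close>,
    which kills \<open>?w1\<close>; so \<open>s1\<close> may be sent to \<open>?w1\<close> while
    \<open>z\<close> and \<open>s2\<close> go to zero.\<close>
  define A where "A = PIdl z <+>\<^bsub>R\<^esub> PIdl s2"
  have A: "ideal A R" unfolding A_def by (rule add_ideals[OF zI cgenideal_ideal[OF s(2)]])
  have memA: "x \<in> A \<longleftrightarrow> (\<exists>p\<in>carrier R. \<exists>r\<in>carrier R. x = z \<otimes> p \<oplus> r \<otimes> s2)" for x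
    unfolding A_def set_add_def' using PIdl_iff by (auto simp: cgenideal_def)
  have zA: "z \<in> A" unfolding memA using z_carrier s(2) by (intro bexI[of _ \<one>] bexI[of _ \<zero>]) auto
  have sA: "s2 \<in> A" unfolding memA using z_carrier s(2) by (intro bexI[of _ \<zero>] bexI[of _ \<one>]) auto
  have "\<forall>r\<in>carrier R. r \<otimes> s1 \<in> A \<longrightarrow> r \<odot>\<^bsub>E 1\<^esub> ?w1 = \<zero>\<^bsub>E 1\<^esub>"
  proof (intro ballI impI)
    fix r assume r: "r \<in> carrier R" "r \<otimes> s1 \<in> A"
    then obtain p q where pq: "p \<in> carrier R" "q \<in> carrier R" "r \<otimes> s1 = z \<otimes> p \<oplus> q \<otimes> s2" by (auto simp: memA)
    have "r \<otimes> s1 \<oplus> (\<ominus> q) \<otimes> s2 = z \<otimes> p"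
      unfolding pq(3) using pq(1,2) s z_carrier by algebra
    then have "r \<in> M" using indep[of r "\<ominus> q"] r(1) pq(1,2) by (auto simp: PIdl_iff)
    then show "r \<odot>\<^bsub>E 1\<^esub> ?w1 = \<zero>\<^bsub>E 1\<^esub>" by (rule Mw1)
  qed
  moreover have "?w1 \<in> Z 1" unfolding Z1 using e1(1) by (rule imageI)
  ultimately obtain w where w: "w \<in> Z 1" "\<And>a. a \<in> A \<Longrightarrow> a \<odot>\<^bsub>E 1\<^esub> w = \<zero>\<^bsub>E 1\<^esub>" "s1 \<odot>\<^bsub>E 1\<^esub> w = ?w1"
    using baer1 A zA s(1) unfolding cyclic_baer_def by metis
  obtain e where e: "e \<in> carrier (E 0)" "w = \<delta> 0 e" using w(1) unfolding Z1 by blast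
  have ker0D: "\<exists>r\<in>carrier R. x = \<epsilon> r" if "x \<in> carrier (E 0)" "\<delta> 0 x = \<zero>\<^bsub>E 1\<^esub>" for x
    using ker0 that by blast
  \<comment> \<open>\<open>r0\<close> represents z e. The relations below say that, modulo
    \<open>z\<close>, it fixes \<open>s1\<close> and kills \<open>s2\<close>.\<close>
  obtain r0 where r0: "r0 \<in> carrier R" "z \<odot>\<^bsub>E 0\<^esub> e = \<epsilon> r0"
    using ker0D[of "z \<odot>\<^bsub>E 0\<^esub> e"] w(2)[OF zA] e \<delta>s[OF z_carrier e(1)] z_carrier by auto
  have swap: "a \<odot>\<^bsub>E 0\<^esub> (z \<odot>\<^bsub>E 0\<^esub> x) = z \<odot>\<^bsub>E 0\<^esub> (a \<odot>\<^bsub>E 0\<^esub> x)" if "a \<in> carrier R" "x \<in> carrier (E 0)" for a x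
    using that z_carrier m_comm[of a z] by (simp flip: N.smult_assoc1)
  obtain y2 where y2: "y2 \<in> carrier R" "s2 \<odot>\<^bsub>E 0\<^esub> e = \<epsilon> y2"
    using ker0D[of "s2 \<odot>\<^bsub>E 0\<^esub> e"] w(2)[OF sA] e \<delta>s[OF s(2) e(1)] s(2) by auto
  have "\<epsilon> (s2 \<otimes> r0) = \<epsilon> (z \<otimes> y2)"
    using \<epsilon>s[OF s(2) r0(1)] \<epsilon>s[OF z_carrier y2(1)] r0(2) y2(2) swap[OF s(2) e(1)] by simp
  then have eq2: "s2 \<otimes> r0 = z \<otimes> y2"
    using \<epsilon>_inj s(2) r0(1) z_carrier y2(1) by (simp add: inj_on_eq_iff)
  have se: "s1 \<odot>\<^bsub>E 0\<^esub> e \<in> carrier (E 0)" using s(1) e(1) by simp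
  have "\<delta> 0 (s1 \<odot>\<^bsub>E 0\<^esub> e \<ominus>\<^bsub>E 0\<^esub> e1) = ?w1 \<ominus>\<^bsub>E 1\<^esub> ?w1"
    using \<delta>m[OF se e1(1)] \<delta>s[OF s(1) e(1)] w(3) e(2) by simp
  also have "\<dots> = \<zero>\<^bsub>E 1\<^esub>" using N1.M.r_neg[OF \<delta>c[OF e1(1)]] by (simp only: N1.M.minus_eq)
  finally obtain y1 where y1: "y1 \<in> carrier R" "s1 \<odot>\<^bsub>E 0\<^esub> e \<ominus>\<^bsub>E 0\<^esub> e1 = \<epsilon> y1"
    using ker0D[of "s1 \<odot>\<^bsub>E 0\<^esub> e \<ominus>\<^bsub>E 0\<^esub> e1"] se e1(1) by auto
  have "s1 \<odot>\<^bsub>E 0\<^esub> e = e1 \<oplus>\<^bsub>E 0\<^esub> \<epsilon> y1"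
    using y1(2) se e1(1) \<epsilon>c[OF y1(1)] by (metis N.M.minus_eq N.M.add.inv_solve_right' N.M.a_comm)
  then have "s1 \<odot>\<^bsub>E 0\<^esub> \<epsilon> r0 = \<epsilon> s1 \<oplus>\<^bsub>E 0\<^esub> z \<odot>\<^bsub>E 0\<^esub> \<epsilon> y1"
    using swap[OF s(1) e(1)] r0(2) ze1 e1(1) \<epsilon>c[OF y1(1)] z_carrier by (simp add: N.smult_r_distr)
  then have "\<epsilon> (s1 \<otimes> r0) = \<epsilon> (s1 \<oplus> z \<otimes> y1)"
    using \<epsilon>s[OF s(1) r0(1)] \<epsilon>a[OF s(1), of "z \<otimes> y1"] \<epsilon>s[OF z_carrier y1(1)] y1(1) z_carrier by simp
  then have eq1: "s1 \<otimes> r0 = s1 \<oplus> z \<otimes> y1"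
    using \<epsilon>_inj s(1) r0(1) z_carrier y1(1) by (simp add: inj_on_eq_iff)
  \<comment> \<open>If \<open>r0\<close> is in \<open>M\<close>, it kills the socle, so
    \<open>s1\<close> is zero modulo \<open>z\<close>; otherwise r0 s2 is zero modulo
    \<open>z\<close> with \<open>r0\<close> outside \<open>M\<close>. Both contradict
    independence.\<close>
  show False
  proof (cases "r0 \<in> M")
    case True
    have "\<one> \<otimes> s1 \<oplus> \<zero> \<otimes> s2 = s1 \<otimes> r0 \<ominus> z \<otimes> y1"
      unfolding eq1 using s y1(1) z_carrier by algebra
    also have "\<dots> = z \<otimes> (c r0 \<ominus> y1)"
      using c[OF True] s(1) r0(1) y1(1) z_carrier m_comm[of s1 r0] by (simp add: r_distr r_minus minus_eq)
    finally show False using indep[of \<one> \<zero>] one_notin c(1)[OF True] y1(1) by (auto simp: PIdl_iff)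
  next
    case False
    have "\<zero> \<otimes> s1 \<oplus> r0 \<otimes> s2 = z \<otimes> y2" using eq2 s r0(1) z_carrier y2(1) by (simp add: m_comm)
    then show False using indep[of \<zero> r0] False r0(1) y2(1) by (auto simp: PIdl_iff)
  qed
qed

end

section \<open>Localization at a prime ideal\<close>

lemma localization_simps:
  "carrier (localization Q D) = {fraction Q D r s |r s. r \<in> carrier Q \<and> s \<in> D}"
  "\<one>\<^bsub>localization Q D\<^esub> = fraction Q D \<one>\<^bsub>Q\<^esub> \<one>\<^bsub>Q\<^esub>"
  "\<zero>\<^bsub>localization Q D\<^esub> = fraction Q D \<zero>\<^bsub>Q\<^esub> \<one>\<^bsub>Q\<^esub>"
  by (simp_all add: localization_def)

locale prime_localization = Q: cring Q for Q (structure) +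
  fixes P :: "'a set"
  assumes prime: "primeideal P Q"
begin

abbreviation "D \<equiv> carrier Q - P"
abbreviation "frac_at \<equiv> fraction Q D"
abbreviation "L \<equiv> localization Q D"

lemma P_ideal: "ideal P Q"
  using primeideal.axioms(1)[OF prime] .

lemma P_carrier: "p \<in> P \<Longrightarrow> p \<in> carrier Q"
  using ideal.Icarr[OF P_ideal] .

lemma D_one: "\<one> \<in> D"
  using primeideal.I_notcarr[OF prime] ideal.one_imp_carrier[OF P_ideal] by auto

lemma D_mult: "s \<in> D \<Longrightarrow> t \<in> D \<Longrightarrow> s \<otimes> t \<in> D"
  using primeideal.I_prime[OF prime] by auto

lemma frac_mem_iff:
  "(a, t) \<in> frac_at r s \<longleftrightarrow> a \<in> carrier Q \<and> t \<in> D \<and> (\<exists>u\<in>D. u \<otimes> (r \<otimes> t) = u \<otimes> (a \<otimes> s))"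
  by (simp add: fraction_def)

lemma frac_self: "r \<in> carrier Q \<Longrightarrow> s \<in> D \<Longrightarrow> (r, s) \<in> frac_at r s"
  using D_one by (auto simp: frac_mem_iff)

lemma frac_subset:
  assumes r: "r \<in> carrier Q" "s \<in> D" and r': "r' \<in> carrier Q" "s' \<in> D"
    and u: "u \<in> D" "u \<otimes> (r \<otimes> s') = u \<otimes> (r' \<otimes> s)"
  shows "frac_at r' s' \<subseteq> frac_at r s"
proof
  fix x assume "x \<in> frac_at r' s'"
  then obtain a t v where x: "x = (a, t)" "a \<in> carrier Q" "t \<in> D" "v \<in> D" "v \<otimes> (r' \<otimes> t) = v \<otimes> (a \<otimes> s')"
    by (cases x) (auto simp: frac_mem_iff)
  have c: "s \<in> carrier Q" "s' \<in> carrier Q" "t \<in> carrier Q" "u \<in> carrier Q" "v \<in> carrier Q"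
    using r r' x u by auto
  \<comment> \<open>Besides both witnesses, the factor \<open>s'\<close> is needed to eliminate the
    middle fraction.\<close>
  have "(u \<otimes> v \<otimes> s') \<otimes> (r \<otimes> t) = (v \<otimes> t) \<otimes> (u \<otimes> (r \<otimes> s'))" using c r(1) by algebra
  also have "\<dots> = (u \<otimes> s) \<otimes> (v \<otimes> (r' \<otimes> t))" unfolding u(2) using c r'(1) by algebra
  also have "\<dots> = (u \<otimes> v \<otimes> s') \<otimes> (a \<otimes> s)" unfolding x(5) using c x(2) by algebra
  finally have "(u \<otimes> v \<otimes> s') \<otimes> (r \<otimes> t) = (u \<otimes> v \<otimes> s') \<otimes> (a \<otimes> s)" .
  moreover have "u \<otimes> v \<otimes> s' \<in> D" using D_mult u(1) x(4) r'(2) by blast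
  ultimately show "x \<in> frac_at r s" unfolding x(1) frac_mem_iff using x(2,3) by blast
qed

lemma frac_eqI:
  assumes r: "r \<in> carrier Q" "s \<in> D" and r': "r' \<in> carrier Q" "s' \<in> D"
    and u: "u \<in> D" "u \<otimes> (r \<otimes> s') = u \<otimes> (r' \<otimes> s)"
  shows "frac_at r s = frac_at r' s'"
  using frac_subset[OF r r' u] frac_subset[OF r' r u(1) u(2)[symmetric]] by blast

lemma frac_eqD:
  assumes "frac_at r s = frac_at r' s'" "r' \<in> carrier Q" "s' \<in> D"
  shows "\<exists>u\<in>D. u \<otimes> (r \<otimes> s') = u \<otimes> (r' \<otimes> s)"
  using frac_self[OF assms(2,3)] unfolding assms(1)[symmetric] frac_mem_iff by blast

lemma frac_mult:
  assumes a: "a \<in> carrier Q" "s \<in> D" and b: "b \<in> carrier Q" "t \<in> D"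
  shows "frac_at a s \<otimes>\<^bsub>L\<^esub> frac_at b t = frac_at (a \<otimes> b) (s \<otimes> t)"
proof -
  have eq: "frac_at (a' \<otimes> b') (s' \<otimes> t') = frac_at (a \<otimes> b) (s \<otimes> t)"
    if "(a', s') \<in> frac_at a s" "(b', t') \<in> frac_at b t" for a' s' b' t'
  proof -
    obtain u v where u: "a' \<in> carrier Q" "s' \<in> D" "u \<in> D" "u \<otimes> (a \<otimes> s') = u \<otimes> (a' \<otimes> s)"
      and v: "b' \<in> carrier Q" "t' \<in> D" "v \<in> D" "v \<otimes> (b \<otimes> t') = v \<otimes> (b' \<otimes> t)"
      using \<open>(a', s') \<in> frac_at a s\<close> \<open>(b', t') \<in> frac_at b t\<close> by (auto simp: frac_mem_iff)
    have c: "s \<in> carrier Q" "t \<in> carrier Q" "s' \<in> carrier Q" "t' \<in> carrier Q" "u \<in> carrier Q" "v \<in> carrier Q"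
      using a b u v by auto
    have "(u \<otimes> v) \<otimes> ((a' \<otimes> b') \<otimes> (s \<otimes> t)) = (u \<otimes> (a' \<otimes> s)) \<otimes> (v \<otimes> (b' \<otimes> t))"
      using c u(1) v(1) by algebra
    also have "\<dots> = (u \<otimes> v) \<otimes> ((a \<otimes> b) \<otimes> (s' \<otimes> t'))"
      unfolding u(4)[symmetric] v(4)[symmetric] using c a(1) b(1) by algebra
    finally show ?thesis
      using a b u v by (intro frac_eqI[of _ _ _ _ "u \<otimes> v"] D_mult) auto
  qed
  have "frac_at a s \<otimes>\<^bsub>L\<^esub> frac_at b t = (\<Union>(a', s') \<in> frac_at a s. \<Union>(b', t') \<in> frac_at b t. frac_at (a' \<otimes> b') (s' \<otimes> t'))"
    by (simp add: localization_def)
  also have "\<dots> = frac_at (a \<otimes> b) (s \<otimes> t)"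
    using eq frac_self[OF a] frac_self[OF b] by fast
  finally show ?thesis .
qed

lemma frac_add:
  assumes a: "a \<in> carrier Q" "s \<in> D" and b: "b \<in> carrier Q" "t \<in> D"
  shows "frac_at a s \<oplus>\<^bsub>L\<^esub> frac_at b t = frac_at (a \<otimes> t \<oplus> b \<otimes> s) (s \<otimes> t)"
proof -
  have eq: "frac_at (a' \<otimes> t' \<oplus> b' \<otimes> s') (s' \<otimes> t') = frac_at (a \<otimes> t \<oplus> b \<otimes> s) (s \<otimes> t)"
    if "(a', s') \<in> frac_at a s" "(b', t') \<in> frac_at b t" for a' s' b' t'
  proof -
    obtain u v where u: "a' \<in> carrier Q" "s' \<in> D" "u \<in> D" "u \<otimes> (a \<otimes> s') = u \<otimes> (a' \<otimes> s)"
      and v: "b' \<in> carrier Q" "t' \<in> D" "v \<in> D" "v \<otimes> (b \<otimes> t') = v \<otimes> (b' \<otimes> t)"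
      using \<open>(a', s') \<in> frac_at a s\<close> \<open>(b', t') \<in> frac_at b t\<close> by (auto simp: frac_mem_iff)
    have c: "s \<in> carrier Q" "t \<in> carrier Q" "s' \<in> carrier Q" "t' \<in> carrier Q" "u \<in> carrier Q" "v \<in> carrier Q"
      using a b u v by auto
    have "(u \<otimes> v) \<otimes> ((a' \<otimes> t' \<oplus> b' \<otimes> s') \<otimes> (s \<otimes> t)) =
        (u \<otimes> (a' \<otimes> s)) \<otimes> (v \<otimes> t \<otimes> t') \<oplus> (v \<otimes> (b' \<otimes> t)) \<otimes> (u \<otimes> s \<otimes> s')"
      using c u(1) v(1) by algebra
    also have "\<dots> = (u \<otimes> v) \<otimes> ((a \<otimes> t \<oplus> b \<otimes> s) \<otimes> (s' \<otimes> t'))"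
      unfolding u(4)[symmetric] v(4)[symmetric] using c a(1) b(1) by algebra
    finally show ?thesis
      using a b u v by (intro frac_eqI[of _ _ _ _ "u \<otimes> v"] D_mult) auto
  qed
  have "frac_at a s \<oplus>\<^bsub>L\<^esub> frac_at b t =
      (\<Union>(a', s') \<in> frac_at a s. \<Union>(b', t') \<in> frac_at b t. frac_at (a' \<otimes> t' \<oplus> b' \<otimes> s') (s' \<otimes> t'))"
    by (simp add: localization_def)
  also have "\<dots> = frac_at (a \<otimes> t \<oplus> b \<otimes> s) (s \<otimes> t)"
    using eq frac_self[OF a] frac_self[OF b] by fast
  finally show ?thesis .
qed

lemma frac_carrier: "a \<in> carrier Q \<Longrightarrow> s \<in> D \<Longrightarrow> frac_at a s \<in> carrier L"
  by (auto simp: localization_simps)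

lemma L_cases:
  assumes "x \<in> carrier L" obtains a s where "a \<in> carrier Q" "s \<in> D" "x = frac_at a s"
  using assms by (auto simp: localization_simps)

lemma frac_denominator:
  assumes "a \<in> carrier Q" "s \<in> D"
  shows "frac_at a s = frac_at \<one> s \<otimes>\<^bsub>L\<^esub> frac_at a \<one>" "frac_at a \<one> = frac_at s \<one> \<otimes>\<^bsub>L\<^esub> frac_at a s"
proof -
  show "frac_at a s = frac_at \<one> s \<otimes>\<^bsub>L\<^esub> frac_at a \<one>" using assms D_one by (simp add: frac_mult)
  have "frac_at (s \<otimes> a) (\<one> \<otimes> s) = frac_at a \<one>"
    using assms D_one by (intro frac_eqI[of _ _ _ _ \<one>]) (auto simp: Q.m_comm)
  then show "frac_at a \<one> = frac_at s \<one> \<otimes>\<^bsub>L\<^esub> frac_at a s" using assms D_one by (simp add: frac_mult)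
qed

lemma frac_one_add:
  assumes "a \<in> carrier Q" "b \<in> carrier Q"
  shows "frac_at (a \<oplus> b) \<one> = frac_at a \<one> \<oplus>\<^bsub>L\<^esub> frac_at b \<one>"
  using assms D_one by (simp add: frac_add)

lemma frac_one_mult:
  assumes "a \<in> carrier Q" "b \<in> carrier Q"
  shows "frac_at (a \<otimes> b) \<one> = frac_at a \<one> \<otimes>\<^bsub>L\<^esub> frac_at b \<one>"
  using assms D_one by (simp add: frac_mult)

section \<open>Ideals of the localization and the clearing of denominators\<close>

context
  fixes l :: 'a
  assumes L_cring: "cring L" and noeth_Q: "noetherian_ring Q"
    and l: "l \<in> P" and l_regular: "\<And>a. a \<in> carrier Q \<Longrightarrow> l \<otimes> a = \<zero> \<Longrightarrow> a = \<zero>"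
    and nil_Q: "\<And>B. ideal B Q \<Longrightarrow> l \<in> B \<Longrightarrow> B \<noteq> carrier Q \<Longrightarrow> \<exists>b\<in>carrier Q - B. \<forall>m\<in>P. m \<otimes> b \<in> B"
begin

definition "max_L = {frac_at r s |r s. r \<in> P \<and> s \<in> D}"

text \<open>The contraction of \<open>A\<close> along Q -> L.\<close>

definition "pull A = {a \<in> carrier Q. frac_at a \<one> \<in> A}"

lemma frac_mem_ideal_iff:
  assumes A: "ideal A L" and a: "a \<in> carrier Q" "s \<in> D"
  shows "frac_at a s \<in> A \<longleftrightarrow> a \<in> pull A"
proof
  assume "frac_at a s \<in> A"
  then have "frac_at s \<one> \<otimes>\<^bsub>L\<^esub> frac_at a s \<in> A"
    using ideal.I_l_closed[OF A] frac_carrier[of s \<one>] a D_one by simp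
  then show "a \<in> pull A" using frac_denominator(2)[OF a] a by (simp add: pull_def)
next
  assume "a \<in> pull A"
  then have "frac_at \<one> s \<otimes>\<^bsub>L\<^esub> frac_at a \<one> \<in> A"
    using ideal.I_l_closed[OF A] frac_carrier[of \<one> s] a by (simp add: pull_def)
  then show "frac_at a s \<in> A" using frac_denominator(1)[OF a] by simp
qed

lemma ideal_pull:
  assumes A: "ideal A L" shows "ideal (pull A) Q"
proof (rule idealI)
  interpret L: cring L by (rule L_cring)
  interpret A: ideal A L by fact
  have mult: "x \<otimes> a \<in> pull A" if "a \<in> pull A" "x \<in> carrier Q" for a x
    using that frac_one_mult[of x a] A.I_l_closed[of "frac_at a \<one>" "frac_at x \<one>"] frac_carrier[of x \<one>] D_one
    by (auto simp: pull_def)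
  then show "x \<otimes> a \<in> pull A" if "a \<in> pull A" "x \<in> carrier Q" for a x using that by blast
  show "a \<otimes> x \<in> pull A" if "a \<in> pull A" "x \<in> carrier Q" for a x
    using mult[OF that] that Q.m_comm[of a x] by (auto simp: pull_def)
  show "ring Q" ..
  show "subgroup (pull A) (add_monoid Q)"
  proof (rule Q.add.subgroupI)
    fix a assume a: "a \<in> pull A"
    then have "(\<ominus> \<one>) \<otimes> a \<in> pull A" by (intro mult) auto
    then show "\<ominus> a \<in> pull A" using a by (simp add: pull_def Q.l_minus)
  next
    have "\<zero> \<in> pull A" using A.zero_closed by (simp add: pull_def localization_simps)
    then show "pull A \<noteq> {}" by blast
  next
    fix a b assume "a \<in> pull A" "b \<in> pull A"
    then show "a \<oplus> b \<in> pull A" using frac_one_add[of a b] A.a_closed by (auto simp: pull_def)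
  qed (auto simp: pull_def)
qed

text \<open>Each fraction is a unit multiple of its numerator, so an ideal of \<open>L\<close> is
  determined by its contraction.\<close>

lemma pull_subset_iff:
  assumes A: "ideal A L" and B: "ideal B L"
  shows "pull A \<subseteq> pull B \<longleftrightarrow> A \<subseteq> B"
proof
  assume *: "pull A \<subseteq> pull B"
  show "A \<subseteq> B"
  proof
    fix x assume x: "x \<in> A"
    then have "x \<in> carrier L" using ideal.Icarr[OF A] by blast
    then obtain a s where "a \<in> carrier Q" "s \<in> D" "x = frac_at a s" by (rule L_cases)
    then show "x \<in> B" using x frac_mem_ideal_iff[OF A] frac_mem_ideal_iff[OF B] * by blast
  qed
qed (auto simp: pull_def)

text \<open>Contraction embeds the ideals of \<open>L\<close> into those of \<open>Q\<close>, where
  nonempty chains contain their union; Zorn's lemma on the contractions yields the maximal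
  member.\<close>

lemma noetherian_maximal:
  assumes F: "F \<noteq> {}" "\<And>A. A \<in> F \<Longrightarrow> ideal A L"
  shows "\<exists>A\<in>F. \<forall>B\<in>F. A \<subseteq> B \<longrightarrow> A = B"
proof -
  have "\<exists>A\<in>pull ` F. \<forall>B\<in>pull ` F. A \<subseteq> B \<longrightarrow> B = A"
  proof (rule subset_Zorn_nonempty)
    fix C assume C: "C \<noteq> {}" "subset.chain (pull ` F) C"
    then have "subset.chain {I. ideal I Q} C"
      using ideal_pull F(2) by (auto simp: subset.chain_def)
    then have "\<Union>C \<in> C" using noetherian_ring.ideal_chain_is_trivial[OF noeth_Q C(1)] by blast
    then show "\<Union>C \<in> pull ` F" using C(2) by (auto simp: subset.chain_def)
  qed (use F(1) in simp)
  then obtain A where A: "A \<in> F" "\<And>B. B \<in> F \<Longrightarrow> pull A \<subseteq> pull B \<Longrightarrow> pull B = pull A" by blast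
  have "A = B" if B: "B \<in> F" "A \<subseteq> B" for B
  proof -
    have "pull B = pull A" using A(2)[OF B(1)] B(2) pull_subset_iff[of A B] F(2) A(1) B(1) by blast
    then have "B \<subseteq> A" using pull_subset_iff[of B A] F(2) A(1) B(1) by blast
    with B(2) show ?thesis by blast
  qed
  with A(1) show ?thesis by blast
qed

lemma frac_eq_zero_iff:
  assumes "a \<in> carrier Q" "s \<in> D"
  shows "frac_at a s = \<zero>\<^bsub>L\<^esub> \<longleftrightarrow> (\<exists>u\<in>D. u \<otimes> a = \<zero>)"
proof
  assume "frac_at a s = \<zero>\<^bsub>L\<^esub>"
  then obtain u where "u \<in> D" "u \<otimes> (a \<otimes> \<one>) = u \<otimes> (\<zero> \<otimes> s)"
    using frac_eqD[of a s \<zero> \<one>] D_one by (auto simp: localization_simps)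
  then show "\<exists>u\<in>D. u \<otimes> a = \<zero>" using assms by auto
next
  assume "\<exists>u\<in>D. u \<otimes> a = \<zero>"
  then obtain u where u: "u \<in> D" "u \<otimes> a = \<zero>" by blast
  then have "u \<otimes> (a \<otimes> \<one>) = u \<otimes> (\<zero> \<otimes> s)" using assms by simp
  then show "frac_at a s = \<zero>\<^bsub>L\<^esub>"
    unfolding localization_simps by (intro frac_eqI[OF assms _ D_one u(1)]) auto
qed

lemma max_L_frac_iff:
  assumes "a \<in> carrier Q" "s \<in> D" shows "frac_at a s \<in> max_L \<longleftrightarrow> a \<in> P"
proof
  assume "frac_at a s \<in> max_L"
  then obtain r t where rt: "r \<in> P" "t \<in> D" "frac_at a s = frac_at r t" by (auto simp: max_L_def)
  then obtain u where u: "u \<in> D" "u \<otimes> (a \<otimes> t) = u \<otimes> (r \<otimes> s)" using frac_eqD P_carrier by blast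
  have "r \<otimes> s \<in> P" using ideal.I_r_closed[OF P_ideal rt(1)] assms by simp
  then have "u \<otimes> (r \<otimes> s) \<in> P" using ideal.I_l_closed[OF P_ideal] u(1) by simp
  then have "u \<otimes> (a \<otimes> t) \<in> P" using u(2) by simp
  then show "a \<in> P" using primeideal.I_prime[OF prime] u(1) rt(2) assms
    by (metis DiffD1 DiffD2 Q.m_closed)
qed (use assms in \<open>auto simp: max_L_def\<close>)

lemma ideal_max_L: "ideal max_L L"
proof (rule idealI)
  interpret L: cring L by (rule L_cring)
  have carr: "max_L \<subseteq> carrier L" using P_carrier by (auto simp: max_L_def localization_simps)
  have mult: "x \<otimes>\<^bsub>L\<^esub> a \<in> max_L" if a: "a \<in> max_L" and x: "x \<in> carrier L" for a x
  proof -
    obtain r s where rs: "r \<in> P" "s \<in> D" "a = frac_at r s" using a by (auto simp: max_L_def)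
    obtain b t where bt: "b \<in> carrier Q" "t \<in> D" "x = frac_at b t" using x by (rule L_cases)
    have "b \<otimes> r \<in> P" using ideal.I_l_closed[OF P_ideal rs(1) bt(1)] .
    then show ?thesis unfolding rs(3) bt(3) frac_mult[OF bt(1,2) P_carrier[OF rs(1)] rs(2)]
      using D_mult[OF bt(2) rs(2)] unfolding max_L_def by blast
  qed
  then show "x \<otimes>\<^bsub>L\<^esub> a \<in> max_L" if "a \<in> max_L" "x \<in> carrier L" for a x using that by blast
  show "a \<otimes>\<^bsub>L\<^esub> x \<in> max_L" if "a \<in> max_L" "x \<in> carrier L" for a x
    using mult[OF that] that carr L.m_comm[of a x] by auto
  show "ring L" ..
  show "subgroup max_L (add_monoid L)"
  proof (rule L.add.subgroupI)
    show "max_L \<subseteq> carrier L" by (rule carr)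
    fix a assume a: "a \<in> max_L"
    then have "(\<ominus>\<^bsub>L\<^esub> \<one>\<^bsub>L\<^esub>) \<otimes>\<^bsub>L\<^esub> a \<in> max_L" by (intro mult) auto
    then show "\<ominus>\<^bsub>L\<^esub> a \<in> max_L" using a carr by (auto simp: L.l_minus)
  next
    have "frac_at \<zero> \<one> \<in> max_L"
      using additive_subgroup.zero_closed[OF ideal.axioms(1)[OF P_ideal]] D_one by (auto simp: max_L_def)
    then show "max_L \<noteq> {}" by blast
  next
    fix a b assume "a \<in> max_L" "b \<in> max_L"
    then obtain r s r' s' where *: "r \<in> P" "s \<in> D" "a = frac_at r s" "r' \<in> P" "s' \<in> D" "b = frac_at r' s'"
      by (auto simp: max_L_def)
    have "r \<otimes> s' \<oplus> r' \<otimes> s \<in> P"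
      using * by (intro additive_subgroup.a_closed[OF ideal.axioms(1)[OF P_ideal]] ideal.I_r_closed[OF P_ideal]) auto
    then show "a \<oplus>\<^bsub>L\<^esub> b \<in> max_L"
      unfolding *(3,6) frac_add[OF P_carrier[OF *(1)] *(2) P_carrier[OF *(4)] *(5)]
      using D_mult[OF *(2,5)] unfolding max_L_def by blast
  qed
qed

lemma local_parameter_localization: "local_parameter L max_L (frac_at l \<one>)"
proof (intro local_parameter.intro local_parameter_axioms.intro)
  interpret L: cring L by (rule L_cring)
  have lc: "l \<in> carrier Q" using l by (rule P_carrier)
  show "cring L" by (rule L_cring)
  show "ideal max_L L" by (rule ideal_max_L)
  show "\<one>\<^bsub>L\<^esub> \<notin> max_L" using max_L_frac_iff[of \<one> \<one>] D_one by (auto simp: localization_simps)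
  show "frac_at l \<one> \<in> max_L" using max_L_frac_iff[of l \<one>] l lc D_one by auto
  show "r \<in> Units L" if r: "r \<in> carrier L" "r \<notin> max_L" for r
  proof -
    obtain a s where as: "a \<in> carrier Q" "s \<in> D" "r = frac_at a s" using r(1) by (rule L_cases)
    have aD: "a \<in> D" using r(2) as max_L_frac_iff by auto
    have "frac_at s a \<otimes>\<^bsub>L\<^esub> r = \<one>\<^bsub>L\<^esub>"
    proof -
      have sa: "s \<in> carrier Q" "a \<in> carrier Q" using as by auto
      have "\<one> \<otimes> ((s \<otimes> a) \<otimes> \<one>) = \<one> \<otimes> (\<one> \<otimes> (a \<otimes> s))" using sa by algebra
      then have "frac_at (s \<otimes> a) (a \<otimes> s) = frac_at \<one> \<one>"
        using sa D_mult[OF aD as(2)] D_one by (intro frac_eqI[OF _ _ _ D_one D_one]) auto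
      then show ?thesis unfolding as(3) localization_simps using sa as(2) aD by (simp add: frac_mult)
    qed
    moreover have "frac_at s a \<in> carrier L" using as aD by (intro frac_carrier) auto
    ultimately show ?thesis using r(1) L.m_comm[of r "frac_at s a"] unfolding Units_def by auto
  qed
  show "a = \<zero>\<^bsub>L\<^esub>" if a: "a \<in> carrier L" "frac_at l \<one> \<otimes>\<^bsub>L\<^esub> a = \<zero>\<^bsub>L\<^esub>" for a
  proof -
    obtain b s where bs: "b \<in> carrier Q" "s \<in> D" "a = frac_at b s" using a(1) by (rule L_cases)
    have "frac_at (l \<otimes> b) (\<one> \<otimes> s) = \<zero>\<^bsub>L\<^esub>" using a(2) bs lc D_one by (simp add: frac_mult)
    then obtain u where u: "u \<in> D" "u \<otimes> (l \<otimes> b) = \<zero>"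
      using frac_eq_zero_iff[of "l \<otimes> b" "\<one> \<otimes> s"] bs lc D_one D_mult by auto
    then have "l \<otimes> (u \<otimes> b) = \<zero>" using bs lc by (simp add: Q.m_lcomm)
    then have "u \<otimes> b = \<zero>" using l_regular u(1) bs(1) by simp
    then show ?thesis unfolding bs(3) using frac_eq_zero_iff bs u(1) by blast
  qed
  show "\<exists>A\<in>F. \<forall>B\<in>F. A \<subseteq> B \<longrightarrow> A = B" if "F \<noteq> {}" "\<And>A. A \<in> F \<Longrightarrow> ideal A L" for F
    using noetherian_maximal that by blast
  show "\<exists>b\<in>carrier L - A. \<forall>m\<in>max_L. m \<otimes>\<^bsub>L\<^esub> b \<in> A"
    if A: "ideal A L" "frac_at l \<one> \<in> A" "A \<noteq> carrier L" for A
  proof -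
    have "\<one>\<^bsub>L\<^esub> \<notin> A" using ideal.one_imp_carrier[OF A(1)] A(3) by blast
    then have "\<one> \<notin> pull A" by (simp add: pull_def localization_simps)
    then have "pull A \<noteq> carrier Q" by auto
    moreover have "l \<in> pull A" using A(2) lc by (simp add: pull_def)
    \<comment> \<open>\<open>nil_Q\<close> applies to the contraction, which is proper and contains
      \<open>l\<close>; the fraction b/1 inherits the property.\<close>
    ultimately obtain b where b: "b \<in> carrier Q" "b \<notin> pull A" "\<And>m. m \<in> P \<Longrightarrow> m \<otimes> b \<in> pull A"
      using nil_Q[OF ideal_pull[OF A(1)]] by blast
    have "m \<otimes>\<^bsub>L\<^esub> frac_at b \<one> \<in> A" if m: "m \<in> max_L" for m
    proof -
      obtain r s where rs: "r \<in> P" "s \<in> D" "m = frac_at r s" using m by (auto simp: max_L_def)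
      have "m \<otimes>\<^bsub>L\<^esub> frac_at b \<one> = frac_at (r \<otimes> b) (s \<otimes> \<one>)"
        unfolding rs(3) using rs P_carrier b(1) D_one by (simp add: frac_mult)
      then show ?thesis
        using frac_mem_ideal_iff[OF A(1), of "r \<otimes> b" "s \<otimes> \<one>"] b rs P_carrier D_mult[OF _ D_one] by auto
    qed
    moreover have "frac_at b \<one> \<in> carrier L - A"
      using b frac_carrier D_one by (auto simp: pull_def)
    ultimately show ?thesis by blast
  qed
qed

text \<open>Clears denominators in the relation over \<open>L\<close>. They lie outside the prime
  \<open>P\<close>, so a coefficient outside \<open>P\<close> remains outside.\<close>

theorem socle_dependent_localization:
  assumes inj_dim: "finite_self_injective_dimension L"
    and s: "s1 \<in> carrier Q" "s2 \<in> carrier Q"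
    and socle: "\<And>m. m \<in> P \<Longrightarrow> m \<otimes> s1 \<in> PIdl l" "\<And>m. m \<in> P \<Longrightarrow> m \<otimes> s2 \<in> PIdl l"
  shows "\<exists>a\<in>carrier Q. \<exists>b\<in>carrier Q. (a \<notin> P \<or> b \<notin> P) \<and> a \<otimes> s1 \<oplus> b \<otimes> s2 \<in> PIdl l"
proof -
  interpret LP: local_parameter L max_L "frac_at l \<one>" by (rule local_parameter_localization)
  have lc: "l \<in> carrier Q" using l by (rule P_carrier)
  have socle_L: "m \<otimes>\<^bsub>L\<^esub> frac_at x \<one> \<in> PIdl\<^bsub>L\<^esub> (frac_at l \<one>)"
    if x: "x \<in> carrier Q" "\<And>m. m \<in> P \<Longrightarrow> m \<otimes> x \<in> PIdl l" and m: "m \<in> max_L" for x m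
  proof -
    obtain r t where rt: "r \<in> P" "t \<in> D" "m = frac_at r t" using m by (auto simp: max_L_def)
    obtain c where c: "c \<in> carrier Q" "r \<otimes> x = c \<otimes> l" using x(2)[OF rt(1)] by (auto simp: cgenideal_def)
    have "m \<otimes>\<^bsub>L\<^esub> frac_at x \<one> = frac_at (c \<otimes> l) (t \<otimes> \<one>)"
      unfolding rt(3) using rt P_carrier x(1) D_one c(2) by (simp add: frac_mult)
    also have "\<dots> = frac_at c t \<otimes>\<^bsub>L\<^esub> frac_at l \<one>" using c(1) rt(2) lc D_one by (simp add: frac_mult)
    finally show ?thesis using frac_carrier[OF c(1) rt(2)] by (auto simp: cgenideal_def)
  qed
  have c1: "frac_at s1 \<one> \<in> carrier L" "frac_at s2 \<one> \<in> carrier L" using s D_one frac_carrier by auto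
  obtain a b where ab: "a \<in> carrier L" "b \<in> carrier L" "a \<notin> max_L \<or> b \<notin> max_L"
    "a \<otimes>\<^bsub>L\<^esub> frac_at s1 \<one> \<oplus>\<^bsub>L\<^esub> b \<otimes>\<^bsub>L\<^esub> frac_at s2 \<one> \<in> PIdl\<^bsub>L\<^esub> (frac_at l \<one>)"
    using LP.socle_dependent[OF inj_dim c1 socle_L socle_L] s socle by blast
  obtain p t where pt: "p \<in> carrier Q" "t \<in> D" "a = frac_at p t" using ab(1) by (rule L_cases)
  obtain p' t' where pt': "p' \<in> carrier Q" "t' \<in> D" "b = frac_at p' t'" using ab(2) by (rule L_cases)
  obtain x where x: "x \<in> carrier L"
      "a \<otimes>\<^bsub>L\<^esub> frac_at s1 \<one> \<oplus>\<^bsub>L\<^esub> b \<otimes>\<^bsub>L\<^esub> frac_at s2 \<one> = x \<otimes>\<^bsub>L\<^esub> frac_at l \<one>"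
    using ab(4) by (auto simp: cgenideal_def)
  obtain c w where cw: "c \<in> carrier Q" "w \<in> D" "x = frac_at c w" using x(1) by (rule L_cases)
  have tc: "t \<in> carrier Q" "t' \<in> carrier Q" "w \<in> carrier Q" using pt pt' cw by auto
  have "frac_at ((p \<otimes> s1) \<otimes> t' \<oplus> (p' \<otimes> s2) \<otimes> t) (t \<otimes> t') = frac_at (c \<otimes> l) w"
    using x(2) unfolding pt(3) pt'(3) cw(3)
    using pt pt' cw s lc D_one tc by (simp add: frac_mult frac_add)
  then obtain u where u: "u \<in> D"
    "u \<otimes> (((p \<otimes> s1) \<otimes> t' \<oplus> (p' \<otimes> s2) \<otimes> t) \<otimes> w) = u \<otimes> ((c \<otimes> l) \<otimes> (t \<otimes> t'))"
    using frac_eqD cw lc by (metis Q.m_closed)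
  have uc: "u \<in> carrier Q" using u(1) by simp
  let ?a = "u \<otimes> (p \<otimes> (t' \<otimes> w))" and ?b = "u \<otimes> (p' \<otimes> (t \<otimes> w))"
  have "?a \<otimes> s1 \<oplus> ?b \<otimes> s2 = u \<otimes> (((p \<otimes> s1) \<otimes> t' \<oplus> (p' \<otimes> s2) \<otimes> t) \<otimes> w)"
    using uc tc s pt(1) pt'(1) by algebra
  also have "\<dots> = (u \<otimes> c \<otimes> (t \<otimes> t')) \<otimes> l" unfolding u(2) using uc tc cw(1) lc by algebra
  finally have "?a \<otimes> s1 \<oplus> ?b \<otimes> s2 \<in> PIdl l" using uc tc cw(1) by (auto simp: cgenideal_def)
  moreover have "?a \<notin> P \<or> ?b \<notin> P"
  proof -
    have "p \<notin> P \<or> p' \<notin> P" using ab(3) pt pt' max_L_frac_iff by blast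
    then have "p \<in> D \<or> p' \<in> D" using pt(1) pt'(1) by blast
    then have "?a \<in> D \<or> ?b \<in> D" using D_mult u(1) pt(2) pt'(2) cw(2) by metis
    then show ?thesis by blast
  qed
  moreover have "?a \<in> carrier Q" "?b \<in> carrier Q" using uc tc pt(1) pt'(1) by auto
  ultimately show ?thesis by blast
qed

end

end

section \<open>The main theorem\<close>

lemma minus_constant_term_max_ideal:
  assumes "x \<in> polys n" shows "x - mpoly_const (lookup x 0) \<in> max_ideal n"
proof -
  have "lookup (mpoly_const c) 0 = c" for c :: 'a by (simp add: mpoly_const_def)
  then show ?thesis using assms by (simp add: max_ideal_def lookup_minus)
qed

text \<open>Localized at the irrelevant ideal, S/I yields a relation with coefficients in S, one of
  which has nonzero constant term. Their parts without constant term kill the socle, so the constant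
  terms alone give the dependence.\<close>

lemma gorenstein_socle:
  fixes I :: "'k::field mpoly set"
  assumes gor: "gorenstein_ring (mpoly_ring n Quot I)" and I: "homogeneous_ideal n I" and one: "1 \<notin> I"
    and z: "z \<in> homogeneous_part n 1" "nonzerodivisor n z I"
    and top: "\<And>p. a < p \<Longrightarrow> homogeneous_part n p \<subseteq> adjoin n I z"
  shows "socle_le_1 n (adjoin n I z)"
proof -
  define S where "S = (mpoly_ring n :: 'k mpoly ring)"
  define Q where "Q = S Quot I"
  define \<pi> where "\<pi> x = I +>\<^bsub>S\<^esub> x" for x
  note Ii = homogeneous_ideal_is_ideal[OF I]
  have Iid: "ideal I S" using Ii by (simp add: ideal_iff_is_ideal S_def)
  have carrS: "carrier S = polys n" by (simp add: S_def)
  have \<pi>_hom: "\<pi> \<in> ring_hom S Q"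
    unfolding \<pi>_def Q_def using ideal.rcos_ring_hom[OF Iid] by simp
  have carrQ: "carrier Q = \<pi> ` polys n"
    unfolding Q_def \<pi>_def S_def by (auto simp: FactRing_def A_RCOSETS_def')
  have \<pi>c: "\<pi> x \<in> carrier Q" if "x \<in> polys n" for x using that carrQ by blast
  have \<pi>m: "\<pi> (x * y) = \<pi> x \<otimes>\<^bsub>Q\<^esub> \<pi> y" and \<pi>a: "\<pi> (x + y) = \<pi> x \<oplus>\<^bsub>Q\<^esub> \<pi> y"
    if "x \<in> polys n" "y \<in> polys n" for x y
    using ring_hom_mult[OF \<pi>_hom, of x y] ring_hom_add[OF \<pi>_hom, of x y] that by (simp_all add: S_def)
  have \<pi>1: "\<pi> 1 = \<one>\<^bsub>Q\<^esub>" using ring_hom_one[OF \<pi>_hom] by (simp add: S_def)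
  have \<pi>_eq: "\<pi> x = \<pi> y \<longleftrightarrow> x - y \<in> I" if "x \<in> polys n" "y \<in> polys n" for x y
    using mpoly.quotient_eq_iff_same_a_r_cos[of I n x y] Iid that by (simp add: \<pi>_def S_def)
  have Q0: "\<zero>\<^bsub>Q\<^esub> = \<pi> 0"
    using mpoly.a_rcos_zero[of I n 0] Iid idlD(2)[OF Ii] by (simp add: Q_def \<pi>_def S_def)
  have zp: "z \<in> polys n" using z(1) by simp
  \<comment> \<open>The component of degree 0 of a member is its constant term, and a nonzero
    constant in \<open>I\<close> would make \<open>I\<close> the unit ideal.\<close>
  have I_max_ideal: "I \<subseteq> max_ideal n"
  proof
    fix x assume x: "x \<in> I"
    then have xp: "x \<in> polys n" using idlD(1)[OF Ii] by blast
    have "hcomp 0 x \<in> I" using homogeneous_ideal_hcomp[OF I x] .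
    moreover have "hcomp 0 x = mpoly_const (lookup x 0) * 1"
      by (intro poly_mapping_eqI) (auto simp: lookup_hcomp mpoly_const_def lookup_single when_def total_deg_eq_0_iff)
    ultimately have "lookup x 0 = 0" using const_mult_mem_iff[OF Ii, of 1 "lookup x 0"] one by auto
    then show "x \<in> max_ideal n" using xp by (simp add: max_ideal_def)
  qed
  define P where "P = \<pi> ` max_ideal n"
  have memP: "\<pi> x \<in> P \<longleftrightarrow> x \<in> max_ideal n" if x: "x \<in> polys n" for x
  proof
    assume "\<pi> x \<in> P"
    then obtain y where y: "y \<in> max_ideal n" "\<pi> x = \<pi> y" by (auto simp: P_def)
    then have "x - y \<in> max_ideal n" using \<pi>_eq[OF x, of y] I_max_ideal by (auto simp: max_ideal_polys)
    then show "x \<in> max_ideal n" using idlD(3)[OF is_ideal_max_ideal, of "x - y" n y] y(1) by simp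
  qed (auto simp: P_def)
  interpret Q: cring Q using gor by (simp add: gorenstein_ring_def Q_def S_def)
  have Pid: "ideal P Q"
  proof -
    have "ideal (\<pi> ` max_ideal n) Q"
      unfolding \<pi>_def Q_def S_def
      by (rule mpoly.ring_ideal_imp_quot_ideal) (use Iid is_ideal_max_ideal in \<open>auto simp: S_def ideal_iff_is_ideal\<close>)
    then show ?thesis by (simp add: P_def)
  qed
  have max: "maximalideal P Q"
  proof (rule maximalidealI[OF Pid])
    have "\<pi> 1 \<notin> P" using memP[of 1] by (simp add: max_ideal_def)
    then show "carrier Q \<noteq> P" using \<pi>c[of 1] by auto
    fix B assume B: "ideal B Q" "P \<subseteq> B" "B \<subseteq> carrier Q"
    show "B = P \<or> B = carrier Q"
    proof (cases "B \<subseteq> P")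
      case False
      then obtain q where q: "q \<in> B" "q \<notin> P" by blast
      then have "q \<in> \<pi> ` polys n" using B(3) unfolding carrQ by blast
      then obtain x where x: "x \<in> polys n" "\<pi> x \<in> B" "\<pi> x \<notin> P" using q by blast
      \<comment> \<open>With constant term \<open>c\<close>, 1 = x/c - (x - c)/c, and x - c is in
        the irrelevant ideal, so \<open>B\<close> contains 1.\<close>
      define c where "c = lookup x 0"
      have "c \<noteq> 0" using x memP by (auto simp: c_def max_ideal_def)
      have mx: "x - mpoly_const c \<in> max_ideal n" unfolding c_def using x(1) by (rule minus_constant_term_max_ideal)
      have "\<pi> (mpoly_const (- 1 / c) * (x - mpoly_const c)) \<in> B"
        using B(2) memP idlD(4)[OF is_ideal_max_ideal mx] max_ideal_polys by (meson polys_const subsetD)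
      moreover have "\<pi> (mpoly_const (1 / c) * x) \<in> B"
        using \<pi>m[of "mpoly_const (1 / c)" x] ideal.I_l_closed[OF B(1) x(2)] \<pi>c[of "mpoly_const (1 / c)"] x(1) by simp
      ultimately have "\<pi> (mpoly_const (- 1 / c) * (x - mpoly_const c) + mpoly_const (1 / c) * x) \<in> B"
        using \<pi>a x(1) additive_subgroup.a_closed[OF ideal.axioms(1)[OF B(1)]] by simp
      moreover have "mpoly_const (- 1 / c) * (x - mpoly_const c) + mpoly_const (1 / c) * x = 1"
      proof -
        have "mpoly_const (- 1 / c) * x + mpoly_const (1 / c) * x = 0"
          by (simp flip: mpoly_const_add distrib_right)
        moreover have "mpoly_const (- 1 / c) * mpoly_const c = - 1"
          using \<open>c \<noteq> 0\<close> by (simp flip: mpoly_const_mult) (simp add: mpoly_const_def single_uminus)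
        ultimately show ?thesis by (simp add: right_diff_distrib)
      qed
      ultimately show ?thesis using ideal.one_imp_carrier[OF B(1)] \<pi>1 by simp
    qed (use B(2) in blast)
  qed
  have prime: "primeideal P Q" using max by (rule Q.maximalideal_prime)
  interpret PL: prime_localization Q P
    by (intro prime_localization.intro prime_localization_axioms.intro prime Q.is_cring)
  let ?L = "localization Q (carrier Q - P)"
  have inj_dim: "finite_self_injective_dimension ?L" and noeth: "noetherian_ring Q"
    using gor max by (auto simp: gorenstein_ring_def Q_def S_def)
  \<comment> \<open>Read off from the resolution: its terms are modules over the localization, and
    \<open>module\<close> includes \<open>cring\<close>.\<close>
  have L_cring: "cring ?L"
    using inj_dim unfolding finite_self_injective_dimension_def injective_resolution_def
    by (auto intro: module.axioms(1))
  have zP: "\<pi> z \<in> P" using memP[OF zp] homogeneous_max_ideal[OF z(1)] by simp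
  have z_nonzerodivisor: "x = \<zero>\<^bsub>Q\<^esub>" if x: "x \<in> carrier Q" "\<pi> z \<otimes>\<^bsub>Q\<^esub> x = \<zero>\<^bsub>Q\<^esub>" for x
  proof -
    obtain y where y: "y \<in> polys n" "x = \<pi> y" using x(1) carrQ by blast
    have "\<pi> (z * y) = \<pi> 0" using x(2) y zp \<pi>m Q0 by simp
    then have "z * y \<in> I" using \<pi>_eq[of "z * y" 0] zp y(1) by simp
    then have "y \<in> I" using z(2) y(1) by (simp add: nonzerodivisor_def)
    then show ?thesis using \<pi>_eq[of y 0] y Q0 by simp
  qed
  have nil: "\<exists>b\<in>carrier Q - B. \<forall>m\<in>P. m \<otimes>\<^bsub>Q\<^esub> b \<in> B"
    if B: "ideal B Q" "\<pi> z \<in> B" "B \<noteq> carrier Q" for B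
  proof -
    define C where "C = {x \<in> polys n. \<pi> x \<in> B}"
    have C: "is_ideal n C"
      using ideal.I_l_closed[OF B(1)] additive_subgroup.a_closed[OF ideal.axioms(1)[OF B(1)]]
        additive_subgroup.zero_closed[OF ideal.axioms(1)[OF B(1)]]
      unfolding is_ideal_def C_def by (auto simp: \<pi>a \<pi>m \<pi>c simp flip: Q0)
    have "I \<subseteq> C"
    proof
      fix x assume x: "x \<in> I"
      then have "\<pi> x = \<pi> 0" "x \<in> polys n" using \<pi>_eq[of x 0] idlD(1)[OF Ii x] by auto
      then show "x \<in> C" using idlD(2)[OF C] by (simp add: C_def)
    qed
    then have adjC: "adjoin n I z \<subseteq> C" using C B(2) zp by (intro adjoin_least) (auto simp: C_def)
    \<comment> \<open>\<open>C\<close> need not be homogeneous, but it contains all forms of degree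
      above \<open>a\<close>. In the last degree with a form outside \<open>C\<close>, such a form
      is a socle element modulo \<open>C\<close>.\<close>
    define R where "R = {r. \<not> homogeneous_part n r \<subseteq> C}"
    have "1 \<notin> C" using ideal.one_imp_carrier[OF B(1)] B(3) \<pi>1 by (auto simp: C_def)
    then have "0 \<in> R" using homogeneous_1[of n] by (auto simp: R_def)
    have fin: "finite R"
    proof (rule finite_subset)
      show "R \<subseteq> {..a}"
      proof
        fix r assume "r \<in> R"
        then have "\<not> a < r" using top[of r] adjC by (auto simp: R_def)
        then show "r \<in> {..a}" by simp
      qed
    qed simp
    define r where "r = Max R"
    have "r \<in> R" unfolding r_def using fin \<open>0 \<in> R\<close> by (intro Max_in) auto
    then obtain w where w: "w \<in> homogeneous_part n r" "w \<notin> C" by (auto simp: R_def)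
    have wp: "w \<in> polys n" using w(1) by simp
    have "w \<in> socle n C"
    proof (rule socle_memI[OF C wp])
      fix p and y :: "'k mpoly" assume "1 \<le> p" "y \<in> homogeneous_part n p"
      then have "w * y \<in> homogeneous_part n (r + p)" "r + p \<notin> R"
        using homogeneous_mult[OF w(1)] Max_ge[OF fin, of "r + p"] by (auto simp: r_def)
      then show "w * y \<in> C" by (auto simp: R_def)
    qed
    then have "m \<otimes>\<^bsub>Q\<^esub> \<pi> w \<in> B" if "m \<in> P" for m
      using that wp by (auto simp: P_def socle_def C_def \<pi>m max_ideal_polys)
    moreover have "\<pi> w \<in> carrier Q - B" using w(2) wp \<pi>c by (simp add: C_def)
    ultimately show ?thesis by blast
  qed
  have PIdl_iff: "\<pi> x \<in> PIdl\<^bsub>Q\<^esub> (\<pi> z) \<longleftrightarrow> x \<in> adjoin n I z" if x: "x \<in> polys n" for x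
  proof
    assume "\<pi> x \<in> PIdl\<^bsub>Q\<^esub> (\<pi> z)"
    then obtain y where y: "y \<in> polys n" "\<pi> x = \<pi> y \<otimes>\<^bsub>Q\<^esub> \<pi> z" by (auto simp: cgenideal_def carrQ)
    then have "x - y * z \<in> I" using \<pi>_eq[OF x, of "y * z"] \<pi>m zp by simp
    then have "(x - y * z) + z * y \<in> adjoin n I z" using y(1) by (rule adjI)
    then show "x \<in> adjoin n I z" by (simp add: mult.commute)
  next
    assume "x \<in> adjoin n I z"
    then obtain i y where y: "i \<in> I" "y \<in> polys n" "x = i + z * y" by (auto simp: adjoin_def)
    then have "\<pi> x = \<pi> (y * z)" using \<pi>_eq[OF x, of "y * z"] zp by (simp add: mult.commute)
    then show "\<pi> x \<in> PIdl\<^bsub>Q\<^esub> (\<pi> z)" using y(2) zp \<pi>m \<pi>c by (auto simp: cgenideal_def)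
  qed
  have adjoin_is_ideal: "is_ideal n (adjoin n I z)" by (rule is_ideal_adjoin[OF Ii zp])
  show ?thesis
    unfolding socle_le_1_def
  proof (intro ballI)
    fix x y assume xy: "x \<in> socle n (adjoin n I z)" "y \<in> socle n (adjoin n I z)"
    have socle: "m \<otimes>\<^bsub>Q\<^esub> \<pi> s \<in> PIdl\<^bsub>Q\<^esub> (\<pi> z)" if s: "s \<in> socle n (adjoin n I z)" and m: "m \<in> P" for s m
    proof -
      obtain m' where m': "m' \<in> max_ideal n" "m = \<pi> m'" using m by (auto simp: P_def)
      have "m' * s \<in> adjoin n I z" "s \<in> polys n" "m' \<in> polys n" using s m'(1) by (auto simp: socle_def max_ideal_polys)
      then show ?thesis using PIdl_iff[of "m' * s"] by (simp add: m'(2) \<pi>m)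
    qed
    have xyp: "x \<in> polys n" "y \<in> polys n" using xy by (auto simp: socle_def)
    have "\<exists>a\<in>carrier Q. \<exists>b\<in>carrier Q. (a \<notin> P \<or> b \<notin> P) \<and>
        a \<otimes>\<^bsub>Q\<^esub> \<pi> x \<oplus>\<^bsub>Q\<^esub> b \<otimes>\<^bsub>Q\<^esub> \<pi> y \<in> PIdl\<^bsub>Q\<^esub> (\<pi> z)"
      by (rule PL.socle_dependent_localization[OF L_cring noeth zP z_nonzerodivisor nil inj_dim
            \<pi>c[OF xyp(1)] \<pi>c[OF xyp(2)] socle[OF xy(1)] socle[OF xy(2)]])
    then obtain a b where ab: "a \<in> carrier Q" "b \<in> carrier Q" "a \<notin> P \<or> b \<notin> P"
      "a \<otimes>\<^bsub>Q\<^esub> \<pi> x \<oplus>\<^bsub>Q\<^esub> b \<otimes>\<^bsub>Q\<^esub> \<pi> y \<in> PIdl\<^bsub>Q\<^esub> (\<pi> z)" by blast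
    obtain p q where pq: "p \<in> polys n" "q \<in> polys n" "a = \<pi> p" "b = \<pi> q"
      using ab(1,2) unfolding carrQ by (elim imageE) simp
    have "\<pi> (p * x + q * y) \<in> PIdl\<^bsub>Q\<^esub> (\<pi> z)" using ab(4) pq xyp by (simp add: \<pi>a \<pi>m)
    then have mem: "p * x + q * y \<in> adjoin n I z" using PIdl_iff pq(1,2) xyp by simp
    have nz: "lookup p 0 \<noteq> 0 \<or> lookup q 0 \<noteq> 0" 
      using ab(3) pq memP[OF pq(1)] memP[OF pq(2)] unfolding max_ideal_def by blast
    have mmp: "p - mpoly_const (lookup p 0) \<in> max_ideal n" "q - mpoly_const (lookup q 0) \<in> max_ideal n"
      using pq(1,2) by (simp_all add: minus_constant_term_max_ideal)
    have "(p - mpoly_const (lookup p 0)) * x + (q - mpoly_const (lookup q 0)) * y \<in> adjoin n I z"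
      using xy mmp by (intro idlD(3)[OF adjoin_is_ideal]) (auto simp: socle_def)
    then have "(p * x + q * y) - ((p - mpoly_const (lookup p 0)) * x + (q - mpoly_const (lookup q 0)) * y) \<in> adjoin n I z"
      by (rule is_ideal_diff[OF adjoin_is_ideal mem])
    then have "mpoly_const (lookup p 0) * x + mpoly_const (lookup q 0) * y \<in> adjoin n I z"
      by (simp add: algebra_simps)
    with nz show "\<exists>a b. (a \<noteq> 0 \<or> b \<noteq> 0) \<and> mpoly_const a * x + mpoly_const b * y \<in> adjoin n I z" by blast
  qed
qed

theorem theorem1p4:
  fixes n :: nat
    and f :: "nat \<Rightarrow> ('k::field_char_0) mpoly"
    and d :: "nat \<Rightarrow> nat"
    and S :: "'k mpoly ring"
    and J I :: "'k mpoly set"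
    and G F :: "int poly"
  assumes S_def: "S = mpoly_ring n"
    and homogeneous: "\<And>i. i \<le> n \<Longrightarrow> f i \<in> homogeneous_part n (d i)"
    and J_def: "J = genideal S (f ` {0..n})"
    and dim_one: "krull_dim (S Quot J) = 1"
    and regular: "regular_sequence S (map f [1..<n + 1])"
    and I_def: "I = saturation S J (irrelevant_ideal n)"
    and G: "hilbert_series n J * (1 - fps_X) = fps_of_poly G"
    and F: "hilbert_series n I * (1 - fps_X) = fps_of_poly F"
  shows "laurent_eval G fls_X =
           (1 - fls_X ^ d 0) * (\<Prod>j = 1..n. \<Sum>k < d j. fls_X ^ k)
           + fls_X_intpow (int (\<Sum>i = 0..n. d i) - int n) * laurent_eval F fls_X_inv
         \<and> (gorenstein_ring (S Quot I) \<longrightarrow>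
           laurent_eval G fls_X =
             (1 - fls_X ^ d 0) * (\<Prod>j = 1..n. \<Sum>k < d j. fls_X ^ k)
             + fls_X_intpow (int (\<Sum>i = 0..n. d i) - int n - int (Polynomial.degree F))
               * laurent_eval F fls_X)"
proof
  note assms' = homogeneous J_def[unfolded S_def] regular[unfolded S_def] I_def[unfolded S_def] G F
  define a where "a = (\<Sum>j\<in>{1..n}. d j - 1)"
  note H = hilbert_series_saturation[OF assms', folded a_def]
  have d1: "1 \<le> d j" if "j \<in> {1..n}" for j using degree_pos[OF assms' that] .
  \<comment> \<open>As every d_j here is positive, the truncated differences in \<open>a\<close>
    lose nothing, and the exponent of t becomes d_0 + a.\<close>
  have "(\<Sum>j\<in>{1..n}. d j) = (\<Sum>j\<in>{1..n}. (d j - 1) + 1)" 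
  proof (rule sum.cong[OF refl])
    fix j assume "j \<in> {1..n}"
    then show "d j = (d j - 1) + 1" using d1[of j] by simp
  qed
  also have "\<dots> = a + n" by (simp only: a_def sum.distrib) simp
  finally have "(\<Sum>i = 0..n. d i) = d 0 + (a + n)" by (simp add: sum.atLeast_Suc_atMost)
  then have e: "int (\<Sum>i = 0..n. d i) - int n = int (d 0) + int a" by simp
  have prod: "fps_to_fls (fps_of_poly (\<Prod>j\<in>{1..n}. geom_poly (d j))) = (\<Prod>j = 1..n. \<Sum>k < d j. fls_X ^ k)"
  proof -
    have "fps_to_fls (\<Prod>j\<in>A. g j) = (\<Prod>j\<in>A. fps_to_fls (g j))" for A :: "nat set" and g :: "nat \<Rightarrow> int fps"
      by (induction A rule: infinite_finite_induct) (auto simp: fls_times_fps_to_fls)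
    then show ?thesis
      by (simp add: fps_of_poly_prod geom_poly_fps fps_to_fls_sum fps_to_fls_power)
  qed
  have X: "fls_X_intpow (int (d 0) + int a) = (fls_X ^ d 0 * fls_X_intpow (int a) :: int fls)"
    unfolding fls_X_power_conv_shift_1 by (simp only: fls_X_intpow_times_fls_X_intpow)
  show part1: "laurent_eval G fls_X =
           (1 - fls_X ^ d 0) * (\<Prod>j = 1..n. \<Sum>k < d j. fls_X ^ k)
           + fls_X_intpow (int (\<Sum>i = 0..n. d i) - int n) * laurent_eval F fls_X_inv"
  proof -
    let ?A = "Abs_fps (\<lambda>p. if p \<le> a then Polynomial.coeff F (a - p) else 0)"
    have "laurent_eval G fls_X = fps_to_fls (fps_of_poly (\<Prod>j\<in>{1..n}. geom_poly (d j))) * fps_to_fls (1 - fps_X ^ d 0)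
        + fps_to_fls (fps_X ^ d 0) * fps_to_fls ?A"
      by (simp only: laurent_eval_X H(1) fps_to_fls_plus fls_times_fps_to_fls)
    also have "\<dots> = (1 - fls_X ^ d 0) * (\<Prod>j = 1..n. \<Sum>k < d j. fls_X ^ k) + fls_X ^ d 0 * fps_to_fls ?A"
      by (simp only: prod fps_to_fls_minus fps_one_to_fls fps_to_fls_power fps_X_to_fls mult.commute)
    also have "fls_X ^ d 0 * fps_to_fls ?A =
        fls_X_intpow (int (\<Sum>i = 0..n. d i) - int n) * laurent_eval F fls_X_inv"
      by (simp only: e X mult.assoc laurent_eval_X_inv[OF H(2)])
    finally show ?thesis .
  qed
  show "gorenstein_ring (S Quot I) \<longrightarrow> laurent_eval G fls_X =
             (1 - fls_X ^ d 0) * (\<Prod>j = 1..n. \<Sum>k < d j. fls_X ^ k)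
             + fls_X_intpow (int (\<Sum>i = 0..n. d i) - int n - int (Polynomial.degree F))
               * laurent_eval F fls_X"
  proof
    assume gor: "gorenstein_ring (S Quot I)"
    let ?s = "Polynomial.degree F"
    obtain z where z: "z \<in> homogeneous_part n 1" "nonzerodivisor n z I" "homogeneous_ideal n I"
      and hI: "\<And>p. int (hilb n (adjoin n I z) p) = Polynomial.coeff F p" using H(3) by blast
    have B: "homogeneous_ideal n (adjoin n I z)" using z by (intro homogeneous_ideal_adjoin)
    have top: "homogeneous_part n p \<subseteq> adjoin n I z" if "?s < p" for p
      using hI[of p] coeff_eq_0[OF that] hilb_eq_0_iff[OF homogeneous_ideal_is_ideal[OF B], of p] by simp
    \<comment> \<open>For the unit ideal \<open>F\<close> is zero; otherwise the Gorenstein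
      hypothesis supplies the socle bound.\<close>
    have sym: "Polynomial.coeff F (?s - i) = Polynomial.coeff F i" if i: "i \<le> ?s" for i
    proof (cases "1 \<in> I")
      case True
      then have "homogeneous_part n p \<subseteq> adjoin n I z" for p
        using idlD(4)[OF homogeneous_ideal_is_ideal[OF z(3)] True] adjoin_superset[of I n z] homogeneous_polys by force
      then have "Polynomial.coeff F p = 0" for p
        using hI[of p] hilb_eq_0_iff[OF homogeneous_ideal_is_ideal[OF B], of p] by simp
      then show ?thesis by simp
    next
      case False
      have "socle_le_1 n (adjoin n I z)"
        using gor[unfolded S_def] z(3) False z(1,2) top by (rule gorenstein_socle)
      then show ?thesis using socle_le_1_imp_symmetric[OF B _ hI i] by blast
    qed
    \<comment> \<open>Symmetry of the coefficients means t^s F(1/t) = F(t) for s = deg F, which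
      converts the first formula into the second.\<close>
    have "fls_X_intpow (int ?s) * laurent_eval F fls_X_inv = laurent_eval F fls_X"
    proof -
      have "Abs_fps (\<lambda>i. if i \<le> ?s then Polynomial.coeff F (?s - i) else 0) = fps_of_poly F"
        using sym by (intro fps_ext) (auto simp: coeff_eq_0)
      then show ?thesis by (simp only: laurent_eval_X laurent_eval_X_inv[OF order_refl])
    qed
    then have "fls_X_intpow (int (\<Sum>i = 0..n. d i) - int n - int ?s) * laurent_eval F fls_X =
        (fls_X_intpow (int (\<Sum>i = 0..n. d i) - int n - int ?s) * fls_X_intpow (int ?s)) * laurent_eval F fls_X_inv"
      by (simp only: mult.assoc)
    also have "\<dots> = fls_X_intpow (int (\<Sum>i = 0..n. d i) - int n) * laurent_eval F fls_X_inv"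
      by (simp only: fls_X_intpow_times_fls_X_intpow diff_add_cancel)
    finally show "laurent_eval G fls_X =
             (1 - fls_X ^ d 0) * (\<Prod>j = 1..n. \<Sum>k < d j. fls_X ^ k)
             + fls_X_intpow (int (\<Sum>i = 0..n. d i) - int n - int ?s) * laurent_eval F fls_X"
      using part1 by simp
  qed
qed

end
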